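(* Let $\mathcal A$ be a line arrangement in $\mathbb P^2$ and let $p$ be a point of $\mathbb P^2$ not lying on any line of $\mathcal A$. Let $\mathcal B(\mathcal A,p)$ be the line arrangement obtained from $\mathcal A$ by adding all the lines determined by $p$ and each of the multiple points of $\mathcal A$ (each such line counted once, even if it passes through several multiple points). Then $\mathcal B(\mathcal A,p)$ is free and its complement $\mathbb P^2\setminus \mathcal B(\mathcal A,p)$ is a $K(\pi,1)$-space.
   Context: A line arrangement is a finite set of distinct lines, defined by the product $f$ of their linear forms; a multiple point is a point lying on at least two lines of $\mathcal A$. The arrangement is free if $AR(f)=\{(a,b,c)\in\mathbb C[x,y,z]^3: af_x+bf_y+cf_z=0\}$ is a free $\mathbb C[x,y,z]$-module.
   Formalization: The line arrangement is assumed nonempty; for the empty arrangement the complement is the whole projective plane, which has nontrivial second homotopy group and so is not a K(π,1)-space. *)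

theory Defs
  imports "HOL-Analysis.Analysis" "HOL-Library.Poly_Mapping" "HOL-Library.Product_Plus"
begin

text \<open>Monomials x^i y^j z^k are encoded by exponent triples (i,j,k); polynomials are
  finitely supported maps from exponent triples to complex coefficients (with the
  convolution product of Poly_Mapping this is the ring C[x,y,z]).\<close>

type_synonym mpoly3 = "(nat \<times> nat \<times> nat) \<Rightarrow>\<^sub>0 complex"

definition dX :: "mpoly3 \<Rightarrow> mpoly3" where
  "dX p = (\<Sum>m\<in>Poly_Mapping.keys p. Poly_Mapping.single (fst m - 1, fst (snd m), snd (snd m))
                                  (of_nat (fst m) * Poly_Mapping.lookup p m))"

definition dY :: "mpoly3 \<Rightarrow> mpoly3" where
  "dY p = (\<Sum>m\<in>Poly_Mapping.keys p. Poly_Mapping.single (fst m, fst (snd m) - 1, snd (snd m))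
                                  (of_nat (fst (snd m)) * Poly_Mapping.lookup p m))"

definition dZ :: "mpoly3 \<Rightarrow> mpoly3" where
  "dZ p = (\<Sum>m\<in>Poly_Mapping.keys p. Poly_Mapping.single (fst m, fst (snd m), snd (snd m) - 1)
                                  (of_nat (snd (snd m)) * Poly_Mapping.lookup p m))"

definition AR :: "mpoly3 \<Rightarrow> (mpoly3 \<times> mpoly3 \<times> mpoly3) set" where
  "AR f = {(a, b, c). a * dX f + b * dY f + c * dZ f = 0}"

definition smul3 :: "mpoly3 \<Rightarrow> mpoly3 \<times> mpoly3 \<times> mpoly3 \<Rightarrow> mpoly3 \<times> mpoly3 \<times> mpoly3" where
  "smul3 r t = (r * fst t, r * fst (snd t), r * snd (snd t))"

definition free_submodule :: "(mpoly3 \<times> mpoly3 \<times> mpoly3) set \<Rightarrow> bool" where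
  "free_submodule M \<longleftrightarrow> (\<exists>E. finite E \<and> E \<subseteq> M \<and>
      (\<forall>m\<in>M. \<exists>!r. (\<forall>e. e \<notin> E \<longrightarrow> r e = 0) \<and> m = (\<Sum>e\<in>E. smul3 (r e) e)))"

type_synonym ppoint = "(complex ^ 3) set"

definition ppt :: "complex ^ 3 \<Rightarrow> ppoint" where
  "ppt v = {c *s v | c. c \<noteq> 0}"

definition P2 :: "ppoint set" where
  "P2 = {ppt v | v. v \<noteq> 0}"

definition lform :: "complex ^ 3 \<Rightarrow> complex ^ 3 \<Rightarrow> complex" where
  "lform a v = a$1 * v$1 + a$2 * v$2 + a$3 * v$3"

definition pline :: "complex ^ 3 \<Rightarrow> ppoint set" where
  "pline a = {P \<in> P2. \<forall>v\<in>P. lform a v = 0}"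

definition is_line :: "ppoint set \<Rightarrow> bool" where
  "is_line L \<longleftrightarrow> (\<exists>a. a \<noteq> 0 \<and> L = pline a)"

definition line_arrangement :: "ppoint set set \<Rightarrow> bool" where
  "line_arrangement A \<longleftrightarrow> finite A \<and> (\<forall>L\<in>A. is_line L)"

definition multiple_point :: "ppoint set set \<Rightarrow> ppoint \<Rightarrow> bool" where
  "multiple_point A q \<longleftrightarrow> q \<in> P2 \<and> card {L\<in>A. q \<in> L} \<ge> 2"

definition Barr :: "ppoint set set \<Rightarrow> ppoint \<Rightarrow> ppoint set set" where
  "Barr A p = A \<union> {L. is_line L \<and> p \<in> L \<and> (\<exists>q. multiple_point A q \<and> q \<in> L)}"

definition linpoly :: "complex ^ 3 \<Rightarrow> mpoly3" where
  "linpoly a = Poly_Mapping.single (1,0,0) (a$1) + Poly_Mapping.single (0,1,0) (a$2)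
             + Poly_Mapping.single (0,0,1) (a$3)"

definition defpoly :: "ppoint set set \<Rightarrow> mpoly3" where
  "defpoly A = (\<Prod>L\<in>A. linpoly (SOME a. a \<noteq> 0 \<and> L = pline a))"

definition free_arrangement :: "ppoint set set \<Rightarrow> bool" where
  "free_arrangement A \<longleftrightarrow> free_submodule (AR (defpoly A))"

text \<open>Quotient topology on P2 from C^3 minus 0 (points are the classes of nonzero vectors).\<close>
definition P2top :: "ppoint topology" where
  "P2top = topology (\<lambda>U. U \<subseteq> P2 \<and> openin (top_of_set (- {0 :: complex ^ 3})) (\<Union>U))"

definition arr_complement :: "ppoint set set \<Rightarrow> ppoint topology" where
  "arr_complement A = subtopology P2top (P2 - \<Union>A)"

text \<open>K(pi,1): path-connected and all higher homotopy groups vanish, i.e. every map from an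
  n-sphere, n >= 2, is null-homotopic.\<close>
definition K_pi_1 :: "'a topology \<Rightarrow> bool" where
  "K_pi_1 X \<longleftrightarrow> path_connected_space X \<and>
     (\<forall>n\<ge>2. \<forall>f. continuous_map (nsphere n) X f \<longrightarrow>
        (\<exists>c. homotopic_with (\<lambda>_. True) (nsphere n) X f (\<lambda>_. c)))"

end

theory Submission
  imports Defs "HOL-Complex_Analysis.Complex_Analysis"
    "HOL-Computational_Algebra.Polynomial_Factorial" "HOL-Computational_Algebra.Field_as_Ring"
begin

text \<open>Call a point on some line of an arrangement modular if the intersection of any two lines missing it
  lies on a line of the arrangement through it. The point \<open>p\<close> is modular for \<open>\<B>(\<A>,p)\<close>, or, if \<open>\<A>\<close> is a single
  line, any point of that line is. Choose coordinates in which the modular point is \<open>[0:0:1]\<close>: the lines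
  through it are given by forms \<open>h\<^sub>k(x,y)\<close>, the others by \<open>z = r\<^sub>i(x,y)\<close>, and each \<open>r\<^sub>i - r\<^sub>j\<close> is a multiple of
  some \<open>h\<^sub>k\<close>.

  Freeness: the logarithmic derivations are spanned by the Euler field, the field
  \<open>\<Prod>\<^sub>i(z - r\<^sub>i) \<partial>\<^sub>z\<close> and a field extending the Hamiltonian field of \<open>\<Prod>\<^sub>k h\<^sub>k\<close>, whose last component is
  obtained by Newton interpolation. Subtracting multiples of the Euler field from the latter two gives
  a basis of the derivations killing the defining polynomial.

  Asphericity: projection from the modular point fibres the complement over a punctured plane, with
  punctured planes as fibres. Homotopies of the base lift, since small motions of the punctures are followed
  by explicit small perturbations of the identity. A map from a sphere of dimension at least two to a
  plane open set is contracted by taking logarithms of \<open>f - a\<close> until the union of the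
  lifted pieces of a finite cover of the image is simply connected.\<close>

text \<open>Otherwise \<open>$\<close> is ambiguous between vector components and power series coefficients.\<close>
unbundle no Formal_Power_Series.fps_syntax

section \<open>Interpolation and linear forms\<close>

text \<open>Modularity serves both halves through one fact: every difference
  \<open>r i - r j\<close> is a unit times some \<open>h k\<close>. Algebraically, this makes the
  interpolation data compatible; topologically, it keeps the punctures of a fibre distinct as long
  as the base point avoids the zeros of the \<open>h k\<close>. That the modular point lies on a
  line of the arrangement is used twice: such a line becomes the line at infinity of an affine chart
  containing the whole complement, and the degree of the product of the \<open>h k\<close> is
  nonzero, so that Euler's identity can be divided by it. The algebra takes place in iterated
  univariate polynomials, where restriction to \<open>z = r i\<close> is evaluation and the
  coefficients in \<open>x, y\<close> form a factorial ring; a linear change of coordinates carries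
  the result back to \<open>mpoly3\<close>. The topology uses no exact sequence. A sphere map is
  contracted in the base, the homotopy is lifted, and the resulting map lies in one fibre. Base and
  fibre are both open in the plane, so one theorem contracts in both. Its main demand on the sphere
  is that nonvanishing complex functions have logarithms, which fails for the circle.\<close>

lemma prod_linear_dvd:
  fixes r :: "'i \<Rightarrow> 'a::idom"
  assumes "finite I" "inj_on r I" "\<And>i. i \<in> I \<Longrightarrow> poly u (r i) = 0"
  shows "(\<Prod>i\<in>I. [:- r i, 1:]) dvd u"
  using assms
proof (induction I arbitrary: u rule: finite_induct)
  case (insert i I)
  have "[:- r i, 1:] dvd u"
    using insert.prems by (simp add: poly_eq_0_iff_dvd)
  then obtain w where w: "u = [:- r i, 1:] * w" by (elim dvdE)
  have "poly w (r j) = 0" if "j \<in> I" for j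
  proof -
    have "r j \<noteq> r i" using insert.prems(1) insert.hyps that by (auto simp: inj_on_def)
    moreover have "poly u (r j) = 0" using insert.prems that by auto
    ultimately show ?thesis by (simp add: w)
  qed
  then have "(\<Prod>i\<in>I. [:- r i, 1:]) dvd w"
    using insert by (intro insert.IH) auto
  then show ?case using insert.hyps unfolding w by (simp del: mult_pCons_left)
qed auto

lemma prod_pairwise_coprime_dvd:
  fixes D :: "'k \<Rightarrow> 'a::semiring_gcd"
  assumes "finite K" "\<And>k. k \<in> K \<Longrightarrow> D k dvd e"
    "\<And>k l. k \<in> K \<Longrightarrow> l \<in> K \<Longrightarrow> k \<noteq> l \<Longrightarrow> coprime (D k) (D l)"
  shows "(\<Prod>k\<in>K. D k) dvd e"
  using assms
proof (induction K rule: finite_induct)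
  case (insert k K)
  have "coprime (D k) (\<Prod>k\<in>K. D k)"
    by (rule prod_coprime_right) (use insert in auto)
  with insert show ?case by (auto intro!: divides_mult)
qed auto

text \<open>Newton interpolation over a factorial ring: the obstruction
  \<open>poly c (r j) - t j\<close> is divisible by each \<open>h k\<close> to the number of nodes \<open>i\<close> with
  \<open>r j - r i\<close> associated to \<open>h k\<close>, because along such a pencil the data are those of an affine map.\<close>
lemma pencil_interpolation:
  fixes r t :: "'i \<Rightarrow> 'a::factorial_ring_gcd" and h q :: "'k \<Rightarrow> 'a"
  assumes "finite J"
    and inj: "inj_on r J"
    and r: "\<And>i j. i \<in> J \<Longrightarrow> j \<in> J \<Longrightarrow> i \<noteq> j \<Longrightarrow> r i - r j = u i j * h (\<kappa> i j)"
    and u: "\<And>i j. i \<in> J \<Longrightarrow> j \<in> J \<Longrightarrow> i \<noteq> j \<Longrightarrow> is_unit (u i j)"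
    and t: "\<And>i j. i \<in> J \<Longrightarrow> j \<in> J \<Longrightarrow> i \<noteq> j \<Longrightarrow> t i - t j = u i j * (h (\<kappa> i j) * q (\<kappa> i j))"
    and cop: "\<And>i j i' j'. i \<in> J \<Longrightarrow> j \<in> J \<Longrightarrow> i \<noteq> j \<Longrightarrow> i' \<in> J \<Longrightarrow> j' \<in> J \<Longrightarrow> i' \<noteq> j' \<Longrightarrow>
       \<kappa> i j \<noteq> \<kappa> i' j' \<Longrightarrow> coprime (h (\<kappa> i j)) (h (\<kappa> i' j'))"
  shows "\<exists>c. \<forall>i\<in>J. poly c (r i) = t i"
  using assms
proof (induction J rule: finite_induct)
  case (insert j J)
  have "\<exists>c. \<forall>i\<in>J. poly c (r i) = t i"
    by (rule insert.IH) (use insert.prems in \<open>auto simp: inj_on_def\<close>)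
  then obtain c where c: "\<And>i. i \<in> J \<Longrightarrow> poly c (r i) = t i" by blast
  define e where "e = poly c (r j) - t j"
  define I where "I k = {i\<in>J. \<kappa> i j = k}" for k
  define K where "K = (\<lambda>i. \<kappa> i j) ` J"
  have neq: "i \<noteq> j" if "i \<in> J" for i using insert.hyps that by auto
  have D: "(\<Prod>i\<in>I k. r j - r i) dvd e" for k
  proof -
    \<comment> \<open>Compare \<open>c\<close> with the affine map of slope \<open>q k\<close>
      through the new node. That map takes the values \<open>t i\<close> on \<open>I k\<close>, so
      \<open>w\<close> vanishes there, while its value at \<open>r j\<close> is the obstruction
      \<open>e\<close>.\<close>
    define w where "w = c - [:t j:] - [:- r j, 1:] * [:q k:]"
    have "poly w (r i) = 0" if "i \<in> I k" for i
    proof -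
      have i: "i \<in> J" "\<kappa> i j = k" using that by (auto simp: I_def)
      have "r i - r j = u i j * h k" "t i - t j = u i j * (h k * q k)"
        using insert.prems(2,4)[of i j] i neq[of i] by auto
      then have "t i - t j = (r i - r j) * q k" by (simp add: mult_ac)
      then show ?thesis using c[OF i(1)] by (simp add: w_def algebra_simps)
    qed
    then have "(\<Prod>i\<in>I k. [:- r i, 1:]) dvd w"
      using insert.hyps insert.prems(1)
      by (intro prod_linear_dvd) (auto simp: I_def inj_on_def)
    then have "poly (\<Prod>i\<in>I k. [:- r i, 1:]) (r j) dvd poly w (r j)"
      by (metis dvd_def poly_mult)
    moreover have "poly w (r j) = e" by (simp add: w_def e_def)
    ultimately show ?thesis by (simp add: poly_prod)
  qed
  have "coprime (\<Prod>i\<in>I k. r j - r i) (\<Prod>i\<in>I l. r j - r i)" if "k \<in> K" "l \<in> K" "k \<noteq> l" for k l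
  proof (intro prod_coprime_left prod_coprime_right)
    fix i i' assume "i \<in> I k" "i' \<in> I l"
    then have i: "i \<in> J" "\<kappa> i j = k" "i' \<in> J" "\<kappa> i' j = l" by (auto simp: I_def)
    have "coprime (h k) (h l)"
      using insert.prems(5)[of i j i' j] i neq that by auto
    moreover have "r i - r j = u i j * h k" "is_unit (u i j)" "r i' - r j = u i' j * h l" "is_unit (u i' j)"
      using insert.prems(2,3)[of i j] insert.prems(2,3)[of i' j] i neq by auto
    ultimately have "coprime (r i - r j) (r i' - r j)"
      by (simp add: is_unit_right_imp_coprime is_unit_left_imp_coprime)
    then show "coprime (r j - r i) (r j - r i')"
      by (metis coprime_minus_left_iff coprime_minus_right_iff minus_diff_eq)
  qed
  then have "(\<Prod>k\<in>K. \<Prod>i\<in>I k. r j - r i) dvd e"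
    by (rule prod_pairwise_coprime_dvd[rotated 2]) (use D insert.hyps(1) in \<open>simp_all add: K_def\<close>)
  also have "(\<Prod>k\<in>K. \<Prod>i\<in>I k. r j - r i) = (\<Prod>i\<in>J. r j - r i)"
    unfolding K_def I_def using insert.hyps by (intro prod.image_gen [symmetric])
  finally obtain w where w: "e = (\<Prod>i\<in>J. r j - r i) * w" by (elim dvdE)
  \<comment> \<open>Newton's correction term: it vanishes at the old nodes and equals
    \<open>e\<close> at the new one.\<close>
  have "poly (c - (\<Prod>i\<in>J. [:- r i, 1:]) * [:w:]) (r i) = t i" if "i \<in> insert j J" for i
  proof (cases "i = j")
    case True
    then show ?thesis using w by (simp add: poly_prod e_def diff_eq_eq add.commute mult.commute)
  next
    case False
    then have "i \<in> J" using that by auto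
    then have "(\<Prod>k\<in>J. r i - r k) = 0" using insert.hyps by auto
    then show ?thesis using c[OF \<open>i \<in> J\<close>] by (simp add: poly_prod)
  qed
  then show ?case by blast
qed auto

text \<open>The innermost variable is x, then y, then z. With z outermost, substituting a form in x
  and y for z is \<open>poly\<close>, and a polynomial without z is a constant one.\<close>

definition cst :: "complex \<Rightarrow> complex poly poly poly" where "cst c = [:[:[:c:]:]:]"

definition lin :: "complex \<Rightarrow> complex \<Rightarrow> complex \<Rightarrow> complex poly poly poly" where
  "lin a b c = [:[:[:0,a:],[:b:]:],[:[:c:]:]:]"


section \<open>Linear forms as prime elements\<close>

lemma prime_elem_linear_monic: "prime_elem ([:r, 1:] :: 'a::idom poly)"
proof (rule prime_elemI)
  \<comment> \<open>Divisibility becomes vanishing at a root, and primality the absence of zero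
    divisors among the values.\<close>
  have dvd: "[:r, 1:] dvd u \<longleftrightarrow> poly u (- r) = 0" for u
    using poly_eq_0_iff_dvd[of u "- r"] by simp
  show "[:r, 1:] dvd u \<or> [:r, 1:] dvd v" if "[:r, 1:] dvd u * v" for u v
    using that by (simp add: dvd)
qed (auto simp: is_unit_poly_iff)

lemma prime_elem_smult:
  assumes "prime_elem p" "is_unit (c :: 'a::{idom_divide,algebraic_semidom})"
  shows "prime_elem (smult c p)"
proof -
  have "is_unit [:c:]" using assms(2) by (simp add: is_unit_const_poly_iff)
  then have "prime_elem ([:c:] * p)" using assms(1) by (subst prime_elem_mult_unit_left) auto
  then show ?thesis by simp
qed

lemma prime_elem_lin_S:
  assumes "a \<noteq> 0 \<or> b \<noteq> 0"
  shows "prime_elem [:[:0,a::complex:],[:b:]:]"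
proof (cases "b = 0")
  case True
  have "prime_elem (smult a [:0, 1:])"
    using True assms by (intro prime_elem_smult prime_elem_linear_monic) (auto simp: is_unit_const_poly_iff dvd_field_iff)
  then show ?thesis using True by (simp add: prime_elem_const_poly_iff)
next
  case False
  have "prime_elem (smult [:b:] [:[:0,a/b:], 1:])"
    using False by (intro prime_elem_smult prime_elem_linear_monic) (auto simp: is_unit_const_poly_iff dvd_field_iff)
  then show ?thesis using False by simp
qed

text \<open>The coefficient of the last variable that occurs is a unit, so the form is associated to
  a monic linear polynomial in that variable; constancy in the later variables preserves
  primality.\<close>

lemma prime_elem_lin:
  assumes "a \<noteq> 0 \<or> b \<noteq> 0 \<or> c \<noteq> 0"
  shows "prime_elem (lin a b c)"
proof (cases "c = 0")
  case True
  then show ?thesis using assms prime_elem_lin_S[of a b]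
    by (auto simp: lin_def prime_elem_const_poly_iff)
next
  case False
  have "prime_elem (smult [:[:c:]:] [:[:[:0,a/c:],[:b/c:]:], 1:])"
    using False by (intro prime_elem_smult prime_elem_linear_monic) (auto simp: is_unit_const_poly_iff dvd_field_iff)
  then show ?thesis using False by (simp add: lin_def)
qed

lemma proportional_if_minors:
  fixes a b c a' b' c' :: "'a::field"
  assumes "a \<noteq> 0 \<or> b \<noteq> 0 \<or> c \<noteq> 0" "a' * b = b' * a" "a' * c = c' * a" "b' * c = c' * b"
  shows "\<exists>s. a' = s * a \<and> b' = s * b \<and> c' = s * c"
proof -
  consider "a \<noteq> 0" | "b \<noteq> 0" | "c \<noteq> 0" using assms(1) by blast
  then show ?thesis
  proof cases
    case 1
    with assms(2-) show ?thesis by (intro exI[of _ "a'/a"]) (auto simp: field_simps)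
  next
    case 2
    with assms(2-) show ?thesis by (intro exI[of _ "b'/b"]) (auto simp: field_simps)
  next
    case 3
    with assms(2-) show ?thesis by (intro exI[of _ "c'/c"]) (auto simp: field_simps)
  qed
qed

lemma proportional_if_zeros:
  fixes a b c a' b' c' :: "'a::field"
  assumes "a \<noteq> 0 \<or> b \<noteq> 0 \<or> c \<noteq> 0"
    and z: "\<And>x y z. a * x + b * y + c * z = 0 \<Longrightarrow> a' * x + b' * y + c' * z = 0"
  shows "\<exists>s. a' = s * a \<and> b' = s * b \<and> c' = s * c"
  by (rule proportional_if_minors)
    (use assms(1) z[of b "-a" 0] z[of c 0 "-a"] z[of 0 c "-b"] in \<open>simp_all add: mult.commute\<close>)

text \<open>Divisibility makes the zeros of the first form zeros of the second, and a linear form is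
  determined by its zeros up to a factor.\<close>

lemma lin_dvd_linD:
  assumes "lin a b c dvd lin a' b' c'" "a \<noteq> 0 \<or> b \<noteq> 0 \<or> c \<noteq> 0" 
  shows "\<exists>s. a' = s * a \<and> b' = s * b \<and> c' = s * c"
proof (rule proportional_if_zeros[OF assms(2)])
  fix x y z :: complex
  define ev where "ev P = poly (poly (poly P [:[:z:]:]) [:y:]) x" for P
  have ev: "ev (lin a b c) = a * x + b * y + c * z" for a b c
    by (simp add: ev_def lin_def algebra_simps)
  from assms(1) obtain w where "lin a' b' c' = lin a b c * w" by (elim dvdE)
  then have "ev (lin a' b' c') = ev (lin a b c) * ev w" by (simp add: ev_def)
  moreover assume "a * x + b * y + c * z = 0"
  ultimately show "a' * x + b' * y + c' * z = 0" by (simp add: ev)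
qed

lemma prime_elem_dvd_prodD:
  assumes "prime_elem p" "finite I" "p dvd (\<Prod>i\<in>I. f i)"
  shows "\<exists>i\<in>I. p dvd f i"
  using assms(2,3)
proof (induction I rule: finite_induct)
  case empty
  then show ?case using assms(1) by (simp add: prime_elem_def)
next
  case (insert i I)
  then show ?case using assms(1) by (auto dest: prime_elem_dvd_multD)
qed

text \<open>The sum is the product of the \<open>L i\<close> times the sum of the fractions
  \<open>d i / L i\<close>. Modulo \<open>L i\<close> only the summand of index \<open>i\<close>
  survives, and \<open>L i\<close> is prime to the other factors, so it must divide
  \<open>d i\<close>.\<close>

lemma log_form_iff:
  fixes L d :: "'i \<Rightarrow> 'a::idom"
  assumes "finite B" and prime: "\<And>i. i \<in> B \<Longrightarrow> prime_elem (L i)"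
    and ndvd: "\<And>i j. i \<in> B \<Longrightarrow> j \<in> B \<Longrightarrow> i \<noteq> j \<Longrightarrow> \<not> L i dvd L j"
  shows "(\<Sum>i\<in>B. d i * (\<Prod>j\<in>B-{i}. L j)) = 0 \<longleftrightarrow>
    (\<exists>q. (\<forall>i\<in>B. d i = q i * L i) \<and> (\<Sum>i\<in>B. q i) = 0)"
proof -
  have eq: "(\<Sum>i\<in>B. d i * (\<Prod>j\<in>B-{i}. L j)) = (\<Sum>i\<in>B. q i) * (\<Prod>j\<in>B. L j)"
    if "\<forall>i\<in>B. d i = q i * L i" for q
    unfolding sum_distrib_right
  proof (rule sum.cong)
    fix i assume "i \<in> B"
    then have "(\<Prod>j\<in>B. L j) = L i * (\<Prod>j\<in>B-{i}. L j)" using assms(1) by (simp add: prod.remove)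
    then show "d i * (\<Prod>j\<in>B-{i}. L j) = q i * (\<Prod>j\<in>B. L j)" using that \<open>i \<in> B\<close> by simp
  qed auto
  have nz: "(\<Prod>j\<in>B. L j) \<noteq> 0" using assms(1) prime by (auto simp: prime_elem_def)
  have "\<exists>q. \<forall>i\<in>B. d i = q i * L i" if 0: "(\<Sum>i\<in>B. d i * (\<Prod>j\<in>B-{i}. L j)) = 0"
  proof (rule bchoice, rule ballI)
    fix i assume i: "i \<in> B"
    have "(\<Sum>i\<in>B. d i * (\<Prod>j\<in>B-{i}. L j)) = d i * (\<Prod>j\<in>B-{i}. L j) + (\<Sum>k\<in>B-{i}. d k * (\<Prod>j\<in>B-{k}. L j))"
      using assms(1) i by (simp add: sum.remove)
    moreover have "L i dvd (\<Sum>k\<in>B-{i}. d k * (\<Prod>j\<in>B-{k}. L j))"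
      using assms(1) i by (intro dvd_sum dvd_mult dvd_prodI) auto
    ultimately have "L i dvd d i * (\<Prod>j\<in>B-{i}. L j)"
      using 0 by (simp add: eq_neg_iff_add_eq_0[symmetric])
    moreover have "\<not> L i dvd (\<Prod>j\<in>B-{i}. L j)"
      using prime_elem_dvd_prodD[OF prime[OF i], of "B - {i}" L] ndvd[OF i] assms(1) by auto
    ultimately have "L i dvd d i"
      using prime_elem_dvd_multD[OF prime[OF i]] by blast
    then show "\<exists>q. d i = q * L i" by (elim dvdE) (metis mult.commute)
  qed
  with eq nz show ?thesis by fastforce
qed

section \<open>Derivations along an arrangement with a modular point\<close>

text \<open>The forms \<open>\<alpha> x + \<beta> y + \<gamma> z\<close> of an arrangement with
  modular point [0:0:1]. Here \<open>\<gamma>\<close> is the value at that point, so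
  \<open>\<gamma> k = 0\<close> says that line \<open>k\<close> passes through it;
  \<open>modular\<close> says that the difference of two graphs is a multiple of such a
  form.\<close>

locale modular_forms =
  fixes B :: "'i set" and \<alpha> \<beta> \<gamma> :: "'i \<Rightarrow> complex"
  assumes finite_B: "finite B"
    and vertical_ex: "\<exists>k\<in>B. \<gamma> k = 0"
    and nonzero: "i \<in> B \<Longrightarrow> \<alpha> i \<noteq> 0 \<or> \<beta> i \<noteq> 0 \<or> \<gamma> i \<noteq> 0"
    and nonprop: "i \<in> B \<Longrightarrow> j \<in> B \<Longrightarrow> i \<noteq> j \<Longrightarrow> \<not> (\<exists>s. \<alpha> j = s * \<alpha> i \<and> \<beta> j = s * \<beta> i \<and> \<gamma> j = s * \<gamma> i)"
    and modular: "i \<in> B \<Longrightarrow> j \<in> B \<Longrightarrow> i \<noteq> j \<Longrightarrow> \<gamma> i \<noteq> 0 \<Longrightarrow> \<gamma> j \<noteq> 0 \<Longrightarrow>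
      \<exists>k\<in>B. \<gamma> k = 0 \<and> (\<exists>s. \<alpha> i / \<gamma> i - \<alpha> j / \<gamma> j = s * \<alpha> k \<and> \<beta> i / \<gamma> i - \<beta> j / \<gamma> j = s * \<beta> k)"
begin

definition "V = {i\<in>B. \<gamma> i = 0}"
definition "W = {i\<in>B. \<gamma> i \<noteq> 0}"
definition L where "L i = lin (\<alpha> i) (\<beta> i) (\<gamma> i)"
text \<open>The derivation with components \<open>P\<close>, \<open>Q\<close>, \<open>R\<close>,
  applied to \<open>L i\<close>.\<close>

definition dot where "dot i P Q R = cst (\<alpha> i) * P + cst (\<beta> i) * Q + cst (\<gamma> i) * R"
definition r where "r i = [:[:0, - \<alpha> i / \<gamma> i:], [:- \<beta> i / \<gamma> i:]:]"
definition h where "h i = [:[:0, \<alpha> i:], [:\<beta> i:]:]"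
definition X where "X = [:[:[:0, 1::complex:]:]:]"
definition Y where "Y = [:[:0, [:1::complex:]:]:]"
definition Z where "Z = [:0, [:[:1::complex:]:]:]"

text \<open>With \<open>q i\<close> the logarithmic derivative of \<open>L i\<close>, the sum of the
  \<open>q i\<close> is that of the defining polynomial. Its vanishing singles out, among the
  logarithmic derivations, those that kill this polynomial.\<close>

definition logder where
  "logder = {(P, Q, R). \<exists>q. (\<forall>i\<in>B. dot i P Q R = q i * L i) \<and> (\<Sum>i\<in>B. q i) = 0}"

lemma prime_L: "i \<in> B \<Longrightarrow> prime_elem (L i)"
  unfolding L_def by (rule prime_elem_lin[OF nonzero])

lemma L_not_dvd: "i \<in> B \<Longrightarrow> j \<in> B \<Longrightarrow> i \<noteq> j \<Longrightarrow> \<not> L i dvd L j"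
  unfolding L_def using nonprop[of i j] nonzero[of i] by (blast dest: lin_dvd_linD)

lemma logder_iff:
  "(P, Q, R) \<in> logder \<longleftrightarrow> (\<Sum>i\<in>B. dot i P Q R * (\<Prod>j\<in>B-{i}. L j)) = 0"
  unfolding logder_def using log_form_iff[of B L "\<lambda>i. dot i P Q R"] finite_B prime_L L_not_dvd by simp

lemma L_eq: "L i = cst (\<alpha> i) * X + cst (\<beta> i) * Y + cst (\<gamma> i) * Z"
  by (simp add: L_def lin_def cst_def X_def Y_def Z_def)

lemma L_W: "i \<in> W \<Longrightarrow> L i = cst (\<gamma> i) * [:- r i, 1:]"
  by (simp add: L_def lin_def cst_def r_def W_def)

lemma L_V: "i \<in> V \<Longrightarrow> L i = [:h i:]"
  by (simp add: L_def lin_def h_def V_def)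

lemma V_coprime: "i \<in> V \<Longrightarrow> j \<in> V \<Longrightarrow> i \<noteq> j \<Longrightarrow> coprime (h i) (h j)"
proof (rule prime_elem_imp_coprime)
  assume ij: "i \<in> V" "j \<in> V" "i \<noteq> j"
  then have "prime_elem (L i)" "\<not> L i dvd L j" using prime_L L_not_dvd by (auto simp: V_def)
  then show "prime_elem (h i)" "\<not> h i dvd h j"
    using ij by (auto simp: L_V prime_elem_const_poly_iff const_poly_dvd_const_poly_iff)
qed

lemma inj_r: "inj_on r W"
proof (rule inj_onI, rule ccontr)
  fix i j assume ij: "i \<in> W" "j \<in> W" "r i = r j" "i \<noteq> j"
  then have "\<alpha> j = (\<gamma> j / \<gamma> i) * \<alpha> i \<and> \<beta> j = (\<gamma> j / \<gamma> i) * \<beta> i \<and> \<gamma> j = (\<gamma> j / \<gamma> i) * \<gamma> i"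
    by (auto simp: r_def W_def field_simps)
  then show False using nonprop[of i j] ij unfolding W_def by blast
qed

lemma card_B_pos: "card B > 0" using finite_B vertical_ex card_gt_0_iff by blast
lemma finite_V: "finite V" and finite_W: "finite W" using finite_B by (auto simp: V_def W_def)

text \<open>The Hamiltonian vector field of the product of the forms \<open>h k\<close>, written without derivatives.\<close>
definition Ha where "Ha = (\<Sum>k\<in>V. [:[:\<beta> k:]:] * (\<Prod>l\<in>V-{k}. h l))"
definition Hb where "Hb = (\<Sum>k\<in>V. [:[:- \<alpha> k:]:] * (\<Prod>l\<in>V-{k}. h l))"

text \<open>Euler's identity for the product of the \<open>h k\<close>, homogeneous of degree
  \<open>card V\<close>: each summand recombines to \<open>h k\<close> times the remaining
  factors.\<close>

lemma Ha_Hb_euler: "[:Ha:] * Y - [:Hb:] * X = of_nat (card V) * [:\<Prod>k\<in>V. h k:]"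
proof -
  have "Ha * [:0, [:1:]:] - Hb * [:[:0,1:]:] = (\<Sum>k\<in>V. h k * (\<Prod>l\<in>V-{k}. h l))"
    unfolding Ha_def Hb_def sum_distrib_right sum_subtractf[symmetric]
  proof (rule sum.cong)
    fix k
    have "h k = [:[:\<beta> k:]:] * [:0, [:1:]:] - [:[:- \<alpha> k:]:] * [:[:0,1:]:]" by (simp add: h_def)
    then show "[:[:\<beta> k:]:] * (\<Prod>l\<in>V-{k}. h l) * [:0, [:1:]:] - [:[:- \<alpha> k:]:] * (\<Prod>l\<in>V-{k}. h l) * [:[:0,1:]:]
      = h k * (\<Prod>l\<in>V-{k}. h l)" by (simp only: left_diff_distrib mult.assoc mult.commute[of "\<Prod>l\<in>V-{k}. h l"])
  qed auto
  also have "\<dots> = (\<Sum>k\<in>V. (\<Prod>l\<in>V. h l))"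
    using finite_V by (intro sum.cong) (auto simp: prod.remove)
  finally have "Ha * [:0, [:1:]:] - Hb * [:[:0,1:]:] = of_nat (card V) * (\<Prod>l\<in>V. h l)" by simp
  then have "[:Ha * [:0, [:1:]:] - Hb * [:[:0,1:]:]:] = [:of_nat (card V) * (\<Prod>l\<in>V. h l):]" by simp
  then show ?thesis by (simp add: X_def Y_def of_nat_poly mult.commute)
qed

text \<open>The Hamiltonian field is tangent to every line of the pencil: in its value on
  \<open>h k\<close> the summand of index \<open>k\<close> has coefficient zero, and all the others
  contain \<open>h k\<close> as a factor.\<close>

lemma h_dvd: 
  assumes "k \<in> V"
  shows "h k dvd [:[:\<alpha> k:]:] * Ha + [:[:\<beta> k:]:] * Hb"
proof -
  have "[:[:\<alpha> k:]:] * Ha + [:[:\<beta> k:]:] * Hb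
      = (\<Sum>m\<in>V. [:[:\<alpha> k * \<beta> m - \<beta> k * \<alpha> m:]:] * (\<Prod>l\<in>V-{m}. h l))"
    unfolding Ha_def Hb_def sum_distrib_left sum.distrib[symmetric]
  proof (rule sum.cong)
    fix m
    have "[:[:\<alpha> k * \<beta> m - \<beta> k * \<alpha> m:]:] = [:[:\<alpha> k:]:] * [:[:\<beta> m:]:] + [:[:\<beta> k:]:] * [:[:- \<alpha> m:]:]" by simp
    then show "[:[:\<alpha> k:]:] * ([:[:\<beta> m:]:] * (\<Prod>l\<in>V-{m}. h l)) + [:[:\<beta> k:]:] * ([:[:- \<alpha> m:]:] * (\<Prod>l\<in>V-{m}. h l))
      = [:[:\<alpha> k * \<beta> m - \<beta> k * \<alpha> m:]:] * (\<Prod>l\<in>V-{m}. h l)"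
      by (simp only: algebra_simps)
  qed auto
  also have "h k dvd \<dots>"
  proof (rule dvd_sum)
    fix m assume "m \<in> V"
    show "h k dvd [:[:\<alpha> k * \<beta> m - \<beta> k * \<alpha> m:]:] * (\<Prod>l\<in>V-{m}. h l)"
    proof (cases "m = k")
      case False
      then show ?thesis using assms finite_V by (intro dvd_mult dvd_prodI) auto
    qed simp
  qed
  finally show ?thesis .
qed

text \<open>The prescribed value is the Hamiltonian field applied to \<open>r i\<close>, which is
  what tangency to \<open>z = r i\<close> demands of a last component \<open>c\<close>. Since
  \<open>r i - r j\<close> is a scalar times \<open>h k\<close>, and the field maps
  \<open>h k\<close> to \<open>h k * q k\<close>, the data have the shape required by
  \<open>pencil_interpolation\<close>.\<close>

lemma ex_third_component:
  "\<exists>c. \<forall>i\<in>W. poly c (r i) = [:[:- \<alpha> i / \<gamma> i:]:] * Ha + [:[:- \<beta> i / \<gamma> i:]:] * Hb"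
proof -
  obtain q where q: "\<And>k. k \<in> V \<Longrightarrow> [:[:\<alpha> k:]:] * Ha + [:[:\<beta> k:]:] * Hb = h k * q k"
    using h_dvd unfolding dvd_def by metis
  have "\<forall>i j. \<exists>k s. i \<in> W \<longrightarrow> j \<in> W \<longrightarrow> i \<noteq> j \<longrightarrow> 
      k \<in> V \<and> \<alpha> i / \<gamma> i - \<alpha> j / \<gamma> j = s * \<alpha> k \<and> \<beta> i / \<gamma> i - \<beta> j / \<gamma> j = s * \<beta> k"
    using modular unfolding V_def W_def by blast
  then obtain \<kappa> s where ks: "\<And>i j. i \<in> W \<Longrightarrow> j \<in> W \<Longrightarrow> i \<noteq> j \<Longrightarrow> \<kappa> i j \<in> V"
    "\<And>i j. i \<in> W \<Longrightarrow> j \<in> W \<Longrightarrow> i \<noteq> j \<Longrightarrow> \<alpha> i / \<gamma> i - \<alpha> j / \<gamma> j = s i j * \<alpha> (\<kappa> i j)"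
    "\<And>i j. i \<in> W \<Longrightarrow> j \<in> W \<Longrightarrow> i \<noteq> j \<Longrightarrow> \<beta> i / \<gamma> i - \<beta> j / \<gamma> j = s i j * \<beta> (\<kappa> i j)"
    unfolding choice_iff by blast
  have r: "r i - r j = [:[:- s i j:]:] * h (\<kappa> i j)" if "i \<in> W" "j \<in> W" "i \<noteq> j" for i j
    using ks(2,3)[OF that] by (simp add: r_def h_def algebra_simps)
  show ?thesis
  proof (rule pencil_interpolation[where u = "\<lambda>i j. [:[:- s i j:]:]" and h = h and q = q and \<kappa> = \<kappa>])
    fix i j assume ij: "i \<in> W" "j \<in> W" "i \<noteq> j"
    show "r i - r j = [:[:- s i j:]:] * h (\<kappa> i j)" by (rule r[OF ij])
    have "r i \<noteq> r j" using inj_r ij by (auto dest: inj_onD)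
    then have "s i j \<noteq> 0" using r[OF ij] by auto
    then show "is_unit [:[:- s i j:]:]" by (simp add: is_unit_const_poly_iff dvd_field_iff)
    have "[:[:- \<alpha> i / \<gamma> i:]:] * Ha + [:[:- \<beta> i / \<gamma> i:]:] * Hb - ([:[:- \<alpha> j / \<gamma> j:]:] * Ha + [:[:- \<beta> j / \<gamma> j:]:] * Hb)
       = [:[:- (\<alpha> i / \<gamma> i - \<alpha> j / \<gamma> j):]:] * Ha + [:[:- (\<beta> i / \<gamma> i - \<beta> j / \<gamma> j):]:] * Hb"
    proof -
      have *: "[:[:- (x / z - y / w):]:] = [:[:- x / z:]:] - [:[:- y / w:]:]" for x y z w :: complex by simp
      show ?thesis unfolding * by (simp only: algebra_simps)
    qed
    also have "\<dots> = [:[:- s i j:]:] * (h (\<kappa> i j) * q (\<kappa> i j))"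
      unfolding ks(2,3)[OF ij] q[OF ks(1)[OF ij], symmetric] distrib_left mult.assoc[symmetric]
      by simp
    finally show "[:[:- \<alpha> i / \<gamma> i:]:] * Ha + [:[:- \<beta> i / \<gamma> i:]:] * Hb - ([:[:- \<alpha> j / \<gamma> j:]:] * Ha + [:[:- \<beta> j / \<gamma> j:]:] * Hb)
       = [:[:- s i j:]:] * (h (\<kappa> i j) * q (\<kappa> i j))" .
  next
    fix i j i' j' assume "i \<in> W" "j \<in> W" "i \<noteq> j" "i' \<in> W" "j' \<in> W" "i' \<noteq> j'" "\<kappa> i j \<noteq> \<kappa> i' j'"
    then show "coprime (h (\<kappa> i j)) (h (\<kappa> i' j'))" using ks(1) V_coprime by auto
  qed (simp_all add: finite_W inj_r)
qed


section \<open>Logarithmic derivations modulo the Euler field\<close>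

lemma dot_smult: "dot i (w * P) (w * Q) (w * R) = w * dot i P Q R"
  by (simp add: dot_def algebra_simps)

lemma dot_diff: "dot i (P - P') (Q - Q') (R - R') = dot i P Q R - dot i P' Q' R'"
  by (simp add: dot_def algebra_simps)

lemma dot_euler: "dot i X Y Z = L i"
  by (simp add: dot_def L_eq)

lemma L_nonzero: "i \<in> B \<Longrightarrow> L i \<noteq> 0"
  using prime_L by (auto simp: prime_elem_def)

text \<open>The Euler field fixes every linear form, so all cofactors equal \<open>w\<close> and
  their sum is \<open>card B\<close> times \<open>w\<close>.\<close>

lemma euler_mem_imp_zero:
  assumes "(w * X, w * Y, w * Z) \<in> logder"
  shows "w = 0"
proof -
  obtain q where q: "\<forall>i\<in>B. dot i (w * X) (w * Y) (w * Z) = q i * L i" "(\<Sum>i\<in>B. q i) = 0"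
    using assms unfolding logder_def by blast
  have "q i = w" if "i \<in> B" for i
    using q(1) that L_nonzero[OF that] by (auto simp: dot_smult dot_euler)
  then have "of_nat (card B) * w = 0" using q(2) by simp
  then show ?thesis using card_B_pos by simp
qed

lemma logder_diff: "(P, Q, R) \<in> logder \<Longrightarrow> (P', Q', R') \<in> logder \<Longrightarrow> (P - P', Q - Q', R - R') \<in> logder"
  unfolding logder_iff by (simp add: dot_diff left_diff_distrib sum_subtractf)

lemma logder_smult: "(P, Q, R) \<in> logder \<Longrightarrow> (w * P, w * Q, w * R) \<in> logder"
  unfolding logder_iff by (simp add: dot_smult mult.assoc flip: sum_distrib_left)

text \<open>Subtracting \<open>e\<close> times the Euler field lowers each cofactor
  \<open>q i\<close> by \<open>e\<close>; the average of the \<open>q i\<close> makes their sum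
  vanish.\<close>

lemma logder_correction:
  assumes "\<And>i. i \<in> B \<Longrightarrow> L i dvd dot i P Q R"
  shows "\<exists>e. (P - e * X, Q - e * Y, R - e * Z) \<in> logder"
proof -
  obtain q where q: "\<And>i. i \<in> B \<Longrightarrow> dot i P Q R = L i * q i"
    using assms unfolding dvd_def by metis
  define e where "e = cst (1 / of_nat (card B)) * (\<Sum>i\<in>B. q i)"
  have "dot i (P - e * X) (Q - e * Y) (R - e * Z) = (q i - e) * L i" if "i \<in> B" for i
    using q[OF that] unfolding dot_diff dot_smult dot_euler left_diff_distrib by (simp only: mult.commute)
  moreover have "(\<Sum>i\<in>B. q i - e) = 0"
  proof -
    have "of_nat (card B) * cst (1 / of_nat (card B)) = 1"
      using card_B_pos by (simp add: cst_def of_nat_poly one_pCons)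
    then have "of_nat (card B) * e = (\<Sum>i\<in>B. q i)"
      unfolding e_def by (metis mult.assoc mult_1)
    then show ?thesis by (simp add: sum_subtractf)
  qed
  ultimately have "(P - e * X, Q - e * Y, R - e * Z) \<in> logder"
    unfolding logder_def by auto
  then show ?thesis by blast
qed

lemma prod_V_dvd:
  assumes "\<And>i. i \<in> V \<Longrightarrow> L i dvd u"
  shows "[:\<Prod>k\<in>V. h k:] dvd u"
proof -
  have "(\<Prod>k\<in>V. [:h k:]) dvd u"
  proof (rule prod_pairwise_coprime_dvd[OF finite_V])
    show "[:h k:] dvd u" if "k \<in> V" for k using assms[OF that] L_V[OF that] by simp
    show "coprime [:h k:] [:h l:]" if "k \<in> V" "l \<in> V" "k \<noteq> l" for k l
      using prime_L[of k] L_not_dvd[of k l] L_V that by (intro prime_elem_imp_coprime) (auto simp: V_def)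
  qed
  moreover have "(\<Prod>k\<in>V. [:h k:]) = [:\<Prod>k\<in>V. h k:]"
  proof -
    have "(\<Prod>k\<in>A. [:h k:]) = [:\<Prod>k\<in>A. h k:]" if "finite A" for A
      using that by (induction A rule: finite_induct) (auto simp: one_pCons)
    then show ?thesis using finite_V by blast
  qed
  ultimately show ?thesis by simp
qed

text \<open>The determinant \<open>P * Y - Q * X\<close> vanishes on each line of the pencil, hence
  is a multiple of the product of the \<open>h k\<close>. By Euler's identity a multiple of the
  Hamiltonian field has the same determinant, and a pair with determinant zero is a multiple of
  \<open>(X, Y)\<close>.\<close>

lemma vertical_part:
  assumes "\<And>i. i \<in> V \<Longrightarrow> L i dvd dot i P Q R"
  shows "\<exists>u w. P = u * [:Ha:] + w * X \<and> Q = u * [:Hb:] + w * Y"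
proof -
  have "L i dvd P * Y - Q * X" if i: "i \<in> V" for i
  proof -
    have L: "L i = cst (\<alpha> i) * X + cst (\<beta> i) * Y" and d: "dot i P Q R = cst (\<alpha> i) * P + cst (\<beta> i) * Q"
      using i by (auto simp: L_eq dot_def V_def cst_def)
    have d': "L i dvd cst (\<alpha> i) * P + cst (\<beta> i) * Q" using assms[OF i] d by simp
    \<comment> \<open>Either coefficient may be zero, so both multiples are treated; one of the two
      is a unit multiple.\<close>
    have "cst (\<alpha> i) * (P * Y - Q * X) = (cst (\<alpha> i) * P + cst (\<beta> i) * Q) * Y - L i * Q"
      "cst (\<beta> i) * (P * Y - Q * X) = L i * P - (cst (\<alpha> i) * P + cst (\<beta> i) * Q) * X"
      unfolding L by (simp_all only: algebra_simps)
    then have "L i dvd cst (\<alpha> i) * (P * Y - Q * X)" "L i dvd cst (\<beta> i) * (P * Y - Q * X)"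
      using d' by (simp_all only: dvd_diff dvd_mult dvd_mult2 dvd_triv_left)
    moreover have "is_unit (cst (\<alpha> i)) \<or> is_unit (cst (\<beta> i))"
      using nonzero[of i] i by (auto simp: V_def cst_def is_unit_const_poly_iff dvd_field_iff)
    ultimately show ?thesis by (metis dvd_mult_unit_iff')
  qed
  then obtain u' where u': "P * Y - Q * X = [:\<Prod>k\<in>V. h k:] * u'"
    using prod_V_dvd[of "P * Y - Q * X"] by (auto elim: dvdE)
  define u where "u = cst (1 / of_nat (card V)) * u'"
  have "card V > 0" using vertical_ex finite_V unfolding V_def by (metis (mono_tags, lifting) card_gt_0_iff empty_iff mem_Collect_eq)
  then have 1: "of_nat (card V) * cst (1 / of_nat (card V)) = 1"
    by (simp add: cst_def of_nat_poly one_pCons)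
  have "u * ([:Ha:] * Y - [:Hb:] * X) = (of_nat (card V) * cst (1 / of_nat (card V))) * ([:\<Prod>k\<in>V. h k:] * u')"
    unfolding Ha_Hb_euler u_def by (simp only: ac_simps)
  also have "\<dots> = P * Y - Q * X" unfolding 1 u' by simp
  finally have eq: "(P - u * [:Ha:]) * Y = (Q - u * [:Hb:]) * X" by (simp only: algebra_simps)
  have "X dvd (P - u * [:Ha:]) * Y" unfolding eq by simp
  moreover have X: "X = lin 1 0 0" "Y = lin 0 1 0" by (simp_all add: X_def Y_def lin_def)
  then have "prime_elem X" "\<not> X dvd Y"
    using prime_elem_lin[of 1 0 0] lin_dvd_linD[of 1 0 0 0 1 0] by auto
  ultimately have "X dvd P - u * [:Ha:]" by (blast dest: prime_elem_dvd_multD)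
  then obtain w where w: "P - u * [:Ha:] = w * X" by (metis dvdE mult.commute)
  have "(w * Y) * X = (Q - u * [:Hb:]) * X" using eq unfolding w by (simp only: ac_simps)
  then have "w * Y = Q - u * [:Hb:]" using \<open>prime_elem X\<close> by (metis mult_right_cancel prime_elem_not_zeroI)
  with w show ?thesis by (metis add.commute diff_add_cancel)
qed

lemma logder_basis:
  "\<exists>P2 Q2 R2 P3 Q3 R3. (P2, Q2, R2) \<in> logder \<and> (P3, Q3, R3) \<in> logder \<and>
    (\<forall>(P, Q, R) \<in> logder. \<exists>u v. P = u * P2 + v * P3 \<and> Q = u * Q2 + v * Q3 \<and> R = u * R2 + v * R3) \<and>
    (\<forall>u v. u * P2 + v * P3 = 0 \<and> u * Q2 + v * Q3 = 0 \<and> u * R2 + v * R3 = 0 \<longrightarrow> u = 0 \<and> v = 0)"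
proof -
  obtain c where c: "\<And>i. i \<in> W \<Longrightarrow> poly c (r i) = [:[:- \<alpha> i / \<gamma> i:]:] * Ha + [:[:- \<beta> i / \<gamma> i:]:] * Hb"
    using ex_third_component by blast
  define G where "G = (\<Prod>i\<in>W. [:- r i, 1:])"
  have "L i dvd dot i [:Ha:] [:Hb:] c" if "i \<in> B" for i
  proof (cases "i \<in> W")
    case True
    \<comment> \<open>By the choice of \<open>c\<close>, the first two terms of \<open>dot\<close>
      are \<open>- cst (\<gamma> i)\<close> times the value of \<open>c\<close> at
      \<open>r i\<close>.\<close>
    have "dot i [:Ha:] [:Hb:] c = cst (\<gamma> i) * (c - [:poly c (r i):])"
    proof -
      have *: "cst x * [:[:[:- y / x:]:] * H:] = - (cst y * [:H:])" if "x \<noteq> 0" for x y H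
        using that by (simp add: cst_def flip: smult_minus_left)
      have "cst (\<gamma> i) * [:poly c (r i):] = - (cst (\<alpha> i) * [:Ha:] + cst (\<beta> i) * [:Hb:])"
        using True *[of "\<gamma> i" "\<alpha> i" Ha] *[of "\<gamma> i" "\<beta> i" Hb] unfolding c[OF True]
        by (simp add: W_def flip: add_pCons distrib_left) (simp add: distrib_left smult_add_left flip: add_pCons)
      then show ?thesis unfolding dot_def right_diff_distrib by simp
    qed
    moreover have "[:- r i, 1:] dvd c - [:poly c (r i):]"
      by (simp flip: poly_eq_0_iff_dvd)
    ultimately show ?thesis using L_W[OF True] by (simp only: mult_dvd_mono dvd_refl)
  next
    case False
    then have V: "i \<in> V" using that by (auto simp: V_def W_def)
    have "dot i [:Ha:] [:Hb:] c = [:[:[:\<alpha> i:]:] * Ha + [:[:\<beta> i:]:] * Hb:]"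
      using V by (simp add: dot_def cst_def V_def)
    then show ?thesis using h_dvd[OF V] by (simp add: L_V[OF V] const_poly_dvd_const_poly_iff)
  qed
  then obtain e2 where e2: "([:Ha:] - e2 * X, [:Hb:] - e2 * Y, c - e2 * Z) \<in> logder"
    using logder_correction by blast
  have "L i dvd dot i 0 0 G" if "i \<in> B" for i
  proof (cases "i \<in> W")
    case True
    then have "[:- r i, 1:] dvd G" unfolding G_def by (intro dvd_prodI finite_W)
    then show ?thesis unfolding L_W[OF True] dot_def by (simp only: mult_zero_right add_0 mult_dvd_mono dvd_refl)
  next
    case False
    then show ?thesis using that by (simp add: dot_def W_def cst_def)
  qed
  then obtain e3 where e3: "(0 - e3 * X, 0 - e3 * Y, G - e3 * Z) \<in> logder"
    using logder_correction by blast
  have "\<exists>u v. P = u * ([:Ha:] - e2 * X) + v * (0 - e3 * X) \<and> Q = u * ([:Hb:] - e2 * Y) + v * (0 - e3 * Y)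
      \<and> R = u * (c - e2 * Z) + v * (G - e3 * Z)" if PQR: "(P, Q, R) \<in> logder" for P Q R
  proof -
    have dvd: "L i dvd dot i P Q R" if "i \<in> B" for i
      using PQR that unfolding logder_def by auto
    then obtain u w where uw: "P = u * [:Ha:] + w * X" "Q = u * [:Hb:] + w * Y"
      using vertical_part[of P Q R] by (auto simp: V_def)
    \<comment> \<open>The last component left after subtracting the tangent fields with coefficients
      \<open>u\<close> and \<open>w\<close>. The remaining field \<open>(0, 0, R')\<close> is still
      tangent to every \<open>z = r i\<close>, so \<open>G\<close> divides
      \<open>R'\<close>.\<close>
    define R' where "R' = R - u * c - w * Z"
    have "poly R' (r i) = 0" if i: "i \<in> W" for i
    proof -
      have "L i dvd dot i P Q R - u * dot i [:Ha:] [:Hb:] c - w * dot i X Y Z"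
        using i dvd[of i] \<open>\<And>i. i \<in> B \<Longrightarrow> L i dvd dot i [:Ha:] [:Hb:] c\<close>[of i]
        by (intro dvd_diff) (auto simp: W_def dot_euler)
      also have "dot i P Q R - u * dot i [:Ha:] [:Hb:] c - w * dot i X Y Z = cst (\<gamma> i) * R'"
        unfolding dot_def uw R'_def by (simp only: algebra_simps)
      finally have "[:- r i, 1:] dvd R'"
        using i unfolding L_W[OF i] by (subst (asm) dvd_mult_cancel_left) (auto simp: W_def cst_def)
      then show ?thesis by (simp only: poly_eq_0_iff_dvd)
    qed
    then have "G dvd R'" unfolding G_def by (intro prod_linear_dvd finite_W inj_r)
    then obtain v where v: "R' = v * G" by (metis dvdE mult.commute)
    have R: "R = u * c + w * Z + v * G" using v unfolding R'_def by (simp add: algebra_simps)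
    \<comment> \<open>Replacing the two fields by their corrected versions leaves a multiple of the
      Euler field. It lies in \<open>logder\<close>, hence is zero.\<close>
    have euler_split: "u * a + w * x + v * g - (u * (a - e2 * x) + v * (g - e3 * x)) = (w + u * e2 + v * e3) * x"
      for a x g :: "complex poly poly poly"
      by (simp add: algebra_simps)
    define w' where "w' = w + u * e2 + v * e3"
    have "(P - (u * ([:Ha:] - e2 * X) + v * (0 - e3 * X)), Q - (u * ([:Hb:] - e2 * Y) + v * (0 - e3 * Y)),
        R - (u * (c - e2 * Z) + v * (G - e3 * Z))) \<in> logder"
      using logder_diff[OF logder_diff[OF PQR logder_smult[OF e2, of u]] logder_smult[OF e3, of v]]
      by (simp only: diff_diff_eq)
    moreover have "P - (u * ([:Ha:] - e2 * X) + v * (0 - e3 * X)) = w' * X"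
      "Q - (u * ([:Hb:] - e2 * Y) + v * (0 - e3 * Y)) = w' * Y"
      "R - (u * (c - e2 * Z) + v * (G - e3 * Z)) = w' * Z"
      unfolding uw R w'_def using euler_split[of "[:Ha:]" X 0] euler_split[of "[:Hb:]" Y 0] euler_split[of c Z G]
      by (simp_all only: mult_zero_right add_0_right)
    ultimately have "w' = 0" using euler_mem_imp_zero by simp
    then have "P - (u * ([:Ha:] - e2 * X) + v * (0 - e3 * X)) = 0"
      "Q - (u * ([:Hb:] - e2 * Y) + v * (0 - e3 * Y)) = 0"
      "R - (u * (c - e2 * Z) + v * (G - e3 * Z)) = 0"
      using \<open>P - _ = w' * X\<close> \<open>Q - _ = w' * Y\<close> \<open>R - _ = w' * Z\<close> by simp_all
    then show ?thesis by (metis eq_iff_diff_eq_0)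
  qed
  moreover have "u = 0 \<and> v = 0"
    if 0: "u * ([:Ha:] - e2 * X) + v * (0 - e3 * X) = 0" "u * ([:Hb:] - e2 * Y) + v * (0 - e3 * Y) = 0"
      "u * (c - e2 * Z) + v * (G - e3 * Z) = 0" for u v
  proof -
    have collect: "u * a + v * g = (u * e2 + v * e3) * x" if "u * (a - e2 * x) + v * (g - e3 * x) = 0"
      for a g x
    proof -
      have "u * a + v * g - (u * e2 + v * e3) * x = u * (a - e2 * x) + v * (g - e3 * x)"
        by (simp add: algebra_simps)
      then show ?thesis using that by simp
    qed
    define w where "w = u * e2 + v * e3"
    have w: "u * [:Ha:] = w * X" "u * [:Hb:] = w * Y" "u * c + v * G = w * Z"
      using collect[OF 0(1)] collect[OF 0(2)] collect[OF 0(3)] unfolding w_def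
      by (simp_all only: mult_zero_right add_0_right)
    \<comment> \<open>Taking the determinant with \<open>(X, Y)\<close> eliminates the Euler part
      and isolates \<open>u\<close>.\<close>
    have "u * (of_nat (card V) * [:\<Prod>k\<in>V. h k:]) = (u * [:Ha:]) * Y - (u * [:Hb:]) * X"
      unfolding Ha_Hb_euler[symmetric] by (simp only: algebra_simps)
    also have "\<dots> = 0" unfolding w by (simp only: ac_simps diff_self)
    finally have "u = 0"
    proof -
      have "h k \<noteq> 0" if "k \<in> V" for k
        using that L_nonzero[of k] L_V[of k] by (auto simp: V_def)
      then have "(\<Prod>k\<in>V. h k) \<noteq> 0" using finite_V by simp
      moreover have "card V \<noteq> 0" using finite_V vertical_ex unfolding V_def by auto
      moreover assume "u * (of_nat (card V) * [:\<Prod>k\<in>V. h k:]) = 0"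
      ultimately show "u = 0" by (simp only: mult_eq_0_iff of_nat_eq_0_iff pCons_eq_0_iff) simp
    qed
    then have "w = 0" using w(1) by (simp add: X_def)
    moreover have "G \<noteq> 0" unfolding G_def using finite_W by simp
    ultimately show ?thesis using w(3) \<open>u = 0\<close> by simp
  qed
  ultimately show ?thesis using e2 e3 by blast
qed

end

section \<open>Polynomials in three variables and linear substitutions\<close>

abbreviation const_mp :: "complex \<Rightarrow> mpoly3" where "const_mp \<equiv> Poly_Mapping.single 0"

lemma poly_mapping_eq_sum_single:
  "(p :: 'a \<Rightarrow>\<^sub>0 'b::comm_monoid_add) = (\<Sum>m\<in>Poly_Mapping.keys p. Poly_Mapping.single m (Poly_Mapping.lookup p m))"
  by (rule poly_mapping_eqI) (auto simp: lookup_sum lookup_single when_def in_keys_iff)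

lemma poly_mapping_induct [case_names single add]:
  fixes P :: "('a \<Rightarrow>\<^sub>0 'b::comm_monoid_add) \<Rightarrow> bool"
  assumes "\<And>m c. P (Poly_Mapping.single m c)" "\<And>p q. P p \<Longrightarrow> P q \<Longrightarrow> P (p + q)"
  shows "P p"
proof -
  have "P (\<Sum>m\<in>S. Poly_Mapping.single m (Poly_Mapping.lookup p m))" if "finite S" for S
    using that
  proof (induction S rule: finite_induct)
    case empty
    show ?case using assms(1)[of undefined 0] by simp
  qed (use assms in auto)
  then show ?thesis by (subst poly_mapping_eq_sum_single) auto
qed

lemma sum_keys_add:
  assumes "\<And>m. f m 0 = 0" "\<And>m a b. f m (a + b) = f m a + f m b"
  shows "(\<Sum>m\<in>Poly_Mapping.keys (p + q). f m (Poly_Mapping.lookup (p + q) m)) =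
    (\<Sum>m\<in>Poly_Mapping.keys p. f m (Poly_Mapping.lookup p m)) + (\<Sum>m\<in>Poly_Mapping.keys q. f m (Poly_Mapping.lookup q m))"
  by (rule setsum_keys_plus_distrib) (use assms in auto)

lemma dX_add: "dX (p + q) = dX p + dX q"
  and dY_add: "dY (p + q) = dY p + dY q"
  and dZ_add: "dZ (p + q) = dZ p + dZ q"
  unfolding dX_def dY_def dZ_def
  by (subst sum_keys_add; simp add: distrib_left single_add)+

lemma dX_single: "dX (Poly_Mapping.single m c) = Poly_Mapping.single (fst m - 1, fst (snd m), snd (snd m)) (of_nat (fst m) * c)"
  and dY_single: "dY (Poly_Mapping.single m c) = Poly_Mapping.single (fst m, fst (snd m) - 1, snd (snd m)) (of_nat (fst (snd m)) * c)"
  and dZ_single: "dZ (Poly_Mapping.single m c) = Poly_Mapping.single (fst m, fst (snd m), snd (snd m) - 1) (of_nat (snd (snd m)) * c)"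
  unfolding dX_def dY_def dZ_def by (cases "c = 0"; simp)+

text \<open>Both sides are additive in each factor, and single terms generate.\<close>

lemma leibniz_if_leibniz_single:
  fixes D :: "mpoly3 \<Rightarrow> mpoly3"
  assumes add: "\<And>p q. D (p + q) = D p + D q"
    and single: "\<And>m n a b. D (Poly_Mapping.single m a * Poly_Mapping.single n b) =
      D (Poly_Mapping.single m a) * Poly_Mapping.single n b + Poly_Mapping.single m a * D (Poly_Mapping.single n b)"
  shows "D (p * q) = D p * q + p * D q"
proof (induction p rule: poly_mapping_induct)
  case (single m c)
  show ?case
  proof (induction q rule: poly_mapping_induct)
    case (add p q)
    then show ?case by (simp add: assms(1) algebra_simps)
  qed (rule assms(2))
qed (simp add: add algebra_simps)

lemma dX_mult: "dX (p * q) = dX p * q + p * dX q"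
proof (rule leibniz_if_leibniz_single[OF dX_add])
  fix m n :: "nat \<times> nat \<times> nat" and a b
  obtain i1 i2 i3 j1 j2 j3 where "m = (i1, i2, i3)" "n = (j1, j2, j3)" by (metis prod_cases3)
  then show "dX (Poly_Mapping.single m a * Poly_Mapping.single n b) =
      dX (Poly_Mapping.single m a) * Poly_Mapping.single n b + Poly_Mapping.single m a * dX (Poly_Mapping.single n b)"
    \<comment> \<open>Subtraction of exponents is truncated at 0; there the factor
      \<open>of_nat 0\<close> removes the term, whence the case split.\<close>
    by (cases i1; cases j1) (auto simp: dX_single mult_single algebra_simps simp flip: single_add)
qed

lemma dY_mult: "dY (p * q) = dY p * q + p * dY q"
proof (rule leibniz_if_leibniz_single[OF dY_add])
  fix m n :: "nat \<times> nat \<times> nat" and a b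
  obtain i1 i2 i3 j1 j2 j3 where "m = (i1, i2, i3)" "n = (j1, j2, j3)" by (metis prod_cases3)
  then show "dY (Poly_Mapping.single m a * Poly_Mapping.single n b) =
      dY (Poly_Mapping.single m a) * Poly_Mapping.single n b + Poly_Mapping.single m a * dY (Poly_Mapping.single n b)"
    by (cases i2; cases j2) (auto simp: dY_single mult_single algebra_simps simp flip: single_add)
qed

lemma dZ_mult: "dZ (p * q) = dZ p * q + p * dZ q"
proof (rule leibniz_if_leibniz_single[OF dZ_add])
  fix m n :: "nat \<times> nat \<times> nat" and a b
  obtain i1 i2 i3 j1 j2 j3 where "m = (i1, i2, i3)" "n = (j1, j2, j3)" by (metis prod_cases3)
  then show "dZ (Poly_Mapping.single m a * Poly_Mapping.single n b) =
      dZ (Poly_Mapping.single m a) * Poly_Mapping.single n b + Poly_Mapping.single m a * dZ (Poly_Mapping.single n b)"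
    by (cases i3; cases j3) (auto simp: dZ_single mult_single algebra_simps simp flip: single_add)
qed

lemma derivation_prod:
  fixes D :: "'a::comm_ring_1 \<Rightarrow> 'a"
  assumes mult: "\<And>p q. D (p * q) = D p * q + p * D q" and "finite I"
  shows "D (\<Prod>i\<in>I. f i) = (\<Sum>i\<in>I. D (f i) * (\<Prod>j\<in>I-{i}. f j))"
  using assms(2)
proof (induction I rule: finite_induct)
  case empty
  \<comment> \<open>The product rule gives \<open>D 1 = D 1 + D 1\<close>, so
    \<open>D 1 = 0\<close>.\<close>
  show ?case using mult[of 1 1] by simp
next
  case (insert i I)
  have "(\<Prod>j\<in>insert i I - {k}. f j) = f i * (\<Prod>j\<in>I - {k}. f j)" if "k \<in> I" for k
  proof -
    have "insert i I - {k} = insert i (I - {k})" using insert.hyps that by auto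
    then show ?thesis using insert.hyps by simp
  qed
  then have "(\<Sum>k\<in>I. D (f k) * (\<Prod>j\<in>insert i I - {k}. f j)) = f i * (\<Sum>k\<in>I. D (f k) * (\<Prod>j\<in>I - {k}. f j))"
    by (simp add: sum_distrib_left mult_ac)
  then show ?case using insert by (simp add: mult)
qed

lemma dX_linpoly: "dX (linpoly a) = const_mp (a $ 1)"
  and dY_linpoly: "dY (linpoly a) = const_mp (a $ 2)"
  and dZ_linpoly: "dZ (linpoly a) = const_mp (a $ 3)"
  by (simp_all add: linpoly_def dX_add dY_add dZ_add dX_single dY_single dZ_single zero_prod_def)

text \<open>The shape of \<open>logder_iff\<close>, so that the two descriptions can be matched
  summand by summand.\<close>

lemma AR_prod_linpoly:
  assumes "finite I"
  shows "(a, b, c) \<in> AR (\<Prod>i\<in>I. linpoly (f i)) \<longleftrightarrow>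
    (\<Sum>i\<in>I. (const_mp (f i $ 1) * a + const_mp (f i $ 2) * b + const_mp (f i $ 3) * c) * (\<Prod>j\<in>I-{i}. linpoly (f j))) = 0"
proof -
  have "a * dX (\<Prod>i\<in>I. linpoly (f i)) + b * dY (\<Prod>i\<in>I. linpoly (f i)) + c * dZ (\<Prod>i\<in>I. linpoly (f i))
    = (\<Sum>i\<in>I. (const_mp (f i $ 1) * a + const_mp (f i $ 2) * b + const_mp (f i $ 3) * c) * (\<Prod>j\<in>I-{i}. linpoly (f j)))"
    unfolding derivation_prod[OF dX_mult assms] derivation_prod[OF dY_mult assms] derivation_prod[OF dZ_mult assms]
      dX_linpoly dY_linpoly dZ_linpoly sum_distrib_left sum.distrib[symmetric]
    by (rule sum.cong) (simp_all add: algebra_simps)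
  then show ?thesis by (simp add: AR_def)
qed

text \<open>The map \<open>C\<close> embeds the scalars: \<open>cst\<close> gives substitutions into
  iterated polynomials, \<open>id\<close> gives values at points.\<close>

definition eval_mp :: "(complex \<Rightarrow> 'b::comm_ring_1) \<Rightarrow> 'b \<Rightarrow> 'b \<Rightarrow> 'b \<Rightarrow> mpoly3 \<Rightarrow> 'b" where
  "eval_mp C x y z p = (\<Sum>m\<in>Poly_Mapping.keys p. C (Poly_Mapping.lookup p m) * (x ^ fst m * y ^ fst (snd m) * z ^ snd (snd m)))"

lemma eval_mp_single:
  "C 0 = 0 \<Longrightarrow> eval_mp C x y z (Poly_Mapping.single m c) = C c * (x ^ fst m * y ^ fst (snd m) * z ^ snd (snd m))"
  by (cases "c = 0") (simp_all add: eval_mp_def)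

lemma eval_mp_add:
  assumes "C 0 = 0" "\<And>a b. C (a + b) = C a + C b"
  shows "eval_mp C x y z (p + q) = eval_mp C x y z p + eval_mp C x y z q"
  unfolding eval_mp_def by (subst sum_keys_add) (simp_all add: assms distrib_right)

lemma eval_mp_mult:
  assumes "C 0 = 0" "\<And>a b. C (a + b) = C a + C b" "\<And>a b. C (a * b) = C a * C b"
  shows "eval_mp C x y z (p * q) = eval_mp C x y z p * eval_mp C x y z q"
proof (induction p rule: poly_mapping_induct)
  case (single m c)
  show ?case
  proof (induction q rule: poly_mapping_induct)
    case (single n d)
    show ?case by (simp add: mult_single eval_mp_single assms power_add mult_ac)
  qed (simp add: eval_mp_add assms(1,2) distrib_left)
qed (simp add: eval_mp_add assms(1,2) distrib_right)

lemma cst_hom [simp]: "cst 0 = 0" "cst 1 = 1" "cst (a + b) = cst a + cst b" "cst (a * b) = cst a * cst b"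
  by (simp_all add: cst_def one_pCons)

definition ev3 :: "complex poly poly poly \<Rightarrow> complex \<Rightarrow> complex \<Rightarrow> complex \<Rightarrow> complex" where
  "ev3 P x y z = poly (poly (poly P [:[:z:]:]) [:y:]) x"

lemma ev3_lin: "ev3 (lin a b c) x y z = a * x + b * y + c * z"
  by (simp add: ev3_def lin_def algebra_simps)

lemma ev3_eval_mp:
  "ev3 (eval_mp cst P Q R p) x y z = eval_mp id (ev3 P x y z) (ev3 Q x y z) (ev3 R x y z) p"
  by (simp add: eval_mp_def ev3_def poly_sum cst_def)

lemma poly_eq_0_if_const_roots:
  fixes P :: "'a::{idom,ring_char_0} poly poly"
  assumes "\<And>y. poly P [:y:] = 0"
  shows "P = 0"
proof (rule ccontr)
  assume "P \<noteq> 0"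
  then have "finite {x. poly P x = 0}" by (rule poly_roots_finite)
  moreover have "range (\<lambda>y. [:y:]) \<subseteq> {x. poly P x = 0}" using assms by auto
  moreover have "infinite (range (\<lambda>y::'a. [:y:]))"
    by (subst finite_image_iff) (auto simp: inj_on_def infinite_UNIV_char_0)
  ultimately show False using finite_subset by blast
qed

lemma ev3_eq_0_imp:
  assumes "\<And>x y z. ev3 P x y z = 0"
  shows "P = 0"
proof -
  have 1: "poly (poly P [:[:z:]:]) [:y:] = 0" for y z
    using assms unfolding ev3_def by (metis poly_all_0_iff_0)
  then have 2: "poly P [:[:z:]:] = 0" for z by (rule poly_eq_0_if_const_roots)
  show ?thesis
  proof (rule ccontr)
    assume "P \<noteq> 0"
    then have "finite {x. poly P x = 0}" by (rule poly_roots_finite)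
    moreover have "range (\<lambda>y. [:[:y:]:]) \<subseteq> {x. poly P x = 0}" using 2 by auto
    moreover have "infinite (range (\<lambda>y::complex. [:[:y:]:]))"
      by (subst finite_image_iff) (auto simp: inj_on_def infinite_UNIV_char_0)
    ultimately show False using finite_subset by blast
  qed
qed

text \<open>Inserting the coordinates themselves only regroups monomials. Hence \<open>p\<close> is
  zero as soon as its iterated form is.\<close>

lemma eval_mp_std_coeff:
  "coeff (coeff (coeff (eval_mp cst (lin 1 0 0) (lin 0 1 0) (lin 0 0 1) p) k) j) i = Poly_Mapping.lookup p (i, j, k)"
proof -
  have mon: "[:0, 1:] ^ n = monom 1 n" for n :: nat and dummy :: "'b::comm_ring_1"
    by (simp add: monom_altdef)
  have "[:[:[:0, 1::complex:]:]:] ^ i = [:[:monom 1 i:]:]" for i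
    by (induction i) (simp_all add: monom_Suc monom_0 flip: one_pCons)
  moreover have "[:[:0, 1::complex poly:]:] ^ i = [:monom 1 i:]" for i
    by (induction i) (simp_all add: monom_Suc monom_0 flip: one_pCons)
  moreover have "[:0, 1::complex poly poly:] ^ i = monom 1 i" for i
    by (simp add: monom_altdef)
  ultimately have "cst c * (lin 1 0 0 ^ i * lin 0 1 0 ^ j * lin 0 0 1 ^ k) = monom (monom (monom c i) j) k" for c i j k
    by (simp add: lin_def cst_def one_pCons[symmetric] smult_monom)
  then have "coeff (coeff (coeff (eval_mp cst (lin 1 0 0) (lin 0 1 0) (lin 0 0 1) p) k) j) i
    = (\<Sum>m\<in>Poly_Mapping.keys p. if m = (i, j, k) then Poly_Mapping.lookup p m else 0)"
    unfolding eval_mp_def coeff_sum by (intro sum.cong) (auto simp: prod_eq_iff)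
  also have "\<dots> = Poly_Mapping.lookup p (i, j, k)"
    by (auto simp: in_keys_iff)
  finally show ?thesis .
qed

lemma mpoly3_eq_0_if_vanishing:
  assumes "\<And>x y z. eval_mp id x y z p = 0"
  shows "p = 0"
proof -
  have "eval_mp cst (lin 1 0 0) (lin 0 1 0) (lin 0 0 1) p = 0"
    by (rule ev3_eq_0_imp) (simp add: ev3_eval_mp assms)
  then have "Poly_Mapping.lookup p m = 0" for m
    using eval_mp_std_coeff[of p "snd (snd m)" "fst (snd m)" "fst m"] by simp
  then show ?thesis by (simp add: poly_mapping_eqI)
qed

text \<open>Serves to show that coordinate changes are onto; the nested inductions adjoin one
  variable at a time.\<close>

lemma subring_eq_UNIV:
  fixes A :: "complex poly poly poly set"
  assumes "\<And>c. cst c \<in> A" "lin 1 0 0 \<in> A" "lin 0 1 0 \<in> A" "lin 0 0 1 \<in> A"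
    and add: "\<And>u v. u \<in> A \<Longrightarrow> v \<in> A \<Longrightarrow> u + v \<in> A" and mult: "\<And>u v. u \<in> A \<Longrightarrow> v \<in> A \<Longrightarrow> u * v \<in> A"
  shows "u \<in> A"
proof -
  have 1: "[:[:p:]:] \<in> A" for p
  proof (induction p)
    case 0
    then show ?case using assms(1)[of 0] by (simp add: cst_def)
  next
    case (pCons c p)
    have "[:[:pCons c p:]:] = cst c + lin 1 0 0 * [:[:p:]:]" by (simp add: cst_def lin_def)
    with pCons show ?case by (simp only:) (intro add mult assms)
  qed
  have 2: "[:p:] \<in> A" for p
  proof (induction p)
    case 0
    then show ?case using 1[of 0] by simp
  next
    case (pCons c p)
    have "lin 0 1 0 = [:[:0, 1:]:]" by (simp add: lin_def one_pCons)
    then have "[:pCons c p:] = [:[:c:]:] + lin 0 1 0 * [:p:]" by simp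
    with pCons show ?case by (simp only:) (intro add mult assms 1)
  qed
  show ?thesis
  proof (induction u)
    case 0
    then show ?case using 2[of 0] by simp
  next
    case (pCons c p)
    have "lin 0 0 1 = [:0, 1:]" by (simp add: lin_def one_pCons)
    then have "pCons c p = [:c:] + lin 0 0 1 * p" by simp
    with pCons show ?case by (simp only:) (intro add mult assms 2)
  qed
qed

section \<open>Freeness through a linear change of coordinates\<close>

lemma free_submodule_if_basis_pair:
  assumes "a \<in> M" "b \<in> M"
    and gen: "\<And>m. m \<in> M \<Longrightarrow> \<exists>u v. m = smul3 u a + smul3 v b"
    and ind: "\<And>u v. smul3 u a + smul3 v b = 0 \<Longrightarrow> u = 0 \<and> v = 0"
  shows "free_submodule M"
proof -
  \<comment> \<open>\<open>free_submodule\<close> sums over a set, so a coincidence of the two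
    generators would merge their terms.\<close>
  have "a \<noteq> b" using ind[of 1 "-1"] by (auto simp: smul3_def zero_prod_def plus_prod_def)
  show ?thesis unfolding free_submodule_def
  proof (intro exI[of _ "{a, b}"] conjI ballI)
    fix m assume "m \<in> M"
    then obtain u v where m: "m = smul3 u a + smul3 v b" using gen by blast
    show "\<exists>!r. (\<forall>e. e \<notin> {a, b} \<longrightarrow> r e = 0) \<and> m = (\<Sum>e\<in>{a, b}. smul3 (r e) e)"
    proof (rule ex1I[of _ "\<lambda>e. if e = a then u else if e = b then v else 0"])
      show "(\<forall>e. e \<notin> {a, b} \<longrightarrow> (if e = a then u else if e = b then v else 0) = 0) \<and>
        m = (\<Sum>e\<in>{a, b}. smul3 (if e = a then u else if e = b then v else 0) e)"
        using \<open>a \<noteq> b\<close> m by auto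
    next
      fix r assume r: "(\<forall>e. e \<notin> {a, b} \<longrightarrow> r e = 0) \<and> m = (\<Sum>e\<in>{a, b}. smul3 (r e) e)"
      then have "smul3 (r a) a + smul3 (r b) b = smul3 u a + smul3 v b" using \<open>a \<noteq> b\<close> m by auto
      then have "smul3 (r a - u) a + smul3 (r b - v) b = 0"
        by (auto simp: smul3_def plus_prod_def zero_prod_def algebra_simps)
      then have "r a = u" "r b = v" using ind[of "r a - u" "r b - v"] by auto
      then show "r = (\<lambda>e. if e = a then u else if e = b then v else 0)" using r by auto
    qed
  qed (use assms in auto)
qed

lemma eval_mp_linpoly:
  assumes "C 0 = 0" "\<And>a b. C (a + b) = C a + C b" 
  shows "eval_mp C x y z (linpoly a) = C (a $ 1) * x + C (a $ 2) * y + C (a $ 3) * z"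
  unfolding linpoly_def by (simp add: eval_mp_add eval_mp_single assms)

text \<open>In the coordinates given by a basis, \<open>substitution e1 e2 e3\<close> is the pull-back of
  polynomial functions on \<open>\<complex>\<^sup>3\<close>.\<close>
definition substitution :: "complex ^ 3 \<Rightarrow> complex ^ 3 \<Rightarrow> complex ^ 3 \<Rightarrow> mpoly3 \<Rightarrow> complex poly poly poly" where
  "substitution e1 e2 e3 = eval_mp cst (lin (e1$1) (e2$1) (e3$1)) (lin (e1$2) (e2$2) (e3$2)) (lin (e1$3) (e2$3) (e3$3))"

lemma substitution_add: "substitution e1 e2 e3 (p + q) = substitution e1 e2 e3 p + substitution e1 e2 e3 q"
  unfolding substitution_def by (rule eval_mp_add) simp_all

lemma substitution_mult: "substitution e1 e2 e3 (p * q) = substitution e1 e2 e3 p * substitution e1 e2 e3 q"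
  unfolding substitution_def by (rule eval_mp_mult) simp_all

lemma substitution_const: "substitution e1 e2 e3 (const_mp c) = cst c"
  unfolding substitution_def by (simp add: eval_mp_single)

lemma substitution_linpoly: "substitution e1 e2 e3 (linpoly a) = lin (lform a e1) (lform a e2) (lform a e3)"
  unfolding substitution_def by (simp add: eval_mp_linpoly) (simp add: lin_def cst_def lform_def)

lemma substitution_0: "substitution e1 e2 e3 0 = 0"
  by (simp add: substitution_def eval_mp_def)

lemma substitution_1: "substitution e1 e2 e3 1 = 1"
  using substitution_const[of e1 e2 e3 1] by simp

lemma substitution_sum: "substitution e1 e2 e3 (sum f I) = (\<Sum>i\<in>I. substitution e1 e2 e3 (f i))"
  by (induction I rule: infinite_finite_induct) (simp_all add: substitution_0 substitution_add)

lemma substitution_prod: "substitution e1 e2 e3 (prod f I) = (\<Prod>i\<in>I. substitution e1 e2 e3 (f i))"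
  by (induction I rule: infinite_finite_induct) (simp_all add: substitution_1 substitution_mult)

text \<open>The matrix with rows \<open>n1, n2, n3\<close> and the matrix with columns
  \<open>e1, e2, e3\<close> are inverse to each other. One product reads off coordinates, the other
  expands vectors and forms in the bases.\<close>

definition dual_bases where
  "dual_bases e1 e2 e3 n1 n2 n3 \<longleftrightarrow>
    lform n1 e1 = 1 \<and> lform n1 e2 = 0 \<and> lform n1 e3 = 0 \<and>
    lform n2 e1 = 0 \<and> lform n2 e2 = 1 \<and> lform n2 e3 = 0 \<and>
    lform n3 e1 = 0 \<and> lform n3 e2 = 0 \<and> lform n3 e3 = 1 \<and>
    (\<forall>i j. e1 $ i * n1 $ j + e2 $ i * n2 $ j + e3 $ i * n3 $ j = (if i = j then 1 else 0))"

text \<open>The pull-back evaluated at the coordinates of \<open>v\<close> is the value of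
  \<open>p\<close> at \<open>v\<close>; so if it is zero, \<open>p\<close> vanishes at every
  point.\<close>

lemma substitution_eq_0_iff:
  assumes "dual_bases e1 e2 e3 n1 n2 n3"
  shows "substitution e1 e2 e3 p = 0 \<longleftrightarrow> p = 0"
proof
  assume 0: "substitution e1 e2 e3 p = 0"
  show "p = 0"
  proof (rule mpoly3_eq_0_if_vanishing)
    fix x y z :: complex
    define v :: "complex ^ 3" where "v = vector [x, y, z]"
    have v: "v $ i = e1 $ i * lform n1 v + e2 $ i * lform n2 v + e3 $ i * lform n3 v" for i
    proof -
      have "e1 $ i * lform n1 v + e2 $ i * lform n2 v + e3 $ i * lform n3 v = (\<Sum>j\<in>UNIV. (e1 $ i * n1 $ j + e2 $ i * n2 $ j + e3 $ i * n3 $ j) * v $ j)"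
        by (simp add: lform_def sum_3 algebra_simps)
      also have "\<dots> = (\<Sum>j\<in>UNIV. if i = j then v $ j else 0)"
        using assms unfolding dual_bases_def by (intro sum.cong) auto
      finally show ?thesis by simp
    qed
    have "ev3 (substitution e1 e2 e3 p) (lform n1 v) (lform n2 v) (lform n3 v) = eval_mp id (v $ 1) (v $ 2) (v $ 3) p"
      unfolding substitution_def ev3_eval_mp ev3_lin v[symmetric] by simp
    then show "eval_mp id x y z p = 0" using 0 by (simp add: v_def ev3_def)
  qed
qed (simp add: substitution_0)

lemma surj_substitution:
  assumes "dual_bases e1 e2 e3 n1 n2 n3"
  shows "\<exists>p. substitution e1 e2 e3 p = u"
proof -
  have "u \<in> range (substitution e1 e2 e3)"
  proof (rule subring_eq_UNIV)
    show "cst c \<in> range (substitution e1 e2 e3)" for c by (metis substitution_const rangeI)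
    show "lin 1 0 0 \<in> range (substitution e1 e2 e3)"
      using assms substitution_linpoly[of e1 e2 e3 n1] unfolding dual_bases_def by (metis rangeI)
    show "lin 0 1 0 \<in> range (substitution e1 e2 e3)"
      using assms substitution_linpoly[of e1 e2 e3 n2] unfolding dual_bases_def by (metis rangeI)
    show "lin 0 0 1 \<in> range (substitution e1 e2 e3)"
      using assms substitution_linpoly[of e1 e2 e3 n3] unfolding dual_bases_def by (metis rangeI)
  qed (auto simp flip: substitution_add substitution_mult)
  then show ?thesis by auto
qed

text \<open>The substitution is a ring isomorphism taking \<open>linpoly (f i)\<close> to
  \<open>L i\<close>. The triples in \<open>AR\<close> are vector fields, so their components have
  to be transformed too, by the dual forms.\<close>

lemma free_AR_if_modular_forms:
  assumes dual: "dual_bases e1 e2 e3 n1 n2 n3"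
    and "modular_forms I (\<lambda>i. lform (f i) e1) (\<lambda>i. lform (f i) e2) (\<lambda>i. lform (f i) e3)"
  shows "free_submodule (AR (\<Prod>i\<in>I. linpoly (f i)))"
proof -
  interpret modular_forms I "\<lambda>i. lform (f i) e1" "\<lambda>i. lform (f i) e2" "\<lambda>i. lform (f i) e3" by fact
  define S where "S = substitution e1 e2 e3"
  \<comment> \<open>The field \<open>(a, b, c)\<close> applied to the linear form \<open>n\<close>,
    in the new coordinates. For \<open>n1\<close>, \<open>n2\<close>, \<open>n3\<close> these are
    its new components.\<close>
  define N where "N n a b c = cst (n $ 1) * S a + cst (n $ 2) * S b + cst (n $ 3) * S c" for n :: "complex ^ 3" and a b c
  have dual': "e1 $ i * n1 $ j + e2 $ i * n2 $ j + e3 $ i * n3 $ j = (if i = j then 1 else 0)" for i j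
    using dual unfolding dual_bases_def by blast
  have cst_uminus: "cst (a - b) = cst a - cst b" for a b by (simp add: cst_def)
  have recover: "cst (e1 $ i) * N n1 a b c + cst (e2 $ i) * N n2 a b c + cst (e3 $ i) * N n3 a b c =
     cst (if i = 1 then 1 else 0) * S a + cst (if i = 2 then 1 else 0) * S b + cst (if i = 3 then 1 else 0) * S c" for i a b c
    unfolding dual'[symmetric] N_def by (simp add: distrib_left distrib_right mult_ac add_ac)
  have rec: "S a = cst (e1 $ 1) * N n1 a b c + cst (e2 $ 1) * N n2 a b c + cst (e3 $ 1) * N n3 a b c"
    "S b = cst (e1 $ 2) * N n1 a b c + cst (e2 $ 2) * N n2 a b c + cst (e3 $ 2) * N n3 a b c"
    "S c = cst (e1 $ 3) * N n1 a b c + cst (e2 $ 3) * N n2 a b c + cst (e3 $ 3) * N n3 a b c" for a b c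
    unfolding recover by simp_all
  have mem: "(a, b, c) \<in> AR (\<Prod>i\<in>I. linpoly (f i)) \<longleftrightarrow> (N n1 a b c, N n2 a b c, N n3 a b c) \<in> logder" for a b c
  proof -
    have "dot i (N n1 a b c) (N n2 a b c) (N n3 a b c) = S (const_mp (f i $ 1) * a + const_mp (f i $ 2) * b + const_mp (f i $ 3) * c)" for i
    proof -
      have "S (const_mp (f i $ 1) * a + const_mp (f i $ 2) * b + const_mp (f i $ 3) * c) = cst (f i $ 1) * S a + cst (f i $ 2) * S b + cst (f i $ 3) * S c"
        by (simp add: S_def substitution_add substitution_mult substitution_const)
      also have "\<dots> = dot i (N n1 a b c) (N n2 a b c) (N n3 a b c)"
        unfolding rec[of a b c] rec(2)[of b a c] rec(3)[of c a b] dot_def unfolding lform_def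
        by (simp add: distrib_left distrib_right mult_ac add_ac)
      finally show ?thesis by simp
    qed
    moreover have "L i = S (linpoly (f i))" for i
      by (simp add: L_def S_def substitution_linpoly)
    ultimately have "(N n1 a b c, N n2 a b c, N n3 a b c) \<in> logder \<longleftrightarrow>
      S (\<Sum>i\<in>I. (const_mp (f i $ 1) * a + const_mp (f i $ 2) * b + const_mp (f i $ 3) * c) * (\<Prod>j\<in>I-{i}. linpoly (f j))) = 0"
      unfolding logder_iff S_def by (simp add: substitution_sum substitution_prod substitution_mult)
    then show ?thesis
      unfolding AR_prod_linpoly[OF finite_B] S_def substitution_eq_0_iff[OF dual] by simp
  qed
  have surjN: "\<exists>a b c. N n1 a b c = P \<and> N n2 a b c = Q \<and> N n3 a b c = R" for P Q R
  proof -
    define g where "g i = cst (e1 $ i) * P + cst (e2 $ i) * Q + cst (e3 $ i) * R" for i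
    obtain a b c where "S a = g 1" "S b = g 2" "S c = g 3"
      unfolding S_def using surj_substitution[OF dual] by meson
    then have "N n a b c = cst (lform n e1) * P + cst (lform n e2) * Q + cst (lform n e3) * R" for n
      unfolding N_def g_def lform_def by (simp add: distrib_left distrib_right mult_ac add_ac)
    then have "N n1 a b c = P \<and> N n2 a b c = Q \<and> N n3 a b c = R"
      using dual unfolding dual_bases_def by simp
    then show ?thesis by blast
  qed
  have N_zero: "a = 0 \<and> b = 0 \<and> c = 0" if "N n1 a b c = 0" "N n2 a b c = 0" "N n3 a b c = 0" for a b c
  proof -
    have "S a = 0" "S b = 0" "S c = 0" using rec[where a=a and b=b and c=c] that by simp_all
    then show ?thesis unfolding S_def substitution_eq_0_iff[OF dual] by blast
  qed
  have N_lin: "N n (u * a + v * a') (u * b + v * b') (u * c + v * c') = S u * N n a b c + S v * N n a' b' c'" for n u v a b c a' b' c'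
    unfolding N_def S_def by (simp add: substitution_add substitution_mult distrib_left mult_ac add_ac)
  have N_diff: "N n (a - a') (b - b') (c - c') = N n a b c - N n a' b' c'" for n a b c a' b' c'
  proof -
    have "S 1 + S (- 1) = 0" unfolding S_def substitution_add[symmetric] by (simp add: substitution_0)
    then have "S (- 1) = - 1" by (simp add: S_def substitution_1 add_eq_0_iff)
    then show ?thesis using N_lin[of n 1 a "-1" a' b b' c c'] by (simp add: S_def substitution_1)
  qed
  obtain P2 Q2 R2 P3 Q3 R3 where B: "(P2, Q2, R2) \<in> logder \<and> (P3, Q3, R3) \<in> logder \<and>
    (\<forall>(P, Q, R) \<in> logder. \<exists>u v. P = u * P2 + v * P3 \<and> Q = u * Q2 + v * Q3 \<and> R = u * R2 + v * R3) \<and>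
    (\<forall>u v. u * P2 + v * P3 = 0 \<and> u * Q2 + v * Q3 = 0 \<and> u * R2 + v * R3 = 0 \<longrightarrow> u = 0 \<and> v = 0)"
    using logder_basis by (elim exE) (rule that)
  have basis: "(P2, Q2, R2) \<in> logder" "(P3, Q3, R3) \<in> logder"
    "\<And>P Q R. (P, Q, R) \<in> logder \<Longrightarrow> \<exists>u v. P = u * P2 + v * P3 \<and> Q = u * Q2 + v * Q3 \<and> R = u * R2 + v * R3"
    "\<And>u v. u * P2 + v * P3 = 0 \<Longrightarrow> u * Q2 + v * Q3 = 0 \<Longrightarrow> u * R2 + v * R3 = 0 \<Longrightarrow> u = 0 \<and> v = 0"
    using B by (blast, blast, fast, blast)
  obtain a2 b2 c2 where 2: "N n1 a2 b2 c2 = P2" "N n2 a2 b2 c2 = Q2" "N n3 a2 b2 c2 = R2" using surjN by blast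
  obtain a3 b3 c3 where 3: "N n1 a3 b3 c3 = P3" "N n2 a3 b3 c3 = Q3" "N n3 a3 b3 c3 = R3" using surjN by blast
  show ?thesis
  proof (rule free_submodule_if_basis_pair)
    show "(a2, b2, c2) \<in> AR (\<Prod>i\<in>I. linpoly (f i))" "(a3, b3, c3) \<in> AR (\<Prod>i\<in>I. linpoly (f i))"
      unfolding mem 2 3 by (fact basis)+
  next
    fix m assume m: "m \<in> AR (\<Prod>i\<in>I. linpoly (f i))"
    obtain a b c where abc: "m = (a, b, c)" by (metis prod_cases3)
    obtain u' v' where uv': "N n1 a b c = u' * P2 + v' * P3" "N n2 a b c = u' * Q2 + v' * Q3" "N n3 a b c = u' * R2 + v' * R3"
      using basis(3) m mem unfolding abc by blast
    \<comment> \<open>The coefficients are lifted through \<open>S\<close>; the difference of the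
      two fields then has zero components, and \<open>N_zero\<close> makes it zero.\<close>
    obtain u v where "S u = u'" "S v = v'" unfolding S_def using surj_substitution[OF dual] by meson
    then have "N n (a - (u * a2 + v * a3)) (b - (u * b2 + v * b3)) (c - (u * c2 + v * c3)) =
        N n a b c - (u' * N n a2 b2 c2 + v' * N n a3 b3 c3)" for n
      by (simp add: N_diff N_lin)
    then have "a - (u * a2 + v * a3) = 0 \<and> b - (u * b2 + v * b3) = 0 \<and> c - (u * c2 + v * c3) = 0"
      by (intro N_zero) (simp_all add: uv' 2 3)
    then show "\<exists>u v. m = smul3 u (a2, b2, c2) + smul3 v (a3, b3, c3)"
      unfolding abc by (intro exI[of _ u] exI[of _ v]) (simp add: smul3_def plus_prod_def)
  next
    fix u v assume "smul3 u (a2, b2, c2) + smul3 v (a3, b3, c3) = 0"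
    then have "u * a2 + v * a3 = 0" "u * b2 + v * b3 = 0" "u * c2 + v * c3 = 0"
      by (simp_all add: smul3_def plus_prod_def zero_prod_def)
    then have "S u * N n a2 b2 c2 + S v * N n a3 b3 c3 = 0" for n
      using N_lin[of n u a2 v a3 b2 b3 c2 c3] by (simp add: N_def S_def substitution_0)
    then have "S u = 0 \<and> S v = 0" using basis(4)[of "S u" "S v"] unfolding 2[symmetric] 3[symmetric] by blast
    then show "u = 0 \<and> v = 0" unfolding S_def substitution_eq_0_iff[OF dual] .
  qed
qed

section \<open>Maps into open subsets of the plane\<close>

text \<open>Every map from \<open>K\<close> to the punctured plane lifts through the exponential
  covering. This replaces simple connectedness of \<open>K\<close>.\<close>

definition has_logs :: "'a::topological_space set \<Rightarrow> bool" where
  "has_logs K \<longleftrightarrow> (\<forall>f::'a \<Rightarrow> complex. continuous_on K f \<and> (\<forall>x\<in>K. f x \<noteq> 0) \<longrightarrow>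
     (\<exists>g. continuous_on K g \<and> (\<forall>x\<in>K. f x = exp (g x))))"

text \<open>The difference takes values in the integer multiples of 2 pi i, distinct ones being at
  least 2 pi apart, so it is constant on a connected set.\<close>

lemma connected_logs_differ_const:
  fixes g1 g2 :: "'a::topological_space \<Rightarrow> complex"
  assumes S: "connected S" and g: "continuous_on S g1" "continuous_on S g2"
    and eq: "\<And>x. x \<in> S \<Longrightarrow> exp (g1 x) = exp (g2 x)"
  shows "\<exists>c. exp c = 1 \<and> (\<forall>x\<in>S. g1 x = g2 x + c)"
proof (cases "S = {}")
  case True
  then show ?thesis by (auto intro: exI[of _ 0])
next
  case False
  then obtain x0 where x0: "x0 \<in> S" by blast
  have 1: "exp (g1 x - g2 x) = 1" if "x \<in> S" for x
    using eq[OF that] by (simp add: exp_diff)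
  have "(\<lambda>x. g1 x - g2 x) constant_on S"
  proof (rule continuous_discrete_range_constant[OF S])
    show "\<exists>e>0. \<forall>y. y \<in> S \<and> g1 y - g2 y \<noteq> g1 x - g2 x \<longrightarrow> e \<le> norm (g1 y - g2 y - (g1 x - g2 x))" if x: "x \<in> S" for x
    proof (intro exI[of _ "2 * pi"] conjI allI impI)
      fix y assume y: "y \<in> S \<and> g1 y - g2 y \<noteq> g1 x - g2 x"
      then have "\<not> \<bar>Im (g1 y - g2 y) - Im (g1 x - g2 x)\<bar> < 2 * pi"
        using exp_complex_eqI[of "g1 y - g2 y" "g1 x - g2 x"] 1[of x] 1[of y] x by auto
      then show "2 * pi \<le> norm (g1 y - g2 y - (g1 x - g2 x))"
        using abs_Im_le_cmod[of "g1 y - g2 y - (g1 x - g2 x)"] by simp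
    qed simp
  qed (intro continuous_intros g)
  then obtain c where c: "\<And>x. x \<in> S \<Longrightarrow> g1 x - g2 x = c" unfolding constant_on_def by blast
  then have "\<forall>x\<in>S. g1 x = g2 x + c" by (metis add.commute diff_add_cancel)
  moreover have "exp c = 1" using 1[OF x0] c[OF x0] by simp
  ultimately show ?thesis by blast
qed

lemma connected_logs_eq:
  fixes g1 g2 :: "'a::topological_space \<Rightarrow> complex"
  assumes "connected S" "continuous_on S g1" "continuous_on S g2"
    "\<And>x. x \<in> S \<Longrightarrow> exp (g1 x) = exp (g2 x)" "x0 \<in> S" "g1 x0 = g2 x0" "x \<in> S"
  shows "g1 x = g2 x"
  using connected_logs_differ_const[OF assms(1-4)] assms(5-7) by fastforce

text \<open>The winding number of an exponential about 0 is the increment of its exponent divided by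
  2 pi i, and this increment is zero along a loop.\<close>

lemma winding_number_zero_if_log:
  assumes "path \<gamma>" "pathfinish \<gamma> = pathstart \<gamma>" "path_image \<gamma> \<subseteq> W"
    and g: "continuous_on W g" "\<And>z. z \<in> W \<Longrightarrow> z - a = exp (g z)"
  shows "winding_number \<gamma> a = 0"
proof -
  have p: "path (g \<circ> \<gamma>)" using assms by (auto intro!: path_continuous_image continuous_on_subset[of W])
  have "winding_number \<gamma> a = winding_number (\<lambda>t. \<gamma> t - a) 0" by (rule winding_number_offset)
  also have "\<dots> = winding_number (exp \<circ> (g \<circ> \<gamma>)) 0"
    by (rule winding_number_cong) (use assms(3) g(2) in \<open>auto simp: path_image_def image_subset_iff\<close>)
  also have "\<dots> = 0"
    unfolding winding_number_compose_exp[OF p] using assms(2) by (simp add: pathfinish_def pathstart_def)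
  finally show ?thesis .
qed

text \<open>If the union of the \<open>V i\<close> winds around a point \<open>a\<close> outside of it, then passing to a
  logarithm of \<open>f - a\<close> unrolls the cover and strictly lowers the number of intersecting pairs
  of its members; otherwise the union is contractible.\<close>
lemma nullhomotopic_in_cover:
  fixes f :: "'a::topological_space \<Rightarrow> complex" and V :: "'i \<Rightarrow> complex set"
  assumes K: "has_logs K" "connected K" "K \<noteq> {}" and "finite I"
    and P: "K = (\<Union>i\<in>I. P i)" "\<And>i. i \<in> I \<Longrightarrow> connected (P i)" "\<And>i. i \<in> I \<Longrightarrow> P i \<noteq> {}"
    and "continuous_on K f" and "\<And>i. i \<in> I \<Longrightarrow> f ` P i \<subseteq> V i"
    and "\<And>i. i \<in> I \<Longrightarrow> open (V i)" "\<And>i. i \<in> I \<Longrightarrow> simply_connected (V i)"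
    and "\<And>i j. i \<in> I \<Longrightarrow> j \<in> I \<Longrightarrow> connected (V i \<inter> V j)"
  shows "\<exists>c. homotopic_with_canon (\<lambda>_. True) K (\<Union>i\<in>I. V i) f (\<lambda>_. c)"
  using assms(8-)
proof (induction "card {(i, j) \<in> I \<times> I. V i \<inter> V j \<noteq> {}}" arbitrary: V f rule: less_induct)
  case (less V f)
  note f = less.prems(1) and fV = less.prems(2) and V = less.prems(3-5)
  define W where "W = (\<Union>i\<in>I. V i)"
  have opW: "open W" unfolding W_def using V by auto
  have fW: "f ` K \<subseteq> W" using fV unfolding P(1) W_def by blast
  \<comment> \<open>Every \<open>V i\<close> meets the connected image of \<open>K\<close>.
    Connectedness of the union is needed for the winding number criterion of simple
    connectedness.\<close>
  have "connected (\<Union>i\<in>I. f ` K \<union> V i)"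
  proof (rule connected_Union)
    fix S assume "S \<in> (\<lambda>i. f ` K \<union> V i) ` I"
    then obtain i where i: "i \<in> I" "S = f ` K \<union> V i" by blast
    have "f ` K \<inter> V i \<noteq> {}" using P(3)[OF i(1)] fV[OF i(1)] P(1) i(1) by blast
    then show "connected S" unfolding i(2) using K(2) f V(2)[OF i(1)]
      by (intro connected_Un connected_continuous_image simply_connected_imp_connected)
  next
    show "\<Inter> ((\<lambda>i. f ` K \<union> V i) ` I) \<noteq> {}" using K(3) by blast
  qed
  moreover have "(\<Union>i\<in>I. f ` K \<union> V i) = W" using fW K(3) P(1) unfolding W_def by blast
  ultimately have conW: "connected W" by simp
  show ?case
  proof (cases "simply_connected W")
    case True
    then have "contractible W" using contractible_eq_simply_connected_2d[OF opW] by simp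
    then have contr: "contractible_space (top_of_set W)" by simp
    have "continuous_map (top_of_set K) (top_of_set W) f" using f fW by auto
    from nullhomotopic_into_contractible_space[OF this contr]
    obtain c where "homotopic_with_canon (\<lambda>_. True) K W f (\<lambda>_. c)" .
    then show ?thesis unfolding W_def[symmetric] by blast
  next
    case False
    then obtain \<gamma> a where \<gamma>: "path \<gamma>" "path_image \<gamma> \<subseteq> W" "pathfinish \<gamma> = pathstart \<gamma>" "a \<notin> W"
      "winding_number \<gamma> a \<noteq> 0"
      using simply_connected_eq_winding_number_zero[OF opW] conW by blast
    have "\<exists>g. continuous_on K g \<and> (\<forall>x\<in>K. f x - a = exp (g x))"
    proof -
      have "\<forall>x\<in>K. f x - a \<noteq> 0" using \<gamma>(4) fW by auto
      moreover have "continuous_on K (\<lambda>x. f x - a)" by (intro continuous_intros f)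
      ultimately show ?thesis using K(1) unfolding has_logs_def by blast
    qed
    then obtain f1 where f1: "continuous_on K f1" "\<And>x. x \<in> K \<Longrightarrow> f x - a = exp (f1 x)" by blast
    \<comment> \<open>A logarithm of \<open>z - a\<close> on \<open>V i\<close>, shifted by a period
      so as to match \<open>f1\<close> on the connected piece \<open>P i\<close>.\<close>
    have "\<exists>g. continuous_on (V i) g \<and> (\<forall>z\<in>V i. z - a = exp (g z)) \<and> (\<forall>x\<in>P i. f1 x = g (f x))" if i: "i \<in> I" for i
    proof -
      have "\<forall>z\<in>V i. z - a \<noteq> 0" using \<gamma>(4) i unfolding W_def by auto
      moreover have "continuous_on (V i) (\<lambda>z. z - a)" by (intro continuous_intros)
      ultimately have "\<exists>g. continuous_on (V i) g \<and> (\<forall>z\<in>V i. z - a = exp (g z))"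
        using V(2)[OF i] unfolding simply_connected_eq_continuous_log[OF V(1)[OF i]] by blast
      then obtain g where g: "continuous_on (V i) g" "\<And>z. z \<in> V i \<Longrightarrow> z - a = exp (g z)" by blast
      have PK: "P i \<subseteq> K" using P(1) i by blast
      have fP: "continuous_on (P i) f" using f PK continuous_on_subset by blast
      have "\<exists>c. exp c = 1 \<and> (\<forall>x\<in>P i. f1 x = (g \<circ> f) x + c)"
      proof (rule connected_logs_differ_const)
        show "connected (P i)" by (rule P(2)[OF i])
        show "continuous_on (P i) f1" using f1 PK continuous_on_subset by blast
        show "continuous_on (P i) (g \<circ> f)" using fP fV[OF i] g(1) by (intro continuous_on_compose) (auto intro: continuous_on_subset)
        show "exp (f1 x) = exp ((g \<circ> f) x)" if "x \<in> P i" for x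
        proof -
          have "x \<in> K" "f x \<in> V i" using that fV[OF i] PK by auto
          then have "f x - a = exp (f1 x)" "f x - a = exp (g (f x))" using f1(2) g(2) by blast+
          then show ?thesis by simp
        qed
      qed
      then obtain c where c: "exp c = 1" "\<And>x. x \<in> P i \<Longrightarrow> f1 x = g (f x) + c" by auto
      show ?thesis
        by (rule exI[of _ "\<lambda>z. g z + c"]) (use g c in \<open>auto intro!: continuous_intros simp: exp_add\<close>)
    qed
    then have "\<forall>i. \<exists>g. i \<in> I \<longrightarrow> continuous_on (V i) g \<and> (\<forall>z\<in>V i. z - a = exp (g z)) \<and> (\<forall>x\<in>P i. f1 x = g (f x))" by blast
    then obtain g where g: "\<And>i. i \<in> I \<Longrightarrow> continuous_on (V i) (g i) \<and> (\<forall>z\<in>V i. z - a = exp (g i z)) \<and> (\<forall>x\<in>P i. f1 x = g i (f x))"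
      unfolding choice_iff by blast
    then have gc: "\<And>i. i \<in> I \<Longrightarrow> continuous_on (V i) (g i)"
      and ge: "\<And>i z. i \<in> I \<Longrightarrow> z \<in> V i \<Longrightarrow> z - a = exp (g i z)"
      and gf: "\<And>i x. i \<in> I \<Longrightarrow> x \<in> P i \<Longrightarrow> f1 x = g i (f x)"
      by blast+
    define V1 where "V1 i = g i ` V i" for i
    have inj: "inj_on (g i) (V i)" if "i \<in> I" for i
    proof (rule inj_onI)
      fix z w assume "z \<in> V i" "w \<in> V i" "g i z = g i w"
      then have "z - a = w - a" using ge[OF that, of z] ge[OF that, of w] by simp
      then show "z = w" by simp
    qed
    \<comment> \<open>A common point of two lifted sets lies over a single point of the overlap. The
      two logarithms agree there, hence on the whole connected overlap.\<close>
    have agree: "g i z = g j z" if ij: "i \<in> I" "j \<in> I" and ne: "V1 i \<inter> V1 j \<noteq> {}" and z: "z \<in> V i \<inter> V j" for i j z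
    proof -
      obtain z1 z2 where z12: "z1 \<in> V i" "z2 \<in> V j" "g i z1 = g j z2" using ne unfolding V1_def by blast
      then have "z1 - a = z2 - a" using ge[OF ij(1), of z1] ge[OF ij(2), of z2] by simp
      then have "z1 = z2" by simp
      show ?thesis
      proof (rule connected_logs_eq[OF V(3)[OF ij], where ?g1.0 = "g i" and ?g2.0 = "g j"])
        show "exp (g i x) = exp (g j x)" if "x \<in> V i \<inter> V j" for x
          using ge[OF ij(1), of x] ge[OF ij(2), of x] that by simp
        show "z1 \<in> V i \<inter> V j" "g i z1 = g j z1" using z12 \<open>z1 = z2\<close> by auto
      qed (use gc[OF ij(1)] gc[OF ij(2)] z in \<open>auto intro: continuous_on_subset\<close>)
    qed
    have down: "V i \<inter> V j \<noteq> {}" if ij: "i \<in> I" "j \<in> I" and ne: "V1 i \<inter> V1 j \<noteq> {}" for i j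
    proof -
      obtain z1 z2 where z12: "z1 \<in> V i" "z2 \<in> V j" "g i z1 = g j z2" using ne unfolding V1_def by blast
      then have "z1 - a = z2 - a" using ge[OF ij(1), of z1] ge[OF ij(2), of z2] by simp
      then have "z1 = z2" by simp
      then show ?thesis using z12 by blast
    qed
    \<comment> \<open>If no overlap came apart, the \<open>g i\<close> would glue to a logarithm of
      \<open>z - a\<close> on \<open>W\<close>, against the nonzero winding number.\<close>
    have "\<exists>i\<in>I. \<exists>j\<in>I. V i \<inter> V j \<noteq> {} \<and> V1 i \<inter> V1 j = {}"
    proof (rule ccontr)
      assume "\<not> ?thesis"
      then have meet: "V1 i \<inter> V1 j \<noteq> {}" if "i \<in> I" "j \<in> I" "z \<in> V i \<inter> V j" for i j z using that by blast
      define G where "G z = g (SOME i. i \<in> I \<and> z \<in> V i) z" for z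
      have G: "G z = g i z" if "i \<in> I" "z \<in> V i" for i z
      proof -
        have "(SOME i. i \<in> I \<and> z \<in> V i) \<in> I \<and> z \<in> V (SOME i. i \<in> I \<and> z \<in> V i)"
          using someI[of "\<lambda>i. i \<in> I \<and> z \<in> V i"] that by blast
        then show ?thesis unfolding G_def using agree meet that by blast
      qed
      have "continuous_on W G" unfolding W_def
      proof (rule continuous_on_open_UN)
        fix i assume "i \<in> I"
        then show "continuous_on (V i) G" using gc[of i] G[of i] by (simp cong: continuous_on_cong)
      qed (rule V(1))
      moreover have "z - a = exp (G z)" if "z \<in> W" for z using that ge G unfolding W_def by fastforce
      ultimately show False using winding_number_zero_if_log[OF \<gamma>(1,3,2)] \<gamma>(5) by blast
    qed
    then have "{(i, j) \<in> I \<times> I. V1 i \<inter> V1 j \<noteq> {}} \<subset> {(i, j) \<in> I \<times> I. V i \<inter> V j \<noteq> {}}"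
      using down by blast
    moreover have "finite {(i, j) \<in> I \<times> I. V i \<inter> V j \<noteq> {}}"
      by (rule finite_subset[of _ "I \<times> I"]) (use \<open>finite I\<close> in auto)
    ultimately have "card {(i, j) \<in> I \<times> I. V1 i \<inter> V1 j \<noteq> {}} < card {(i, j) \<in> I \<times> I. V i \<inter> V j \<noteq> {}}"
      by (rule psubset_card_mono[rotated])
    then have "\<exists>c. homotopic_with_canon (\<lambda>_. True) K (\<Union>i\<in>I. V1 i) f1 (\<lambda>_. c)"
    proof (rule less.hyps)
      show "f1 ` P i \<subseteq> V1 i" if "i \<in> I" for i using gf[OF that] fV[OF that] unfolding V1_def by auto
      show "open (V1 i)" if "i \<in> I" for i
        unfolding V1_def using invariance_of_domain[OF gc V(1) inj] that by blast
      show "simply_connected (V1 i)" if i: "i \<in> I" for i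
      proof -
        have "homeomorphism (V i) (V1 i) (g i) (\<lambda>w. exp w + a)"
          unfolding homeomorphism_def V1_def using gc[OF i] ge[OF i, symmetric]
          by (auto intro!: continuous_intros simp: image_image)
        then have "V i homeomorphic V1 i" unfolding homeomorphic_def by blast
        then show ?thesis using V(2)[OF i] homeomorphic_simply_connected_eq by blast
      qed
      show "connected (V1 i \<inter> V1 j)" if ij: "i \<in> I" "j \<in> I" for i j
      proof (cases "V1 i \<inter> V1 j = {}")
        case False
        have "V1 i \<inter> V1 j = g i ` (V i \<inter> V j)"
        proof
          show "g i ` (V i \<inter> V j) \<subseteq> V1 i \<inter> V1 j"
          proof
            fix w assume "w \<in> g i ` (V i \<inter> V j)"
            then obtain z where "z \<in> V i \<inter> V j" "w = g i z" by blast
            then have "z \<in> V i" "z \<in> V j" "w = g i z" "w = g j z" using agree[OF ij False, of z] by auto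
            then show "w \<in> V1 i \<inter> V1 j" unfolding V1_def by blast
          qed
          show "V1 i \<inter> V1 j \<subseteq> g i ` (V i \<inter> V j)"
          proof
            fix w assume "w \<in> V1 i \<inter> V1 j"
            then obtain z1 z2 where z12: "z1 \<in> V i" "z2 \<in> V j" "w = g i z1" "w = g j z2" unfolding V1_def by blast
            then have "z1 - a = z2 - a" using ge[OF ij(1), of z1] ge[OF ij(2), of z2] by simp
            then have "z1 = z2" by simp
            then show "w \<in> g i ` (V i \<inter> V j)" using z12 by blast
          qed
        qed
        then show ?thesis
          using connected_continuous_image[OF continuous_on_subset[OF gc[OF ij(1)] Int_lower1] V(3)[OF ij]] by simp
      qed simp
    qed (rule f1(1))
    then obtain c where c: "homotopic_with_canon (\<lambda>_. True) K (\<Union>i\<in>I. V1 i) f1 (\<lambda>_. c)" by blast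
    \<comment> \<open>Project the contraction of \<open>f1\<close> back down; the projection takes
      each \<open>V1 i\<close> to \<open>V i\<close> and \<open>f1\<close> to
      \<open>f\<close>.\<close>
    have "homotopic_with_canon (\<lambda>_. True) K W ((\<lambda>w. exp w + a) \<circ> f1) ((\<lambda>w. exp w + a) \<circ> (\<lambda>_. c))"
    proof (rule homotopic_with_compose_continuous_left)
      show "(\<lambda>w. exp w + a) \<in> (\<Union>i\<in>I. V1 i) \<rightarrow> W"
        using ge[symmetric] unfolding V1_def W_def by fastforce
    qed (use c in \<open>auto intro!: continuous_intros\<close>)
    then have "homotopic_with_canon (\<lambda>_. True) K W f (\<lambda>_. exp c + a)"
      by (rule homotopic_with_eq) (use f1(2)[symmetric] in auto)
    then show ?thesis unfolding W_def by blast
  qed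
qed

text \<open>The image is covered by finitely many balls, whose convexity makes them simply connected
  with connected intersections. The hypothesis \<open>loc\<close> supplies connected pieces of
  \<open>K\<close> that are mapped into single balls.\<close>

theorem nullhomotopic_into_open_plane:
  fixes f :: "'a::topological_space \<Rightarrow> complex"
  assumes K: "has_logs K" "connected K" "K \<noteq> {}" "compact K"
    and loc: "\<And>x U. x \<in> K \<Longrightarrow> open U \<Longrightarrow> x \<in> U \<Longrightarrow>
      \<exists>T P. open T \<and> x \<in> T \<and> T \<inter> K \<subseteq> P \<and> P \<subseteq> U \<inter> K \<and> connected P"
    and f: "continuous_on K f" "f ` K \<subseteq> W" and W: "open W"
  shows "\<exists>c. homotopic_with_canon (\<lambda>_. True) K W f (\<lambda>_. c)"
proof -
  define good where "good x T P e \<longleftrightarrow> open T \<and> x \<in> T \<and> T \<inter> K \<subseteq> P \<and> P \<subseteq> K \<and> connected P \<and> ball (f x) e \<subseteq> W \<and> f ` P \<subseteq> ball (f x) e"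
    for x :: 'a and T P :: "'a set" and e :: real
  have "\<exists>T P e. good x T P e" if x: "x \<in> K" for x
  proof -
    have "f x \<in> W" using f(2) x by auto
    with W obtain e where e: "e > 0" "ball (f x) e \<subseteq> W" by (rule openE)
    have "\<exists>U. open U \<and> U \<inter> K = f -` ball (f x) e \<inter> K"
      using continuous_on_open_invariant[THEN iffD1, OF f(1), rule_format, of "ball (f x) e"] by auto
    then obtain U where U: "open U" "U \<inter> K = f -` ball (f x) e \<inter> K" by blast
    then have "x \<in> U" using x e by auto
    from loc[OF x U(1) this] obtain T P where T: "open T" "x \<in> T" "T \<inter> K \<subseteq> P" "P \<subseteq> U \<inter> K" "connected P"
      by (elim exE conjE)
    then have "f ` P \<subseteq> ball (f x) e" using U(2) by auto
    with T e have "good x T P e" unfolding good_def by simp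
    then show ?thesis by blast
  qed
  then obtain T P e where *: "\<And>x. x \<in> K \<Longrightarrow> good x (T x) (P x) (e x)" by metis
  have T: "\<And>x. x \<in> K \<Longrightarrow> open (T x)" "\<And>x. x \<in> K \<Longrightarrow> x \<in> T x" "\<And>x. x \<in> K \<Longrightarrow> T x \<inter> K \<subseteq> P x"
    and P: "\<And>x. x \<in> K \<Longrightarrow> P x \<subseteq> K" "\<And>x. x \<in> K \<Longrightarrow> connected (P x)"
    and e: "\<And>x. x \<in> K \<Longrightarrow> ball (f x) (e x) \<subseteq> W" "\<And>x. x \<in> K \<Longrightarrow> f ` P x \<subseteq> ball (f x) (e x)"
    using * unfolding good_def by presburger+
  have "K \<subseteq> (\<Union>x\<in>K. T x)" using T(2) by auto
  with K(4) T(1) obtain I where I: "I \<subseteq> K" "finite I" "K \<subseteq> (\<Union>x\<in>I. T x)"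
    by (rule_tac compactE_image[of K K T]) simp_all
  have sub: "(\<Union>x\<in>I. ball (f x) (e x)) \<subseteq> W" using e(1) I(1) by blast
  have "\<exists>c. homotopic_with_canon (\<lambda>_. True) K (\<Union>x\<in>I. ball (f x) (e x)) f (\<lambda>_. c)"
  proof (rule nullhomotopic_in_cover[OF K(1-3) I(2), where P = P and V = "\<lambda>x. ball (f x) (e x)"])
    show "K = (\<Union>i\<in>I. P i)"
    proof
      show "K \<subseteq> (\<Union>i\<in>I. P i)" using I(1,3) T(3) by fastforce
      show "(\<Union>i\<in>I. P i) \<subseteq> K" using I(1) P(1) by auto
    qed
  next
    fix i assume "i \<in> I"
    then have "i \<in> K" using I(1) by blast
    then show "connected (P i)" "P i \<noteq> {}" "f ` P i \<subseteq> ball (f i) (e i)"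
      using P(2)[of i] e(2)[of i] T(2)[of i] T(3)[of i] by auto
  next
    show "connected (ball (f i) (e i) \<inter> ball (f j) (e j))" for i j
      by (intro convex_connected convex_Int convex_ball)
    show "simply_connected (ball (f i) (e i))" for i by (simp add: convex_imp_simply_connected)
  qed (use f(1) in simp_all)
  then obtain c where "homotopic_with_canon (\<lambda>_. True) K (\<Union>x\<in>I. ball (f x) (e x)) f (\<lambda>_. c)" ..
  then have "homotopic_with_canon (\<lambda>_. True) K W f (\<lambda>_. c)" by (rule homotopic_with_subset_right[OF _ sub])
  then show ?thesis by blast
qed

section \<open>Spheres\<close>

text \<open>Follow \<open>H\<close> from the constant map to the identity in short time steps: the
  quotient of the values of \<open>f\<close> along \<open>H\<close> at consecutive times stays
  within distance 1 of 1, where the principal \<open>Ln\<close> is continuous.\<close>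

lemma has_logs_if_contractible:
  fixes K :: "'a::metric_space set" and H :: "real \<times> 'a \<Rightarrow> 'a"
  assumes K: "compact K" and H: "continuous_on ({0..1} \<times> K) H" "H ` ({0..1} \<times> K) \<subseteq> K"
    and H01: "\<And>y. y \<in> K \<Longrightarrow> H (0, y) = x0" "\<And>y. y \<in> K \<Longrightarrow> H (1, y) = y"
  shows "has_logs K"
  unfolding has_logs_def
proof (intro allI impI)
  fix f :: "'a \<Rightarrow> complex" assume f: "continuous_on K f \<and> (\<forall>x\<in>K. f x \<noteq> 0)"
  show "\<exists>g. continuous_on K g \<and> (\<forall>x\<in>K. f x = exp (g x))"
  proof (cases "K = {}")
    case False
    define C where "C = {0..1::real} \<times> K"
    define F where "F = f \<circ> H"
    have compC: "compact C" unfolding C_def by (intro compact_Times compact_Icc K)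
    have F: "continuous_on C F" unfolding F_def C_def
      using H f by (intro continuous_on_compose) (auto intro: continuous_on_subset)
    have F0: "F p \<noteq> 0" if "p \<in> C" for p using that H(2) f unfolding F_def C_def by auto
    have "C \<noteq> {}" using False unfolding C_def by auto
    \<comment> \<open>The minimum of the norm is the tolerance: two values closer than this have a
      quotient within distance 1 of 1.\<close>
    then obtain p0 where p0: "p0 \<in> C" "\<And>p. p \<in> C \<Longrightarrow> norm (F p0) \<le> norm (F p)"
      using continuous_attains_inf[OF compC _ continuous_on_norm[OF F]] by auto
    have "uniformly_continuous_on C F" by (rule compact_uniformly_continuous[OF F compC])
    moreover have "norm (F p0) > 0" using F0[OF p0(1)] by simp
    ultimately obtain d where d: "d > 0" "\<And>p q. p \<in> C \<Longrightarrow> q \<in> C \<Longrightarrow> dist q p < d \<Longrightarrow> dist (F q) (F p) < norm (F p0)"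
      unfolding uniformly_continuous_on_def by blast
    obtain N :: nat where N: "N > 0" "1 / real N < d"
      using reals_Archimedean[OF d(1)] by (metis inverse_eq_divide of_nat_Suc zero_less_Suc)
    have sl: "continuous_on K (\<lambda>y. F (u, y))" if "u \<in> {0..1}" for u
      by (rule continuous_on_compose2[OF F]) (use that in \<open>auto simp: C_def intro!: continuous_intros\<close>)
    have "\<exists>g. continuous_on K g \<and> (\<forall>y\<in>K. F (real j / real N, y) = exp (g y))" if "j \<le> N" for j
      using that
    proof (induction j)
      case 0
      obtain y0 where y0: "y0 \<in> K" using False by blast
      have "F (0, y) = f x0" if "y \<in> K" for y using H01(1)[OF that] by (simp add: F_def)
      moreover have "f x0 \<noteq> 0" using F0[of "(0, y0)"] y0 H01(1)[OF y0] by (simp add: F_def C_def)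
      ultimately show ?case by (intro exI[of _ "\<lambda>_. Ln (f x0)"]) simp
    next
      case (Suc j)
      then obtain g where g: "continuous_on K g" "\<And>y. y \<in> K \<Longrightarrow> F (real j / real N, y) = exp (g y)" by auto
      let ?u = "real j / real N" and ?v = "real (Suc j) / real N"
      have uv: "?u \<in> {0..1}" "?v \<in> {0..1}" using Suc.prems N by auto
      have near: "norm (F (?v, y) / F (?u, y) - 1) < 1" if y: "y \<in> K" for y
      proof -
        have in_C: "(?u, y) \<in> C" "(?v, y) \<in> C" using uv y unfolding C_def by auto
        have "dist (?v, y) (?u, y) = \<bar>?v - ?u\<bar>" by (simp add: dist_prod_def dist_real_def)
        also have "\<dots> = 1 / real N" using N by (simp add: field_simps)
        finally have "dist (F (?v, y)) (F (?u, y)) < norm (F p0)" using d(2) in_C N(2) by simp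
        also have "\<dots> \<le> norm (F (?u, y))" by (rule p0(2)[OF in_C(1)])
        finally have "norm (F (?v, y) - F (?u, y)) / norm (F (?u, y)) < 1"
          using F0[OF in_C(1)] by (simp add: dist_norm)
        moreover have "F (?v, y) / F (?u, y) - 1 = (F (?v, y) - F (?u, y)) / F (?u, y)"
          using F0[OF in_C(1)] by (simp add: diff_divide_distrib)
        ultimately show ?thesis by (simp add: norm_divide)
      qed
      have notneg: "F (?v, y) / F (?u, y) \<notin> \<real>\<^sub>\<le>\<^sub>0" if y: "y \<in> K" for y
      proof
        assume "F (?v, y) / F (?u, y) \<in> \<real>\<^sub>\<le>\<^sub>0"
        then have "Re (F (?v, y) / F (?u, y)) \<le> 0" by (simp add: complex_nonpos_Reals_iff)
        moreover have "\<bar>Re (F (?v, y) / F (?u, y) - 1)\<bar> < 1"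
          using near[OF y] abs_Re_le_cmod le_less_trans by blast
        ultimately show False by simp
      qed
      show ?case
      proof (intro exI[of _ "\<lambda>y. g y + Ln (F (?v, y) / F (?u, y))"] conjI ballI)
        show "continuous_on K (\<lambda>y. g y + Ln (F (?v, y) / F (?u, y)))"
          using notneg F0 uv by (intro continuous_intros g sl) (auto simp: C_def)
        fix y assume y: "y \<in> K"
        then have "F (?u, y) \<noteq> 0" "F (?v, y) \<noteq> 0" using F0 uv by (auto simp: C_def)
        then show "F (?v, y) = exp (g y + Ln (F (?v, y) / F (?u, y)))"
          using g(2)[OF y] by (simp add: exp_add)
      qed
    qed
    from this[of N] obtain g where "continuous_on K g" "\<And>y. y \<in> K \<Longrightarrow> F (1, y) = exp (g y)" using N by auto
    then show ?thesis using H01(2) by (auto simp: F_def)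
  qed simp
qed

text \<open>On the connected intersection the two logarithms differ by a period; shifting one of
  them lets them be glued.\<close>

lemma has_logs_Un:
  fixes K1 K2 :: "'a::topological_space set"
  assumes "has_logs K1" "has_logs K2" "closed K1" "closed K2" "connected (K1 \<inter> K2)"
  shows "has_logs (K1 \<union> K2)"
  unfolding has_logs_def
proof (intro allI impI)
  fix f :: "'a \<Rightarrow> complex" assume f: "continuous_on (K1 \<union> K2) f \<and> (\<forall>x\<in>K1 \<union> K2. f x \<noteq> 0)"
  then have f12: "continuous_on K1 f" "continuous_on K2 f" by (auto intro: continuous_on_subset)
  obtain g1 where g1: "continuous_on K1 g1" "\<And>x. x \<in> K1 \<Longrightarrow> f x = exp (g1 x)"
    using assms(1) f f12 unfolding has_logs_def by blast
  obtain g2 where g2: "continuous_on K2 g2" "\<And>x. x \<in> K2 \<Longrightarrow> f x = exp (g2 x)"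
    using assms(2) f f12 unfolding has_logs_def by blast
  have "\<exists>c. exp c = 1 \<and> (\<forall>x\<in>K1 \<inter> K2. g1 x = g2 x + c)"
  proof (rule connected_logs_differ_const[OF assms(5)])
    show "continuous_on (K1 \<inter> K2) g1" "continuous_on (K1 \<inter> K2) g2"
      using g1(1) g2(1) by (auto intro: continuous_on_subset)
    show "exp (g1 x) = exp (g2 x)" if "x \<in> K1 \<inter> K2" for x
      using that g1(2)[of x] g2(2)[of x] by simp
  qed
  then obtain c where c: "exp c = 1" "\<And>x. x \<in> K1 \<inter> K2 \<Longrightarrow> g1 x = g2 x + c" by blast
  have "continuous_on (K1 \<union> K2) (\<lambda>x. if x \<in> K1 then g1 x else g2 x + c)"
    using assms(3,4) g1(1) g2(1) c by (intro continuous_on_If continuous_intros) auto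
  moreover have "f x = exp (if x \<in> K1 then g1 x else g2 x + c)" if "x \<in> K1 \<union> K2" for x
    using that g1(2) g2(2) c(1) by (auto simp: exp_add)
  ultimately show "\<exists>g. continuous_on (K1 \<union> K2) g \<and> (\<forall>x\<in>K1 \<union> K2. f x = exp (g x))" by blast
qed

text \<open>The carrier of \<open>nsphere n\<close>, as a subset of a function space with the
  product topology of its type.\<close>

definition Sph :: "nat \<Rightarrow> (nat \<Rightarrow> real) set" where
  "Sph n = {x. (\<Sum>i\<le>n. x i ^ 2) = 1 \<and> (\<forall>i>n. x i = 0)}"

lemma nsphere_eq_top_of_set: "nsphere n = top_of_set (Sph n)"
  by (simp add: nsphere Sph_def euclidean_product_topology)

text \<open>The chord from \<open>x\<close> to \<open>snd p\<close> at time \<open>fst p\<close>,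
  projected radially to the sphere; \<open>arc_domain\<close> is where the chord misses the
  origin.\<close>

definition great_arc :: "nat \<Rightarrow> (nat \<Rightarrow> real) \<Rightarrow> real \<times> (nat \<Rightarrow> real) \<Rightarrow> nat \<Rightarrow> real" where
  "great_arc n x p = (\<lambda>i. ((1 - fst p) * x i + fst p * snd p i) / sqrt (\<Sum>i\<le>n. ((1 - fst p) * x i + fst p * snd p i)\<^sup>2))"

definition inner_upto :: "nat \<Rightarrow> (nat \<Rightarrow> real) \<Rightarrow> (nat \<Rightarrow> real) \<Rightarrow> real" where
  "inner_upto n x y = (\<Sum>i\<le>n. x i * y i)"

definition arc_domain :: "nat \<Rightarrow> (nat \<Rightarrow> real) \<Rightarrow> (real \<times> (nat \<Rightarrow> real)) set" where
  "arc_domain n x = {p. (\<Sum>i\<le>n. ((1 - fst p) * x i + fst p * snd p i)\<^sup>2) > 0}"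

lemma continuous_coord: "continuous_on S (\<lambda>p. snd p i :: real)" for S :: "(real \<times> (nat \<Rightarrow> real)) set"
  by (rule continuous_on_product_then_coordinatewise) (intro continuous_intros)

lemma open_arc_domain: "open (arc_domain n x)"
  unfolding arc_domain_def by (intro open_Collect_less continuous_intros continuous_coord)

lemma continuous_great_arc: "continuous_on (arc_domain n x) (great_arc n x)"
  unfolding great_arc_def
  by (intro continuous_intros continuous_coord) (auto simp: arc_domain_def)

text \<open>For unit vectors at an angle of at most 90 degrees, the squared norm on the chord is at
  least \<open>(1 - t)\<^sup>2 + t\<^sup>2\<close>.\<close>

lemma Sph_in_arc_domain:
  assumes x: "x \<in> Sph n" and y: "y \<in> Sph n" "inner_upto n x y \<ge> 0" and t: "0 \<le> t" "t \<le> 1"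
  shows "(t, y) \<in> arc_domain n x"
proof -
  have "(\<Sum>i\<le>n. ((1 - t) * x i + t * y i)\<^sup>2) = (1 - t)\<^sup>2 * (\<Sum>i\<le>n. x i ^ 2) + 2 * t * (1 - t) * inner_upto n x y + t\<^sup>2 * (\<Sum>i\<le>n. y i ^ 2)"
    unfolding inner_upto_def sum_distrib_left sum.distrib[symmetric]
    by (rule sum.cong) (simp_all add: power2_eq_square algebra_simps)
  also have "\<dots> = (1 - t)\<^sup>2 + 2 * t * (1 - t) * inner_upto n x y + t\<^sup>2" using x y by (simp add: Sph_def)
  also have "\<dots> \<ge> (1 - t)\<^sup>2 + t\<^sup>2" using t y by simp
  moreover have "(1 - t)\<^sup>2 + t\<^sup>2 > 0"
    by (cases "t = 0") (auto intro: add_nonneg_pos)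
  ultimately show ?thesis unfolding arc_domain_def by simp
qed

lemma great_arc_in_Sph:
  assumes "x \<in> Sph n" "y \<in> Sph n" "(t, y) \<in> arc_domain n x"
  shows "great_arc n x (t, y) \<in> Sph n"
proof -
  define s where "s = (\<Sum>i\<le>n. ((1 - t) * x i + t * y i)\<^sup>2)"
  have "s > 0" using assms(3) by (simp add: arc_domain_def s_def)
  then have "(\<Sum>i\<le>n. (great_arc n x (t, y) i)\<^sup>2) = (\<Sum>i\<le>n. ((1 - t) * x i + t * y i)\<^sup>2 / s)"
    unfolding great_arc_def by (simp add: power_divide s_def[symmetric])
  also have "\<dots> = 1" using \<open>s > 0\<close> by (simp add: s_def flip: sum_divide_distrib)
  finally show ?thesis using assms(1,2) by (simp add: Sph_def great_arc_def)
qed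

lemma great_arc_0: "x \<in> Sph n \<Longrightarrow> great_arc n x (0, y) = x"
  by (simp add: great_arc_def Sph_def)

lemma great_arc_1: "y \<in> Sph n \<Longrightarrow> great_arc n x (1, y) = y"
  by (simp add: great_arc_def Sph_def)

lemma great_arc_refl: "x \<in> Sph n \<Longrightarrow> great_arc n x (t, x) = x"
  by (simp add: great_arc_def Sph_def flip: distrib_right)

lemma connected_arcs:
  assumes x: "x \<in> Sph n" and dom: "\<And>y. y \<in> S \<Longrightarrow> {0..1} \<times> {y} \<subseteq> arc_domain n x"
  shows "connected (\<Union>y\<in>S. great_arc n x ` ({0..1} \<times> {y}))"
proof (rule connected_Union)
  fix s assume "s \<in> (\<lambda>y. great_arc n x ` ({0..1} \<times> {y})) ` S"
  then obtain y where y: "y \<in> S" "s = great_arc n x ` ({0..1} \<times> {y})" by blast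
  have "continuous_on ({0..1} \<times> {y}) (great_arc n x)" using continuous_great_arc dom[OF y(1)] continuous_on_subset by blast
  then show "connected s" unfolding y(2)
    by (intro connected_continuous_image connected_Times) auto
next
  have "x \<in> great_arc n x ` ({0..1} \<times> {y})" for y
    by (rule image_eqI[of _ _ "(0, y)"]) (use great_arc_0[OF x(1)] in auto)
  then show "\<Inter> ((\<lambda>y. great_arc n x ` ({0..1} \<times> {y})) ` S) \<noteq> {}" by (metis (no_types, lifting) INT_I empty_iff)
qed

text \<open>The set is star-shaped about \<open>x\<close> with respect to great arcs.\<close>

lemma connected_if_great_arc:
  assumes x: "x \<in> Sph n" "x \<in> S" and S: "S \<subseteq> Sph n" "\<And>y. y \<in> S \<Longrightarrow> inner_upto n x y \<ge> 0"
    "\<And>y t. y \<in> S \<Longrightarrow> 0 \<le> t \<Longrightarrow> t \<le> 1 \<Longrightarrow> great_arc n x (t, y) \<in> S"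
  shows "connected S"
proof -
  have "connected (\<Union>y\<in>S. great_arc n x ` ({0..1} \<times> {y}))"
    by (rule connected_arcs[OF x(1)]) (use Sph_in_arc_domain[OF x(1)] S in auto)
  moreover have "(\<Union>y\<in>S. great_arc n x ` ({0..1} \<times> {y})) = S"
  proof
    show "(\<Union>y\<in>S. great_arc n x ` ({0..1} \<times> {y})) \<subseteq> S" using S(3) by auto
    show "S \<subseteq> (\<Union>y\<in>S. great_arc n x ` ({0..1} \<times> {y}))"
    proof
      fix y assume y: "y \<in> S"
      then have "y \<in> great_arc n x ` ({0..1} \<times> {y})"
        by (intro image_eqI[of _ _ "(1, y)"]) (use great_arc_1[of y n x] S(1) in auto)
      with y show "y \<in> (\<Union>z\<in>S. great_arc n x ` ({0..1} \<times> {z}))" by (intro UN_I[where a = y]) simp_all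
    qed
  qed
  ultimately show ?thesis by simp
qed

text \<open>The constant arc at \<open>x\<close> stays in \<open>U\<close>, so by the tube lemma the
  great arcs from \<open>x\<close> to all nearby points do. Their union is the connected set
  \<open>P\<close>.\<close>

lemma locally_connected_Sph:
  assumes x: "x \<in> Sph n" and U: "open U" "x \<in> U"
  shows "\<exists>T P. open T \<and> x \<in> T \<and> T \<inter> Sph n \<subseteq> P \<and> P \<subseteq> U \<inter> Sph n \<and> connected P"
proof -
  define W where "W = arc_domain n x \<inter> great_arc n x -` U"
  have "open W" unfolding W_def by (rule continuous_open_preimage[OF continuous_great_arc open_arc_domain U(1)])
  moreover have "inner_upto n x x \<ge> 0" by (simp add: inner_upto_def sum_nonneg)
  then have "{0..1} \<times> {x} \<subseteq> W" using Sph_in_arc_domain[OF x x] great_arc_refl[OF x] U by (auto simp: W_def)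
  ultimately obtain A T where T: "open T" "{0..1} \<subseteq> A" "x \<in> T" "A \<times> T \<subseteq> W"
    using tube_lemma_left[of euclidean euclidean W "{0..1}" x] by (auto simp: prod_topology_euclidean)
  define P where "P = (\<Union>y\<in>T \<inter> Sph n. great_arc n x ` ({0..1} \<times> {y}))"
  have in_W: "(t, y) \<in> W" if "y \<in> T" "0 \<le> t" "t \<le> 1" for t y using T(2,4) that by auto
  have "connected P" unfolding P_def
    by (rule connected_arcs[OF x]) (use in_W in \<open>auto simp: W_def\<close>)
  moreover have "T \<inter> Sph n \<subseteq> P"
  proof
    fix y assume y: "y \<in> T \<inter> Sph n"
    then have "y \<in> great_arc n x ` ({0..1} \<times> {y})"
      by (intro image_eqI[of _ _ "(1, y)"]) (use great_arc_1[of y n x] in auto)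
    with y show "y \<in> P" unfolding P_def by (intro UN_I[where a = y]) simp_all
  qed
  moreover have "P \<subseteq> U \<inter> Sph n"
    using in_W great_arc_in_Sph[OF x] unfolding P_def W_def by auto
  ultimately show ?thesis using T by blast
qed

lemma continuous_coord': "continuous_on S (\<lambda>x. x i :: real)" for S :: "(nat \<Rightarrow> real) set"
  by (rule continuous_on_subset[OF continuous_on_product_coordinates]) simp

lemma closed_Sph: "closed (Sph n)"
proof -
  have "Sph n = {x. (\<Sum>i\<le>n. x i ^ 2) = 1} \<inter> (\<Inter>i\<in>{n<..}. {x. x i = 0})"
    by (auto simp: Sph_def)
  also have "closed \<dots>"
    by (intro closed_Int closed_INT ballI closed_Collect_eq continuous_intros continuous_coord')
  finally show ?thesis .
qed

lemma compact_Sph: "compact (Sph n)"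
proof -
  \<comment> \<open>Tychonoff's theorem for the infinite cube that contains the sphere.\<close>
  have "compactin (product_topology (\<lambda>_. euclideanreal) UNIV) (PiE UNIV (\<lambda>_::nat. {-1..1::real}))"
    by (simp add: compactin_PiE)
  then have "compact (PiE UNIV (\<lambda>_::nat. {-1..1::real}))"
    by (simp add: euclidean_product_topology)
  moreover have "Sph n \<subseteq> PiE UNIV (\<lambda>_::nat. {-1..1::real})"
  proof
    fix x assume x: "x \<in> Sph n"
    have "x i \<in> {-1..1}" for i
    proof (cases "i \<le> n")
      case True
      have "x i ^ 2 \<le> (\<Sum>i\<le>n. x i ^ 2)" using True by (intro member_le_sum) auto
      also have "\<dots> = 1" using x by (simp add: Sph_def)
      finally have "\<bar>x i\<bar> \<le> 1" by (simp add: abs_square_le_1)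
      then show ?thesis by auto
    qed (use x in \<open>auto simp: Sph_def\<close>)
    then show "x \<in> PiE UNIV (\<lambda>_::nat. {-1..1::real})" by auto
  qed
  ultimately show ?thesis using closed_Sph by (metis compact_Int_closed inf.absorb_iff2)
qed

definition axis_point :: "nat \<Rightarrow> real \<Rightarrow> nat \<Rightarrow> real" where "axis_point k s = (\<lambda>i. if i = k then s else 0)"

lemma axis_point_in_Sph: "k \<le> n \<Longrightarrow> s\<^sup>2 = 1 \<Longrightarrow> axis_point k s \<in> Sph n"
  by (auto simp: Sph_def axis_point_def if_distrib[of "\<lambda>x. x ^ 2"] cong: if_cong)

lemma inner_upto_axis_point: "k \<le> n \<Longrightarrow> inner_upto n (axis_point k s) y = s * y k"
proof -
  assume "k \<le> n"
  have "inner_upto n (axis_point k s) y = (\<Sum>i\<le>n. if i = k then s * y k else 0)"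
    unfolding inner_upto_def axis_point_def by (rule sum.cong) auto
  then show ?thesis using \<open>k \<le> n\<close> by simp
qed

text \<open>Great arcs from a pole stay in its closed hemisphere; \<open>s\<close> is the sign of
  the pole and \<open>c\<close> the normalising norm.\<close>

lemma scaled_combination_nonneg:
  fixes s t y c :: real
  assumes "s\<^sup>2 = 1" "s * y \<ge> 0" "0 \<le> t" "t \<le> 1" "c \<ge> 0"
  shows "s * (((1 - t) * s + t * y) / c) \<ge> 0"
proof -
  have "s * ((1 - t) * s + t * y) = (1 - t) * s\<^sup>2 + t * (s * y)" by (simp add: power2_eq_square algebra_simps)
  also have "\<dots> \<ge> 0" using assms mult_nonneg_nonneg[of t "s * y"] by auto
  finally show ?thesis using assms(5) by (simp add: divide_nonneg_nonneg)
qed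

text \<open>The predicate \<open>Z\<close> selects coordinates to be zero, so that the lemma covers
  the hemispheres of the sphere and those of its equator.\<close>

lemma connected_half:
  assumes "k \<le> n" "s\<^sup>2 = 1" "\<And>i. Z i \<Longrightarrow> i \<noteq> k"
  shows "connected {y \<in> Sph n. s * y k \<ge> 0 \<and> (\<forall>i. Z i \<longrightarrow> y i = 0)}" (is "connected ?S")
proof (rule connected_if_great_arc)
  show b: "axis_point k s \<in> Sph n" by (rule axis_point_in_Sph) fact+
  then show "axis_point k s \<in> ?S" using assms by (auto simp: axis_point_def)
  show "inner_upto n (axis_point k s) y \<ge> 0" if "y \<in> ?S" for y using that assms(1) by (simp add: inner_upto_axis_point)
  fix y and t :: real assume y: "y \<in> ?S" and t: "0 \<le> t" "t \<le> 1"
  then have "(t, y) \<in> arc_domain n (axis_point k s)" using assms(1) by (intro Sph_in_arc_domain b) (auto simp: inner_upto_axis_point)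
  moreover have "s * (((1 - t) * s + t * y k) / c) \<ge> 0" if "c \<ge> 0" for c
    using scaled_combination_nonneg assms(2) y t that by blast
  ultimately show "great_arc n (axis_point k s) (t, y) \<in> ?S"
    using y great_arc_in_Sph[OF b] assms(3) by (auto simp: great_arc_def axis_point_def sum_nonneg)
qed auto

lemma has_logs_half:
  assumes "k \<le> n" "s\<^sup>2 = 1"
  shows "has_logs {y \<in> Sph n. s * y k \<ge> 0}" (is "has_logs ?S")
proof (rule has_logs_if_contractible)
  have b: "axis_point k s \<in> Sph n" by (rule axis_point_in_Sph) fact+
  have "?S = Sph n \<inter> {y. s * y k \<ge> 0}" by auto
  moreover have "closed {y. s * y k \<ge> 0}" by (intro closed_Collect_le continuous_intros continuous_coord')
  ultimately show "compact ?S" using compact_Sph by (metis compact_Int_closed)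
  have arc_domain: "(t, y) \<in> arc_domain n (axis_point k s)" if "y \<in> ?S" "0 \<le> t" "t \<le> 1" for t y
    using that assms(1) by (intro Sph_in_arc_domain b) (auto simp: inner_upto_axis_point)
  show "continuous_on ({0..1} \<times> ?S) (great_arc n (axis_point k s))"
    by (rule continuous_on_subset[OF continuous_great_arc]) (use arc_domain in auto)
  show "great_arc n (axis_point k s) ` ({0..1} \<times> ?S) \<subseteq> ?S"
  proof clarify
    fix y and t :: real assume y: "y \<in> Sph n" "s * y k \<ge> 0" and t: "t \<in> {0..1}"
    have "s * (((1 - t) * s + t * y k) / c) \<ge> 0" if "c \<ge> 0" for c
      using scaled_combination_nonneg assms(2) y t that by simp
    then show "great_arc n (axis_point k s) (t, y) \<in> Sph n \<and> s * great_arc n (axis_point k s) (t, y) k \<ge> 0"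
      using y t great_arc_in_Sph[OF b y(1)] arc_domain by (auto simp: great_arc_def axis_point_def sum_nonneg)
  qed
  show "great_arc n (axis_point k s) (0, y) = axis_point k s" "great_arc n (axis_point k s) (1, y) = y" if "y \<in> ?S" for y
    using that great_arc_0[OF b] great_arc_1 by auto
qed

lemma Sph_eq_halves: "Sph n = {y \<in> Sph n. 1 * y 0 \<ge> 0} \<union> {y \<in> Sph n. -1 * y 0 \<ge> 0}"
  by auto

text \<open>Here dimension at least two enters: the halves of the equator share a point on the axis
  of coordinate 2. The equator of the circle consists of two points.\<close>

lemma connected_equator:
  assumes "n \<ge> 2"
  shows "connected {y \<in> Sph n. y 0 = 0}"
proof -
  have "connected ({y \<in> Sph n. 1 * y 1 \<ge> 0 \<and> (\<forall>i. i = 0 \<longrightarrow> y i = 0)} \<union>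
      {y \<in> Sph n. -1 * y 1 \<ge> 0 \<and> (\<forall>i. i = 0 \<longrightarrow> y i = 0)})"
  proof (intro connected_Un connected_half)
    have "axis_point 2 1 \<in> Sph n" using assms by (intro axis_point_in_Sph) auto
    then show "{y \<in> Sph n. 1 * y 1 \<ge> 0 \<and> (\<forall>i. i = 0 \<longrightarrow> y i = 0)} \<inter>
      {y \<in> Sph n. -1 * y 1 \<ge> 0 \<and> (\<forall>i. i = 0 \<longrightarrow> y i = 0)} \<noteq> {}"
      by (intro exI[of "\<lambda>x. x \<in> _" "axis_point 2 1", THEN ex_in_conv[THEN iffD1]]) (simp add: axis_point_def)
  qed (use assms in auto)
  also have "{y \<in> Sph n. 1 * y 1 \<ge> 0 \<and> (\<forall>i. i = 0 \<longrightarrow> y i = 0)} \<union>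
      {y \<in> Sph n. -1 * y 1 \<ge> 0 \<and> (\<forall>i. i = 0 \<longrightarrow> y i = 0)} = {y \<in> Sph n. y 0 = 0}"
    by auto
  finally show ?thesis .
qed

lemma has_logs_Sph: "n \<ge> 2 \<Longrightarrow> has_logs (Sph n)"
proof -
  assume n: "n \<ge> 2"
  have closed: "closed {y \<in> Sph n. s * y 0 \<ge> 0}" for s
  proof -
    have "{y \<in> Sph n. s * y 0 \<ge> 0} = Sph n \<inter> {y. s * y 0 \<ge> 0}" by auto
    then show ?thesis
      by (simp only:) (intro closed_Int closed_Sph closed_Collect_le continuous_intros continuous_coord')
  qed
  have "{y \<in> Sph n. 1 * y 0 \<ge> 0} \<inter> {y \<in> Sph n. -1 * y 0 \<ge> 0} = {y \<in> Sph n. y 0 = 0}" by auto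
  then show ?thesis
    by (subst Sph_eq_halves, intro has_logs_Un has_logs_half closed) (use connected_equator[OF n] in auto)
qed

lemma connected_Sph: 
  assumes "n \<ge> 2" shows "connected (Sph n)"
proof (subst Sph_eq_halves, rule connected_Un)
  show "connected {y \<in> Sph n. 1 * y 0 \<ge> 0}" using connected_half[of 0 n 1 "\<lambda>_. False"] by simp
  show "connected {y \<in> Sph n. - 1 * y 0 \<ge> 0}" using connected_half[of 0 n "-1" "\<lambda>_. False"] by simp
  have "axis_point 1 1 \<in> {y \<in> Sph n. 1 * y 0 \<ge> 0} \<inter> {y \<in> Sph n. - 1 * y 0 \<ge> 0}"
    using assms axis_point_in_Sph[of 1 n 1] by (simp add: axis_point_def)
  then show "{y \<in> Sph n. 1 * y 0 \<ge> 0} \<inter> {y \<in> Sph n. - 1 * y 0 \<ge> 0} \<noteq> {}" by blast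
qed

lemma Sph_nonempty: "Sph n \<noteq> {}"
  using axis_point_in_Sph[of 0 n 1] by auto

section \<open>Complements of graphs of affine functions\<close>

lemma uniform_positive_lower_bound:
  fixes \<phi> :: "'q \<Rightarrow> 'a::topological_space \<Rightarrow> real"
  assumes "finite Q" "compact C" "\<And>q. q \<in> Q \<Longrightarrow> continuous_on C (\<phi> q)"
    "\<And>q p. q \<in> Q \<Longrightarrow> p \<in> C \<Longrightarrow> \<phi> q p > 0"
  shows "\<exists>\<delta>>0. \<forall>q\<in>Q. \<forall>p\<in>C. \<delta> \<le> \<phi> q p"
  using assms(1,3,4)
proof (induction Q rule: finite_induct)
  case empty
  then show ?case by (auto intro: exI[of _ 1])
next
  case (insert q Q)
  then obtain \<delta> where \<delta>: "\<delta> > 0" "\<forall>q\<in>Q. \<forall>p\<in>C. \<delta> \<le> \<phi> q p" by auto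
  have "\<exists>\<epsilon>>0. \<forall>p\<in>C. \<epsilon> \<le> \<phi> q p"
  proof (cases "C = {}")
    case True
    then show ?thesis by (auto intro: exI[of _ 1])
  next
    case False
    then obtain p0 where "p0 \<in> C" "\<forall>p\<in>C. \<phi> q p0 \<le> \<phi> q p"
      using continuous_attains_inf[OF assms(2) False] insert.prems(1)[of q] by auto
    then show ?thesis using insert.prems(2)[of q p0] by auto
  qed
  then obtain \<epsilon> where "\<epsilon> > 0" "\<forall>p\<in>C. \<epsilon> \<le> \<phi> q p" by blast
  then show ?case using \<delta> by (intro exI[of _ "min \<delta> \<epsilon>"]) (auto simp: min_le_iff_disj)
qed

text \<open>An affine function is stored as the pair of its slope and its value at 0.\<close>

definition graph_val :: "complex \<times> complex \<Rightarrow> complex \<Rightarrow> complex" where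
  "graph_val g t = fst g * t + snd g"

lemma continuous_graph_val [continuous_intros]:
  "continuous_on S f \<Longrightarrow> continuous_on S (\<lambda>x. graph_val g (f x))"
  unfolding graph_val_def by (intro continuous_intros)

text \<open>A tent of height 1 vanishing from distance \<open>\<delta>\<close> on; its Lipschitz
  constant \<open>1 / \<delta>\<close> decides how far punctures may be pushed.\<close>

definition bump :: "real \<Rightarrow> real \<Rightarrow> real" where
  "bump \<delta> r = max 0 (1 - r / \<delta>)"

lemma bump_lipschitz: "\<delta> > 0 \<Longrightarrow> \<bar>bump \<delta> r - bump \<delta> r'\<bar> \<le> \<bar>r - r'\<bar> / \<delta>"
proof -
  assume \<delta>: "\<delta> > 0"
  have "\<bar>bump \<delta> r - bump \<delta> r'\<bar> \<le> \<bar>r / \<delta> - r' / \<delta>\<bar>" unfolding bump_def by linarith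
  also have "\<dots> = \<bar>r - r'\<bar> / \<delta>" using \<delta> by (simp add: abs_divide flip: diff_divide_distrib)
  finally show ?thesis .
qed

text \<open>The push \<open>z \<mapsto> z + (\<Sum>h\<in>G. bump \<delta> \<bar>z - w h\<bar> * d h)\<close> moves \<open>w g\<close> to \<open>w g + d g\<close> and is
  injective, being the identity plus a contraction.\<close>
lemma push_avoids:
  fixes w d :: "'g \<Rightarrow> complex"
  assumes G: "finite G" "g \<in> G" and \<delta>: "\<delta> > 0"
    and sep: "\<And>h. h \<in> G \<Longrightarrow> h \<noteq> g \<Longrightarrow> \<delta> \<le> norm (w g - w h)"
    and small: "(\<Sum>h\<in>G. norm (d h)) < \<delta>"
    and z: "z \<noteq> w g"
  shows "z + (\<Sum>h\<in>G. of_real (bump \<delta> (norm (z - w h))) * d h) \<noteq> w g + d g"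
proof
  assume eq: "z + (\<Sum>h\<in>G. of_real (bump \<delta> (norm (z - w h))) * d h) = w g + d g"
  \<comment> \<open>The other centres are at distance at least \<open>\<delta>\<close> from
    \<open>w g\<close>, so only its own bump acts on it.\<close>
  have "(\<Sum>h\<in>G. of_real (bump \<delta> (norm (w g - w h))) * d h) = (\<Sum>h\<in>G. if h = g then d g else 0)"
  proof (rule sum.cong)
    fix h assume h: "h \<in> G"
    show "of_real (bump \<delta> (norm (w g - w h))) * d h = (if h = g then d g else 0)"
    proof (cases "h = g")
      case False
      then have "1 - norm (w g - w h) / \<delta> \<le> 0" using sep[OF h] \<delta> by simp
      then show ?thesis using False by (simp add: bump_def)
    qed (simp add: bump_def)
  qed simp
  also have "\<dots> = d g" using G by simp
  finally have "d g = (\<Sum>h\<in>G. of_real (bump \<delta> (norm (w g - w h))) * d h)" by simp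
  with eq have "z - w g = (\<Sum>h\<in>G. of_real (bump \<delta> (norm (w g - w h))) * d h) - (\<Sum>h\<in>G. of_real (bump \<delta> (norm (z - w h))) * d h)"
    by (simp add: algebra_simps)
  also have "\<dots> = (\<Sum>h\<in>G. of_real (bump \<delta> (norm (w g - w h)) - bump \<delta> (norm (z - w h))) * d h)"
    by (simp add: left_diff_distrib sum_subtractf)
  finally have "norm (z - w g) \<le> (\<Sum>h\<in>G. norm (of_real (bump \<delta> (norm (w g - w h)) - bump \<delta> (norm (z - w h))) * d h))"
    by (metis norm_sum)
  also have "\<dots> \<le> (\<Sum>h\<in>G. norm (z - w g) / \<delta> * norm (d h))"
  proof (rule sum_mono)
    fix h
    have "\<bar>bump \<delta> (norm (w g - w h)) - bump \<delta> (norm (z - w h))\<bar> \<le> \<bar>norm (w g - w h) - norm (z - w h)\<bar> / \<delta>"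
      by (rule bump_lipschitz[OF \<delta>])
    also have "\<dots> \<le> norm (z - w g) / \<delta>"
      using norm_triangle_ineq3[of "w g - w h" "z - w h"] \<delta> by (intro divide_right_mono) (auto simp: norm_minus_commute)
    finally show "norm (of_real (bump \<delta> (norm (w g - w h)) - bump \<delta> (norm (z - w h))) * d h) \<le> norm (z - w g) / \<delta> * norm (d h)"
      unfolding norm_mult norm_of_real by (intro mult_right_mono) auto
  qed
  also have "\<dots> = norm (z - w g) / \<delta> * (\<Sum>h\<in>G. norm (d h))" by (simp add: sum_distrib_left)
  also have "\<dots> < norm (z - w g) / \<delta> * \<delta>"
    using small z \<delta> by (intro mult_strict_left_mono) auto
  finally show False using \<delta> by simp
qed

text \<open>At time \<open>u\<close> the fibre over \<open>T (u, x)\<close> is punctured at the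
  values of the graphs. The lift is extended over short time intervals, on each of which the
  punctures move too little to leave the range of \<open>push_avoids\<close>.\<close>

lemma lift_homotopy_avoiding_graphs:
  fixes K :: "'a::metric_space set" and T :: "real \<times> 'a \<Rightarrow> complex"
  assumes K: "compact K" and T: "continuous_on ({0..1} \<times> K) T" and s0: "continuous_on K s0" and G: "finite G"
    and sep: "\<And>g h p. g \<in> G \<Longrightarrow> h \<in> G \<Longrightarrow> g \<noteq> h \<Longrightarrow> p \<in> {0..1} \<times> K \<Longrightarrow> graph_val g (T p) \<noteq> graph_val h (T p)"
    and start: "\<And>x g. x \<in> K \<Longrightarrow> g \<in> G \<Longrightarrow> s0 x \<noteq> graph_val g (T (0, x))"
  shows "\<exists>S. continuous_on ({0..1} \<times> K) S \<and> (\<forall>x\<in>K. S (0, x) = s0 x) \<and>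
     (\<forall>p\<in>{0..1} \<times> K. \<forall>g\<in>G. S p \<noteq> graph_val g (T p))"
proof -
  define C where "C = {0..1::real} \<times> K"
  have compC: "compact C" unfolding C_def by (intro compact_Times compact_Icc K)
  have T': "continuous_on C T" using T unfolding C_def .
  \<comment> \<open>A lower bound for the distance of two punctures during the whole homotopy, used
    as the radius of the bumps.\<close>
  have "\<exists>\<delta>>0. \<forall>q\<in>{q \<in> G \<times> G. fst q \<noteq> snd q}. \<forall>p\<in>C. \<delta> \<le> norm (graph_val (fst q) (T p) - graph_val (snd q) (T p))"
  proof (rule uniform_positive_lower_bound[OF _ compC])
    fix q assume q: "q \<in> {q \<in> G \<times> G. fst q \<noteq> snd q}"
    show "continuous_on C (\<lambda>p. norm (graph_val (fst q) (T p) - graph_val (snd q) (T p)))"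
      by (intro continuous_intros T')
    show "norm (graph_val (fst q) (T p) - graph_val (snd q) (T p)) > 0" if "p \<in> C" for p
      using sep[of "fst q" "snd q" p] q that unfolding C_def by (simp add: mem_Times_iff)
  qed (use G in simp)
  then obtain \<delta> where \<delta>0: "\<delta> > 0"
    "\<forall>q\<in>{q \<in> G \<times> G. fst q \<noteq> snd q}. \<forall>p\<in>C. \<delta> \<le> norm (graph_val (fst q) (T p) - graph_val (snd q) (T p))"
    by blast
  have \<delta>: "\<delta> > 0"
    "\<And>g h p. g \<in> G \<Longrightarrow> h \<in> G \<Longrightarrow> h \<noteq> g \<Longrightarrow> p \<in> C \<Longrightarrow> \<delta> \<le> norm (graph_val g (T p) - graph_val h (T p))"
    using \<delta>0(1) bspec[OF \<delta>0(2), of "(g, h)" for g h] by auto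
  \<comment> \<open>When the base point moves by \<open>D\<close>, the puncture of \<open>g\<close>
    moves by \<open>fst g * D\<close>; so \<open>A\<close> times the norm of \<open>D\<close> bounds
    the total displacement. The added 1 permits division by \<open>A\<close>.\<close>
  define A where "A = (\<Sum>g\<in>G. norm (fst g)) + 1"
  have A: "A > 0" unfolding A_def by (simp add: add_nonneg_pos sum_nonneg)
  have "uniformly_continuous_on C T" by (rule compact_uniformly_continuous[OF T' compC])
  moreover have "\<delta> / A > 0" using \<delta> A by simp
  ultimately obtain \<eta> where \<eta>: "\<eta> > 0" "\<And>p q. p \<in> C \<Longrightarrow> q \<in> C \<Longrightarrow> dist q p < \<eta> \<Longrightarrow> dist (T q) (T p) < \<delta> / A"
    unfolding uniformly_continuous_on_def by blast
  obtain N :: nat where N: "N > 0" "1 / real N < \<eta>"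
    using reals_Archimedean[OF \<eta>(1)] by (metis inverse_eq_divide of_nat_Suc zero_less_Suc)
  have "\<exists>S. continuous_on C S \<and> (\<forall>x\<in>K. S (0, x) = s0 x) \<and>
     (\<forall>u x g. 0 \<le> u \<longrightarrow> u \<le> real j / real N \<longrightarrow> x \<in> K \<longrightarrow> g \<in> G \<longrightarrow> S (u, x) \<noteq> graph_val g (T (u, x)))" if "j \<le> N" for j
    using that
  proof (induction j)
    case 0
    have "continuous_on C (\<lambda>p. s0 (snd p))"
      by (rule continuous_on_compose2[OF s0]) (auto simp: C_def intro!: continuous_intros)
    then show ?case using start by (intro exI[of _ "\<lambda>p. s0 (snd p)"]) auto
  next
    case (Suc j)
    then obtain S where S: "continuous_on C S" "\<And>x. x \<in> K \<Longrightarrow> S (0, x) = s0 x"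
      "\<And>u x g. 0 \<le> u \<Longrightarrow> u \<le> real j / real N \<Longrightarrow> x \<in> K \<Longrightarrow> g \<in> G \<Longrightarrow> S (u, x) \<noteq> graph_val g (T (u, x))"
      by auto
    define c where "c = real j / real N"
    have c: "0 \<le> c" "c \<le> 1" using Suc.prems N unfolding c_def by auto
    \<comment> \<open>Up to time \<open>c\<close> this is \<open>S\<close>, as the
      \<open>max\<close> makes the displacements zero. Afterwards the value at time \<open>c\<close>
      is pushed along with the punctures, a formula that is continuous across
      \<open>c\<close>.\<close>
    define S' where "S' p = S (min (fst p) c, snd p) + (\<Sum>g\<in>G. of_real (bump \<delta> (norm (S (c, snd p) - graph_val g (T (c, snd p)))))
        * (fst g * (T (max (fst p) c, snd p) - T (c, snd p))))" for p
    have "continuous_on C (\<lambda>p. F (\<phi> (fst p), snd p))" if "continuous_on C F" "continuous_on {0..1} \<phi>" "\<phi> ` {0..1} \<subseteq> {0..1}"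
      for F :: "real \<times> 'a \<Rightarrow> complex" and \<phi> :: "real \<Rightarrow> real"
    proof (rule continuous_on_compose2[OF that(1)])
      have "continuous_on C (\<lambda>p. \<phi> (fst p))"
        by (rule continuous_on_compose2[OF that(2)]) (auto simp: C_def intro!: continuous_intros)
      then show "continuous_on C (\<lambda>p. (\<phi> (fst p), snd p))" by (intro continuous_intros)
    qed (use that(3) in \<open>auto simp: C_def\<close>)
    note sub = this
    have "continuous_on C (\<lambda>p. S (min (fst p) c, snd p))" "continuous_on C (\<lambda>p. T (max (fst p) c, snd p))"
      "continuous_on C (\<lambda>p. S (c, snd p))" "continuous_on C (\<lambda>p. T (c, snd p))"
      by (rule sub[OF S(1), of "\<lambda>u. min u c"] sub[OF T', of "\<lambda>u. max u c"] sub[OF S(1), of "\<lambda>u. c"] sub[OF T', of "\<lambda>u. c"];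
        use c in \<open>auto intro!: continuous_intros\<close>)+
    then have "continuous_on C S'" unfolding S'_def bump_def by (intro continuous_intros) (use \<delta> in auto)
    moreover have "S' (0, x) = s0 x" if "x \<in> K" for x
      using S(2)[OF that] c by (simp add: S'_def min_absorb1 max_absorb2)
    moreover have "S' (u, x) \<noteq> graph_val g (T (u, x))"
      if u: "0 \<le> u" "u \<le> real (Suc j) / real N" and x: "x \<in> K" and g: "g \<in> G" for u x g
    proof (cases "u \<le> c")
      case True
      then show ?thesis using S(3)[of u x g] u x g by (simp add: S'_def c_def max_absorb2)
    next
      case False
      let ?D = "T (u, x) - T (c, x)"
      have "real (Suc j) / real N \<le> 1" using Suc.prems N by simp
      then have in_C: "(u, x) \<in> C" "(c, x) \<in> C" using u x c unfolding C_def by auto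
      have "u - c \<le> 1 / real N" using u unfolding c_def by (simp add: add_divide_distrib)
      then have "dist (u, x) (c, x) < \<eta>" using False N(2) by (simp add: dist_prod_def dist_real_def)
      then have "norm ?D < \<delta> / A" using \<eta>(2)[OF in_C(2,1)] by (simp add: dist_norm)
      then have "A * norm ?D < \<delta>" using A by (simp add: field_simps)
      moreover have "(\<Sum>h\<in>G. norm (fst h * ?D)) \<le> A * norm ?D"
        unfolding norm_mult A_def by (simp add: sum_distrib_right distrib_right)
      ultimately have small: "(\<Sum>h\<in>G. norm (fst h * ?D)) < \<delta>" by simp
      have "S (c, x) + (\<Sum>h\<in>G. of_real (bump \<delta> (norm (S (c, x) - graph_val h (T (c, x))))) * (fst h * ?D))
          \<noteq> graph_val g (T (c, x)) + fst g * ?D"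
        by (rule push_avoids[OF G g \<delta>(1) _ small]) (use \<delta>(2)[OF g _ _ in_C(2)] S(3)[of c x g] c x g in \<open>auto simp: c_def\<close>)
      moreover have "graph_val g (T (c, x)) + fst g * ?D = graph_val g (T (u, x))" by (simp add: graph_val_def algebra_simps)
      ultimately show ?thesis using False by (simp add: S'_def min_absorb2 max_absorb1)
    qed
    ultimately show ?case by blast
  qed
  from this[of N] obtain S where "continuous_on C S" "\<forall>x\<in>K. S (0, x) = s0 x"
     "\<forall>u x g. 0 \<le> u \<longrightarrow> u \<le> 1 \<longrightarrow> x \<in> K \<longrightarrow> g \<in> G \<longrightarrow> S (u, x) \<noteq> graph_val g (T (u, x))" using N by auto
  then show ?thesis unfolding C_def by (intro exI[of _ S]) auto
qed

section \<open>Contractions and paths in the complement of vertical lines and graphs\<close>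

definition graph_complement :: "complex set \<Rightarrow> (complex \<times> complex) set \<Rightarrow> (complex \<times> complex) set" where
  "graph_complement F G = {(t, s). t \<notin> F \<and> (\<forall>g\<in>G. s \<noteq> graph_val g t)}"

lemma nullhomotopic_into_graph_complement:
  fixes K :: "'a::metric_space set"
  assumes K: "has_logs K" "connected K" "K \<noteq> {}" "compact K"
    and loc: "\<And>x U. x \<in> K \<Longrightarrow> open U \<Longrightarrow> x \<in> U \<Longrightarrow>
      \<exists>T P. open T \<and> x \<in> T \<and> T \<inter> K \<subseteq> P \<and> P \<subseteq> U \<inter> K \<and> connected P"
    and FG: "finite F" "finite G"
    and sep: "\<And>g h t. g \<in> G \<Longrightarrow> h \<in> G \<Longrightarrow> g \<noteq> h \<Longrightarrow> t \<notin> F \<Longrightarrow> graph_val g t \<noteq> graph_val h t"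
    and f: "continuous_on K f" "f ` K \<subseteq> graph_complement F G"
  shows "\<exists>c. homotopic_with_canon (\<lambda>_. True) K (graph_complement F G) f (\<lambda>_. c)"
proof -
  note plane = nullhomotopic_into_open_plane[OF K loc]
  have in_fG: "fst (f x) \<notin> F" "\<And>g. g \<in> G \<Longrightarrow> snd (f x) \<noteq> graph_val g (fst (f x))" if "x \<in> K" for x
    using f(2) that unfolding graph_complement_def by (auto simp: image_subset_iff case_prod_unfold)
  have "\<exists>t0. homotopic_with_canon (\<lambda>_. True) K (- F) (fst \<circ> f) (\<lambda>_. t0)"
    using plane[of "fst \<circ> f" "- F"] f(1) in_fG(1) FG(1)
    by (simp add: image_subset_iff finite_imp_closed open_Compl continuous_on_fst o_def)
  then obtain t0 where "homotopic_with_canon (\<lambda>_. True) K (- F) (fst \<circ> f) (\<lambda>_. t0)" ..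
  then obtain T where T: "continuous_on ({0..1::real} \<times> K) T" "T \<in> {0..1} \<times> K \<rightarrow> - F"
    "\<And>x. T (0, x) = fst (f x)" "\<And>x. T (1, x) = t0"
    unfolding homotopic_with_def by auto
  have "\<exists>S. continuous_on ({0..1} \<times> K) S \<and> (\<forall>x\<in>K. S (0, x) = snd (f x)) \<and>
     (\<forall>p\<in>{0..1} \<times> K. \<forall>g\<in>G. S p \<noteq> graph_val g (T p))"
  proof (rule lift_homotopy_avoiding_graphs[OF K(4) T(1) _ FG(2)])
    show "continuous_on K (\<lambda>x. snd (f x))" by (intro continuous_intros f)
    show "graph_val g (T p) \<noteq> graph_val h (T p)" if "g \<in> G" "h \<in> G" "g \<noteq> h" "p \<in> {0..1} \<times> K" for g h p
      using sep that T(2) by blast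
    show "snd (f x) \<noteq> graph_val g (T (0, x))" if "x \<in> K" "g \<in> G" for x g using in_fG that T(3) by simp
  qed
  then obtain S where S: "continuous_on ({0..1} \<times> K) S" "\<And>x. x \<in> K \<Longrightarrow> S (0, x) = snd (f x)"
    "\<And>p g. p \<in> {0..1} \<times> K \<Longrightarrow> g \<in> G \<Longrightarrow> S p \<noteq> graph_val g (T p)" by blast
  \<comment> \<open>The lifted homotopy moves \<open>f\<close> into the fibre over
    \<open>t0\<close>.\<close>
  have 1: "homotopic_with_canon (\<lambda>_. True) K (graph_complement F G) (\<lambda>x. (T (0, x), S (0, x))) (\<lambda>x. (T (1, x), S (1, x)))"
    unfolding homotopic_with_def
  proof (intro exI[of _ "\<lambda>p. (T p, S p)"] conjI)
    show "continuous_map (prod_topology (top_of_set {0..1}) (top_of_set K)) (top_of_set (graph_complement F G)) (\<lambda>p. (T p, S p))"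
      using T(2) S(3) by (auto intro!: continuous_intros T(1) S(1) simp: graph_complement_def)
  qed auto
  have t0: "t0 \<notin> F" 
  proof -
    obtain x where "x \<in> K" using K(3) by blast
    then have "T (1, x) \<in> - F" using T(2) by auto
    then show ?thesis using T(4) by simp
  qed
  \<comment> \<open>The fibre is a plane with finitely many punctures, so the theorem used for the
    base applies once more.\<close>
  have "\<exists>c. homotopic_with_canon (\<lambda>_. True) K {s. \<forall>g\<in>G. s \<noteq> graph_val g t0} (\<lambda>x. S (1, x)) (\<lambda>_. c)"
  proof (rule plane)
    show "continuous_on K (\<lambda>x. S (1, x))"
      by (rule continuous_on_compose2[OF S(1)]) (auto intro!: continuous_intros)
    show "(\<lambda>x. S (1, x)) ` K \<subseteq> {s. \<forall>g\<in>G. s \<noteq> graph_val g t0}"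
    proof (intro image_subsetI CollectI ballI)
      fix x g assume "x \<in> K" "g \<in> G"
      then show "S (1, x) \<noteq> graph_val g t0" using S(3)[of "(1, x)" g] T(4)[of x] by simp
    qed
    have "{s. \<forall>g\<in>G. s \<noteq> graph_val g t0} = - (\<lambda>g. graph_val g t0) ` G" by auto
    then show "open {s. \<forall>g\<in>G. s \<noteq> graph_val g t0}" using FG(2) by (simp add: finite_imp_closed open_Compl)
  qed
  then obtain c where "homotopic_with_canon (\<lambda>_. True) K {s. \<forall>g\<in>G. s \<noteq> graph_val g t0} (\<lambda>x. S (1, x)) (\<lambda>_. c)" ..
  then have "homotopic_with_canon (\<lambda>_. True) K (graph_complement F G) (Pair t0 \<circ> (\<lambda>x. S (1, x))) (Pair t0 \<circ> (\<lambda>_. c))"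
    by (rule homotopic_with_compose_continuous_left) (use t0 in \<open>auto intro!: continuous_intros simp: graph_complement_def\<close>)
  then have 2: "homotopic_with_canon (\<lambda>_. True) K (graph_complement F G) (\<lambda>x. (T (1, x), S (1, x))) (\<lambda>_. (t0, c))"
    by (simp add: T(4) o_def)
  have "homotopic_with_canon (\<lambda>_. True) K (graph_complement F G) f (\<lambda>_. (t0, c))"
    by (rule homotopic_with_eq[OF homotopic_with_trans[OF 1 2]]) (use S(2) T(3) in auto)
  then show ?thesis by blast
qed

text \<open>The section \<open>sec\<close> exceeds all graphs in modulus, since \<open>M\<close> is
  larger than the sum of the norms of all their coefficients. Every point is joined to the section
  inside its fibre, and the section is a copy of the base.\<close>

lemma path_connected_graph_complement:
  assumes FG: "finite F" "finite G"
  shows "path_connected (graph_complement F G)"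
proof -
  define M where "M = (\<Sum>g\<in>G. norm (fst g) + norm (snd g)) + 1"
  define sec where "sec t = (t, complex_of_real (M * (1 + norm t)))" for t :: complex
  have sec_in: "sec t \<in> graph_complement F G" if "t \<notin> F" for t
  proof -
    have "norm (graph_val g t) < M * (1 + norm t)" if g: "g \<in> G" for g
    proof -
      have "norm (fst g) + norm (snd g) \<le> (\<Sum>g\<in>G. norm (fst g) + norm (snd g))"
        using g FG(2) by (intro member_le_sum) auto
      then have M: "norm (fst g) + norm (snd g) < M" unfolding M_def by simp
      have "norm (graph_val g t) \<le> norm (fst g) * norm t + norm (snd g)"
        unfolding graph_val_def by (metis norm_mult norm_triangle_ineq)
      also have "\<dots> \<le> (norm (fst g) + norm (snd g)) * (1 + norm t)" by (simp add: algebra_simps)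
      also have "\<dots> < M * (1 + norm t)" using M by (intro mult_strict_right_mono) (auto simp: add_pos_nonneg)
      finally show ?thesis .
    qed
    moreover have "M > 0" unfolding M_def by (simp add: add_nonneg_pos sum_nonneg)
    then have "norm (complex_of_real (M * (1 + norm t))) = M * (1 + norm t)"
      unfolding norm_of_real by (simp add: abs_of_nonneg)
    ultimately show ?thesis using that unfolding sec_def graph_complement_def by force
  qed
  have "path_connected (- F)" using path_connected_complement_countable[OF _ countable_finite[OF FG(1)]] by simp
  moreover have "continuous_on (- F) sec" unfolding sec_def by (intro continuous_intros)
  ultimately have pc: "path_connected (sec ` (- F))" by (rule path_connected_continuous_image[rotated])
  have to_sec: "path_component (graph_complement F G) (t, s) (sec t)" if ts: "(t, s) \<in> graph_complement F G" for t s
  proof -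
    have "path_connected (- (\<lambda>g. graph_val g t) ` G)"
      using path_connected_complement_countable[of "(\<lambda>g. graph_val g t) ` G"] FG(2) by (simp add: countable_finite)
    then have pt: "path_connected (Pair t ` (- (\<lambda>g. graph_val g t) ` G))"
      by (rule path_connected_continuous_image[rotated]) (intro continuous_intros)
    have sub: "Pair t ` (- (\<lambda>g. graph_val g t) ` G) \<subseteq> graph_complement F G"
      using ts by (auto simp: graph_complement_def)
    have "(t, s) \<in> Pair t ` (- (\<lambda>g. graph_val g t) ` G)" "sec t \<in> Pair t ` (- (\<lambda>g. graph_val g t) ` G)"
      using ts sec_in[of t] by (auto simp: graph_complement_def sec_def)
    then have "path_component (Pair t ` (- (\<lambda>g. graph_val g t) ` G)) (t, s) (sec t)"
      using bspec[OF bspec[OF pt[unfolded path_connected_component]]] by blast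
    then show ?thesis by (rule path_component_of_subset[OF sub])
  qed
  show ?thesis unfolding path_connected_component
  proof (intro ballI)
    fix p q assume p: "p \<in> graph_complement F G" and q: "q \<in> graph_complement F G"
    have "path_component (graph_complement F G) p (sec (fst p))" "path_component (graph_complement F G) q (sec (fst q))"
      using to_sec[of "fst p" "snd p"] to_sec[of "fst q" "snd q"] p q by simp_all
    moreover have "path_component (graph_complement F G) (sec (fst p)) (sec (fst q))"
    proof (rule path_component_of_subset)
      show "sec ` (- F) \<subseteq> graph_complement F G" using sec_in by auto
      have "fst p \<in> - F" "fst q \<in> - F" using p q by (auto simp: graph_complement_def)
      then show "path_component (sec ` (- F)) (sec (fst p)) (sec (fst q))"
        using pc unfolding path_connected_component by blast
    qed
    ultimately show "path_component (graph_complement F G) p q"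
      by (meson path_component_sym path_component_trans)
  qed
qed

section \<open>Lines in the projective plane\<close>

lemma lform_scale: "lform a (c *s v) = c * lform a v" "lform (c *s a) v = c * lform a v"
  by (simp_all add: lform_def algebra_simps)

lemma lform_add: "lform a (v + w) = lform a v + lform a w"
  by (simp add: lform_def algebra_simps)

lemma vec3_eq_0_iff: "(v :: complex ^ 3) = 0 \<longleftrightarrow> v $ 1 = 0 \<and> v $ 2 = 0 \<and> v $ 3 = 0"
  by (simp add: vec_eq_iff forall_3)

lemma self_in_ppt: "v \<in> ppt v"
  unfolding ppt_def by (auto intro: exI[of _ 1])

lemma ppt_eq_if_mem: "w \<in> ppt v \<Longrightarrow> ppt w = ppt v"
proof -
  assume "w \<in> ppt v"
  then obtain c where c: "w = c *s v" "c \<noteq> 0" unfolding ppt_def by auto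
  show ?thesis unfolding ppt_def
  proof (intro set_eqI iffI)
    fix u assume "u \<in> {d *s w | d. d \<noteq> 0}"
    then obtain d where "u = d *s w" "d \<noteq> 0" by auto
    then have "u = (d * c) *s v \<and> d * c \<noteq> 0" using c by (simp add: vector_smult_assoc)
    then show "u \<in> {d *s v | d. d \<noteq> 0}" by blast
  next
    fix u assume "u \<in> {d *s v | d. d \<noteq> 0}"
    then obtain d where "u = d *s v" "d \<noteq> 0" by auto
    then have "u = (d / c) *s w \<and> d / c \<noteq> 0" using c by (simp add: vector_smult_assoc)
    then show "u \<in> {d *s w | d. d \<noteq> 0}" by blast
  qed
qed

lemma P2_eq_ppt: "P \<in> P2 \<Longrightarrow> v \<in> P \<Longrightarrow> P = ppt v"
  unfolding P2_def using ppt_eq_if_mem by auto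

lemma nonzero_if_mem_P2: "P \<in> P2 \<Longrightarrow> v \<in> P \<Longrightarrow> v \<noteq> 0"
  unfolding P2_def ppt_def by (auto simp: vec_eq_iff)

lemma ppt_in_P2: "v \<noteq> 0 \<Longrightarrow> ppt v \<in> P2"
  unfolding P2_def by blast

lemma ppt_in_pline: "v \<noteq> 0 \<Longrightarrow> ppt v \<in> pline a \<longleftrightarrow> lform a v = 0"
proof -
  assume v: "v \<noteq> 0"
  have "(\<forall>w\<in>ppt v. lform a w = 0) \<longleftrightarrow> lform a v = 0"
    using self_in_ppt[of v] by (auto simp: ppt_def lform_scale)
  then show ?thesis using ppt_in_P2[OF v] unfolding pline_def by simp
qed

lemma pline_scale: "c \<noteq> 0 \<Longrightarrow> pline (c *s a) = pline a"
  unfolding pline_def by (simp add: lform_scale)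

lemma vec3_proportional:
  fixes a b :: "complex ^ 3"
  assumes "a \<noteq> 0" "b $ 1 * a $ 2 = b $ 2 * a $ 1" "b $ 1 * a $ 3 = b $ 3 * a $ 1" "b $ 2 * a $ 3 = b $ 3 * a $ 2"
  shows "\<exists>s. b = s *s a"
  using proportional_if_minors[of "a $ 1" "a $ 2" "a $ 3" "b $ 1" "b $ 2" "b $ 3"] assms
  by (auto simp: vec3_eq_0_iff vec_eq_iff forall_3)

definition cross :: "complex ^ 3 \<Rightarrow> complex ^ 3 \<Rightarrow> complex ^ 3" where
  "cross a b = vector [a$2 * b$3 - a$3 * b$2, a$3 * b$1 - a$1 * b$3, a$1 * b$2 - a$2 * b$1]"

lemma cross_nth [simp]: "cross a b $ 1 = a$2 * b$3 - a$3 * b$2" "cross a b $ 2 = a$3 * b$1 - a$1 * b$3"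
  "cross a b $ 3 = a$1 * b$2 - a$2 * b$1"
  by (simp_all add: cross_def)

lemma lform_cross: "lform a (cross a b) = 0" "lform b (cross a b) = 0" "lform (cross a b) a = 0" "lform (cross a b) b = 0"
  by (simp_all add: lform_def algebra_simps)

lemma cross_eq_0_imp: "a \<noteq> 0 \<Longrightarrow> cross a b = 0 \<Longrightarrow> \<exists>s. b = s *s a"
  by (rule vec3_proportional) (auto simp: vec3_eq_0_iff algebra_simps)

text \<open>Each minor of \<open>v\<close> against the cross product is a combination of
  \<open>lform a v\<close> and \<open>lform b v\<close>, whose coefficients are, up to sign, entries
  of \<open>b\<close> and \<open>a\<close>.\<close>

lemma orthogonal_imp_multiple_of_cross:
  assumes "cross a b \<noteq> 0" "lform a v = 0" "lform b v = 0"
  shows "\<exists>s. v = s *s cross a b"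
proof (rule vec3_proportional[OF assms(1)])
  have *: "v $ i * cross a b $ j = v $ j * cross a b $ i"
    if "v $ i * cross a b $ j - v $ j * cross a b $ i = x * lform a v + y * lform b v" for i j x y
    using that assms by simp
  show "v $ 1 * cross a b $ 2 = v $ 2 * cross a b $ 1"
    by (rule *[of _ _ "- b $ 3" "a $ 3"]) (simp add: lform_def algebra_simps)
  show "v $ 1 * cross a b $ 3 = v $ 3 * cross a b $ 1"
    by (rule *[of _ _ "b $ 2" "- a $ 2"]) (simp add: lform_def algebra_simps)
  show "v $ 2 * cross a b $ 3 = v $ 3 * cross a b $ 2"
    by (rule *[of _ _ "- b $ 1" "a $ 1"]) (simp add: lform_def algebra_simps)
qed

lemma lform_commute: "lform a b = lform b a"
  by (simp add: lform_def mult.commute)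

text \<open>The same choice as in \<open>defpoly\<close>, so that \<open>defpoly B\<close> is
  literally the product of the \<open>linpoly (line_form L)\<close>.\<close>

definition line_form :: "ppoint set \<Rightarrow> complex ^ 3" where
  "line_form L = (SOME a. a \<noteq> 0 \<and> L = pline a)"

lemma line_form: "is_line L \<Longrightarrow> line_form L \<noteq> 0 \<and> pline (line_form L) = L"
  unfolding is_line_def line_form_def by (metis (mono_tags, lifting) someI_ex)

lemma ppt_in_line: "is_line L \<Longrightarrow> v \<noteq> 0 \<Longrightarrow> ppt v \<in> L \<longleftrightarrow> lform (line_form L) v = 0"
  using line_form ppt_in_pline by metis

lemma lines_eq_if_proportional:
  assumes "is_line L" "is_line M" "line_form M = s *s line_form L"
  shows "L = M"
proof -
  have "s \<noteq> 0" using line_form[OF assms(2)] assms(3) by auto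
  then show ?thesis using line_form[OF assms(1)] line_form[OF assms(2)] assms(3) pline_scale by metis
qed

text \<open>Coordinates in which the point \<open>v\<close> is the last basis vector and the line of
  \<open>a\<close> is spanned by the last two, hence becomes the line at infinity.\<close>

lemma ex_dual_bases:
  assumes a: "a \<noteq> 0" and v: "v \<noteq> 0" "lform a v = 0"
  shows "\<exists>e1 e2 n1 n2 n3. dual_bases e1 e2 v n1 n2 n3 \<and> lform a e2 = 0"
proof -
  have "\<exists>e2. lform a e2 = 0 \<and> cross e2 v \<noteq> 0"
  proof (rule ccontr)
    assume "\<not> ?thesis"
    then have no: "lform a w = 0 \<Longrightarrow> cross w v = 0" for w by blast
    \<comment> \<open>These vectors span the kernel of \<open>a\<close>, a plane, so they cannot all
      be multiples of \<open>v\<close>.\<close>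
    have w: "lform a (vector [a$2, - a$1, 0]) = 0" "lform a (vector [a$3, 0, - a$1]) = 0" "lform a (vector [0, a$3, - a$2]) = 0"
      by (simp_all add: lform_def)
    have "a = 0" using no[OF w(1)] no[OF w(2)] no[OF w(3)] v a by (auto simp: vec3_eq_0_iff lform_def)
    then show False using a by simp
  qed
  then obtain e2 where e2: "lform a e2 = 0" "cross e2 v \<noteq> 0" by blast
  have "\<exists>e1. lform (cross e2 v) e1 = 1"
  proof -
    consider "cross e2 v $ 1 \<noteq> 0" | "cross e2 v $ 2 \<noteq> 0" | "cross e2 v $ 3 \<noteq> 0" using e2(2) vec3_eq_0_iff by blast
    then show ?thesis
    proof cases
      case 1
      then show ?thesis by (intro exI[of _ "vector [1 / cross e2 v $ 1, 0, 0]"]) (simp add: lform_def del: cross_nth)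
    next
      case 2
      then show ?thesis by (intro exI[of _ "vector [0, 1 / cross e2 v $ 2, 0]"]) (simp add: lform_def del: cross_nth)
    next
      case 3
      then show ?thesis by (intro exI[of _ "vector [0, 0, 1 / cross e2 v $ 3]"]) (simp add: lform_def del: cross_nth)
    qed
  qed
  then obtain e1 where e1: "lform (cross e2 v) e1 = 1" by blast
  have det: "(e2$2 * v$3 - e2$3 * v$2) * e1$1 + (e2$3 * v$1 - e2$1 * v$3) * e1$2 + (e2$1 * v$2 - e2$2 * v$1) * e1$3 = 1"
    using e1 by (simp only: lform_def cross_nth)
  \<comment> \<open>Cramer's rule for a matrix of determinant 1.\<close>
  have "dual_bases e1 e2 v (cross e2 v) (cross v e1) (cross e1 e2)"
    unfolding dual_bases_def
  proof (intro conjI)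
    show "lform (cross e2 v) e1 = 1" by fact
    show "lform (cross v e1) e2 = 1" "lform (cross e1 e2) v = 1"
      using det by (simp_all add: lform_def algebra_simps)
    show "\<forall>i j. e1 $ i * cross e2 v $ j + e2 $ i * cross v e1 $ j + v $ i * cross e1 e2 $ j = (if i = j then 1 else 0)"
      unfolding forall_3 cross_nth by (intro conjI; use det in \<open>simp add: algebra_simps\<close>)
  qed (simp_all add: lform_cross)
  then show ?thesis using e2(1) by blast
qed

lemma lform_combination:
  "lform a (x *s e1 + y *s e2 + z *s e3) = x * lform a e1 + y * lform a e2 + z * lform a e3"
  by (simp add: lform_add lform_scale)

lemma dual_bases_expand:
  assumes "dual_bases e1 e2 e3 n1 n2 n3"
  shows "v = lform n1 v *s e1 + lform n2 v *s e2 + lform n3 v *s e3" 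
    and "a = lform a e1 *s n1 + lform a e2 *s n2 + lform a e3 *s n3"
proof -
  have d: "e1 $ i * n1 $ j + e2 $ i * n2 $ j + e3 $ i * n3 $ j = (if i = j then 1 else 0)" for i j
    using assms unfolding dual_bases_def by blast
  show "v = lform n1 v *s e1 + lform n2 v *s e2 + lform n3 v *s e3"
  proof (subst vec_eq_iff, rule allI)
    fix i
    have "(lform n1 v *s e1 + lform n2 v *s e2 + lform n3 v *s e3) $ i = (\<Sum>j\<in>UNIV. (e1 $ i * n1 $ j + e2 $ i * n2 $ j + e3 $ i * n3 $ j) * v $ j)"
      by (simp add: lform_def sum_3 algebra_simps)
    also have "\<dots> = (\<Sum>j\<in>UNIV. if i = j then v $ j else 0)"
      unfolding d by (intro sum.cong) auto
    finally show "v $ i = (lform n1 v *s e1 + lform n2 v *s e2 + lform n3 v *s e3) $ i" by simp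
  qed
  show "a = lform a e1 *s n1 + lform a e2 *s n2 + lform a e3 *s n3"
  proof (subst vec_eq_iff, rule allI)
    fix i
    have "(lform a e1 *s n1 + lform a e2 *s n2 + lform a e3 *s n3) $ i = (\<Sum>j\<in>UNIV. (e1 $ j * n1 $ i + e2 $ j * n2 $ i + e3 $ j * n3 $ i) * a $ j)"
      by (simp add: lform_def sum_3 algebra_simps)
    also have "\<dots> = (\<Sum>j\<in>UNIV. if j = i then a $ j else 0)"
      unfolding d by (intro sum.cong) auto
    finally show "a $ i = (lform a e1 *s n1 + lform a e2 *s n2 + lform a e3 *s n3) $ i" by simp
  qed
qed

definition modular_point :: "ppoint set set \<Rightarrow> ppoint \<Rightarrow> bool" where
  "modular_point B q \<longleftrightarrow> (\<exists>L\<in>B. q \<in> L) \<and>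
    (\<forall>L\<in>B. \<forall>M\<in>B. L \<noteq> M \<longrightarrow> q \<notin> L \<longrightarrow> q \<notin> M \<longrightarrow> (\<exists>N\<in>B. q \<in> N \<and> L \<inter> M \<subseteq> N))"

lemma modular_forms_if_modular_point:
  assumes B: "line_arrangement B" "modular_point B (ppt v)" and v: "v \<noteq> 0"
    and dual: "dual_bases e1 e2 v n1 n2 n3"
  shows "modular_forms B (\<lambda>L. lform (line_form L) e1) (\<lambda>L. lform (line_form L) e2) (\<lambda>L. lform (line_form L) v)"
proof
  have line: "is_line L" if "L \<in> B" for L using B(1) that unfolding line_arrangement_def by blast
  have in_line: "ppt v \<in> L \<longleftrightarrow> lform (line_form L) v = 0" if "L \<in> B" for L
    using ppt_in_line[OF line[OF that] v] .
  show "finite B" using B(1) unfolding line_arrangement_def by blast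
  show "\<exists>k\<in>B. lform (line_form k) v = 0" using B(2) in_line unfolding modular_point_def by blast
  have nz: "lform (line_form L) e1 \<noteq> 0 \<or> lform (line_form L) e2 \<noteq> 0 \<or> lform (line_form L) v \<noteq> 0" if "L \<in> B" for L
  proof (rule ccontr)
    assume "\<not> ?thesis"
    then have "line_form L = 0" using dual_bases_expand(2)[OF dual, of "line_form L"] by simp
    then show False using line_form[OF line[OF that]] by simp
  qed
  then show "lform (line_form L) e1 \<noteq> 0 \<or> lform (line_form L) e2 \<noteq> 0 \<or> lform (line_form L) v \<noteq> 0" if "L \<in> B" for L
    using that .
  show "\<not> (\<exists>s. lform (line_form M) e1 = s * lform (line_form L) e1 \<and> lform (line_form M) e2 = s * lform (line_form L) e2 \<and>
      lform (line_form M) v = s * lform (line_form L) v)" if LM: "L \<in> B" "M \<in> B" "L \<noteq> M" for L M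
  proof
    assume "\<exists>s. lform (line_form M) e1 = s * lform (line_form L) e1 \<and> lform (line_form M) e2 = s * lform (line_form L) e2 \<and>
      lform (line_form M) v = s * lform (line_form L) v"
    then obtain s where s: "lform (line_form M) e1 = s * lform (line_form L) e1" "lform (line_form M) e2 = s * lform (line_form L) e2"
      "lform (line_form M) v = s * lform (line_form L) v" by blast
    have "line_form M = s *s (lform (line_form L) e1 *s n1 + lform (line_form L) e2 *s n2 + lform (line_form L) v *s n3)"
      by (subst dual_bases_expand(2)[OF dual, of "line_form M"]) (simp add: s vector_add_ldistrib vector_smult_assoc)
    then have "line_form M = s *s line_form L" using dual_bases_expand(2)[OF dual, of "line_form L"] by simp
    then show False using lines_eq_if_proportional line LM by blast
  qed
  fix L M assume LM: "L \<in> B" "M \<in> B" "L \<noteq> M" and \<gamma>: "lform (line_form L) v \<noteq> 0" "lform (line_form M) v \<noteq> 0"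
  obtain N where N: "N \<in> B" "ppt v \<in> N" "L \<inter> M \<subseteq> N"
    using B(2) LM \<gamma> in_line unfolding modular_point_def by blast
  define l m k where "l = line_form L" and "m = line_form M" and "k = line_form N"
  define d1 d2 where "d1 = lform l e1 / lform l v - lform m e1 / lform m v" and "d2 = lform l e2 / lform l v - lform m e2 / lform m v"
  \<comment> \<open>The intersection of \<open>L\<close> and \<open>M\<close>: the two lines have
    equal height where \<open>d1 x + d2 y = 0\<close>, solved by \<open>(d2, - d1)\<close>, and the
    last coefficient is the height on \<open>L\<close>. That \<open>N\<close> contains it is the
    proportionality sought.\<close>
  define w where "w = d2 *s e1 + (- d1) *s e2 + (- (lform l e1 * d2 - lform l e2 * d1) / lform l v) *s v"
  have k0: "lform k v = 0" using in_line N unfolding k_def by blast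
  have "lform l w = 0" unfolding w_def lform_combination using \<gamma>(1) by (simp add: l_def)
  moreover have "lform m w = 0"
  proof -
    have "lform m w / lform m v = (lform m e1 / lform m v) * d2 - (lform m e2 / lform m v) * d1 - (lform l e1 * d2 - lform l e2 * d1) / lform l v"
      unfolding w_def lform_combination using \<gamma>(2) by (simp add: m_def add_divide_distrib diff_divide_distrib mult.commute)
    also have "\<dots> = - d1 * d2 + d2 * d1" unfolding d1_def d2_def by (simp add: algebra_simps diff_divide_distrib)
    finally show ?thesis using \<gamma>(2) by (simp add: m_def)
  qed
  ultimately have lkw: "lform k w = 0"
    using N(3) ppt_in_line line LM N(1) unfolding l_def m_def k_def by (cases "w = 0") (auto simp: lform_def)
  then have kw: "lform k e1 * d2 = lform k e2 * d1"
    unfolding w_def lform_combination using k0 by (simp add: mult.commute)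
  have "\<exists>s. d1 = s * lform k e1 \<and> d2 = s * lform k e2"
  proof (cases "lform k e1 = 0")
    case True
    then have "lform k e2 \<noteq> 0" using nz[OF N(1)] k0 unfolding k_def by blast
    then show ?thesis using True kw by (intro exI[of _ "d2 / lform k e2"]) (auto simp: field_simps)
  next
    case False
    then show ?thesis using kw by (intro exI[of _ "d1 / lform k e1"]) (auto simp: field_simps)
  qed
  then show "\<exists>k\<in>B. lform (line_form k) v = 0 \<and>
      (\<exists>s. lform (line_form L) e1 / lform (line_form L) v - lform (line_form M) e1 / lform (line_form M) v = s * lform (line_form k) e1 \<and>
           lform (line_form L) e2 / lform (line_form L) v - lform (line_form M) e2 / lform (line_form M) v = s * lform (line_form k) e2)"
    using N(1) k0 unfolding d1_def d2_def l_def m_def k_def by blast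
qed

section \<open>The quotient topology and an affine chart\<close>

lemma istopology_P2: "istopology (\<lambda>U. U \<subseteq> P2 \<and> openin (top_of_set (- {0 :: complex ^ 3})) (\<Union>U))"
  unfolding istopology_def
proof (intro conjI allI impI)
  fix S T :: "ppoint set"
  assume S: "S \<subseteq> P2 \<and> openin (top_of_set (- {0 :: complex ^ 3})) (\<Union>S)"
    and T: "T \<subseteq> P2 \<and> openin (top_of_set (- {0 :: complex ^ 3})) (\<Union>T)"
  \<comment> \<open>The points of \<open>P2\<close> are disjoint as sets of vectors, so a vector
    determines the class containing it.\<close>
  have "\<Union>(S \<inter> T) = \<Union>S \<inter> \<Union>T"
  proof
    show "\<Union>S \<inter> \<Union>T \<subseteq> \<Union>(S \<inter> T)"
    proof
      fix v assume "v \<in> \<Union>S \<inter> \<Union>T"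
      then obtain P Q where "P \<in> S" "v \<in> P" "Q \<in> T" "v \<in> Q" by blast
      moreover then have "P = ppt v" "Q = ppt v" using S T P2_eq_ppt by blast+
      ultimately show "v \<in> \<Union>(S \<inter> T)" by blast
    qed
  qed blast
  then show "openin (top_of_set (- {0 :: complex ^ 3})) (\<Union>(S \<inter> T))" using S T by (simp add: openin_Int)
  show "S \<inter> T \<subseteq> P2" using S by blast
next
  fix \<K> :: "ppoint set set"
  assume K: "\<forall>K\<in>\<K>. K \<subseteq> P2 \<and> openin (top_of_set (- {0 :: complex ^ 3})) (\<Union>K)"
  have "\<Union>(\<Union>\<K>) = (\<Union>K\<in>\<K>. \<Union>K)" by blast
  then show "openin (top_of_set (- {0 :: complex ^ 3})) (\<Union>(\<Union>\<K>))" using K by (auto intro: openin_Union)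
  show "\<Union>\<K> \<subseteq> P2" using K by blast
qed

lemma openin_P2top: "openin P2top U \<longleftrightarrow> U \<subseteq> P2 \<and> open (\<Union>U)"
proof -
  have "openin P2top U \<longleftrightarrow> U \<subseteq> P2 \<and> openin (top_of_set (- {0 :: complex ^ 3})) (\<Union>U)"
    unfolding P2top_def using topology_inverse'[OF istopology_P2] by simp
  also have "\<dots> \<longleftrightarrow> U \<subseteq> P2 \<and> open (\<Union>U)"
  proof -
    have "\<Union>U \<subseteq> - {0}" if "U \<subseteq> P2" using that nonzero_if_mem_P2 by blast
    moreover have "open (- {0 :: complex ^ 3})" by (intro open_Compl closed_singleton)
    ultimately show ?thesis using openin_open_eq[of "- {0 :: complex ^ 3}" "\<Union>U"] by blast
  qed
  finally show ?thesis .
qed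

lemma topspace_P2top: "topspace P2top = P2"
proof -
  have "\<Union>P2 = - {0}" using nonzero_if_mem_P2 self_in_ppt ppt_in_P2 by blast
  then have "openin P2top P2" unfolding openin_P2top by (simp add: open_Compl)
  then show ?thesis unfolding topspace_def using openin_P2top by blast
qed

lemma ppt_in_open_iff: "openin P2top U \<Longrightarrow> v \<noteq> 0 \<Longrightarrow> ppt v \<in> U \<longleftrightarrow> v \<in> \<Union>U"
  using self_in_ppt P2_eq_ppt unfolding openin_P2top by blast

lemma continuous_map_ppt:
  fixes f :: "'a::topological_space \<Rightarrow> complex ^ 3"
  assumes f: "continuous_on S f" "\<And>x. x \<in> S \<Longrightarrow> f x \<noteq> 0"
  shows "continuous_map (top_of_set S) P2top (\<lambda>x. ppt (f x))"
  unfolding continuous_map_def topspace_P2top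
proof (intro conjI allI impI)
  show "(\<lambda>x. ppt (f x)) \<in> topspace (top_of_set S) \<rightarrow> P2" using f(2) ppt_in_P2 by auto
  fix U assume U: "openin P2top U"
  have "{x \<in> topspace (top_of_set S). ppt (f x) \<in> U} = S \<inter> f -` \<Union>U"
    using ppt_in_open_iff[OF U] f(2) by auto
  moreover have "open (\<Union>U)" using U by (simp add: openin_P2top)
  ultimately show "openin (top_of_set S) {x \<in> topspace (top_of_set S). ppt (f x) \<in> U}"
    using continuous_openin_preimage_gen[OF f(1)] by simp
qed


lemma ppt_scale: "c \<noteq> 0 \<Longrightarrow> ppt (c *s v) = ppt v"
  by (rule ppt_eq_if_mem) (auto simp: ppt_def)

lemma affine_chart_nonzero:
  assumes "dual_bases e1 e2 e3 n1 n2 n3"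
  shows "e1 + t *s e2 + s *s e3 \<noteq> 0"
proof
  assume 0: "e1 + t *s e2 + s *s e3 = 0"
  have "lform n1 (e1 + t *s e2 + s *s e3) = 1"
    using assms unfolding dual_bases_def by (simp add: lform_add lform_scale)
  then show False unfolding 0 by (simp add: lform_def)
qed

text \<open>In the chart \<open>e1 + t *s e2 + s *s e3\<close>, a line with
  \<open>\<gamma> = 0\<close> is a line of constant \<open>t\<close>, or the line at infinity if
  also \<open>\<beta> = 0\<close>; the other lines are the graphs collected in
  \<open>graph_set\<close>.\<close>

definition vertical_set where
  "vertical_set B \<alpha> \<beta> \<gamma> = {- \<alpha> L / \<beta> L | L. L \<in> B \<and> \<gamma> L = 0 \<and> \<beta> L \<noteq> 0}"

definition graph_set where
  "graph_set B \<alpha> \<beta> \<gamma> = {(- \<beta> L / \<gamma> L, - \<alpha> L / \<gamma> L) | L. L \<in> B \<and> \<gamma> L \<noteq> 0}"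

lemma linear_root_iff: "b \<noteq> 0 \<Longrightarrow> t = - a / b \<longleftrightarrow> a + b * t = 0" for a b t :: complex
proof -
  assume "b \<noteq> 0"
  then have "t = - a / b \<longleftrightarrow> t * b = - a" by (rule nonzero_eq_divide_eq)
  also have "\<dots> \<longleftrightarrow> t * b + a = 0" by (rule eq_neg_iff_add_eq_0)
  finally show ?thesis by (simp only: mult.commute add.commute)
qed

context modular_forms
begin

lemma finite_vertical_set: "finite (vertical_set B \<alpha> \<beta> \<gamma>)"
  unfolding vertical_set_def using finite_B by simp

lemma finite_graph_set: "finite (graph_set B \<alpha> \<beta> \<gamma>)"
  unfolding graph_set_def using finite_B by simp

lemma mem_graph_complement_iff:
  "(t, s) \<in> graph_complement (vertical_set B \<alpha> \<beta> \<gamma>) (graph_set B \<alpha> \<beta> \<gamma>) \<longleftrightarrow>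
    (\<forall>L\<in>B. \<alpha> L + \<beta> L * t + \<gamma> L * s \<noteq> 0)"
proof -
  have v: "t \<notin> vertical_set B \<alpha> \<beta> \<gamma> \<longleftrightarrow> (\<forall>L\<in>B. \<gamma> L = 0 \<longrightarrow> \<alpha> L + \<beta> L * t \<noteq> 0)"
  proof -
    have "t = - \<alpha> L / \<beta> L \<longleftrightarrow> \<alpha> L + \<beta> L * t = 0" if "\<beta> L \<noteq> 0" for L
      by (rule linear_root_iff[OF that])
    moreover have "\<alpha> L + \<beta> L * t \<noteq> 0" if "L \<in> B" "\<gamma> L = 0" "\<beta> L = 0" for L
      using nonzero[OF that(1)] that by simp
    ultimately show ?thesis unfolding vertical_set_def by blast
  qed
  have g: "(\<forall>g\<in>graph_set B \<alpha> \<beta> \<gamma>. s \<noteq> graph_val g t) \<longleftrightarrow> (\<forall>L\<in>B. \<gamma> L \<noteq> 0 \<longrightarrow> \<alpha> L + \<beta> L * t + \<gamma> L * s \<noteq> 0)"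
  proof -
    have "s = graph_val (- \<beta> L / \<gamma> L, - \<alpha> L / \<gamma> L) t \<longleftrightarrow> \<alpha> L + \<beta> L * t + \<gamma> L * s = 0" if "\<gamma> L \<noteq> 0" for L
    proof -
      have "\<alpha> L + \<beta> L * t + \<gamma> L * s = \<gamma> L * (s - graph_val (- \<beta> L / \<gamma> L, - \<alpha> L / \<gamma> L) t)"
        using that by (simp add: graph_val_def field_simps)
      then show ?thesis using that by simp
    qed
    then show ?thesis unfolding graph_set_def by blast
  qed
  show ?thesis unfolding graph_complement_def using v g by auto
qed

text \<open>By modularity the difference of two graphs is a nonzero multiple of the form of a line
  through the modular point, so they can only meet over a value of \<open>t\<close> that has been
  removed.\<close>

lemma graph_set_separated:
  assumes g: "g \<in> graph_set B \<alpha> \<beta> \<gamma>" "g' \<in> graph_set B \<alpha> \<beta> \<gamma>" "g \<noteq> g'" and t: "t \<notin> vertical_set B \<alpha> \<beta> \<gamma>"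
  shows "graph_val g t \<noteq> graph_val g' t"
proof
  assume eq: "graph_val g t = graph_val g' t"
  obtain L M where LM: "L \<in> B" "\<gamma> L \<noteq> 0" "g = (- \<beta> L / \<gamma> L, - \<alpha> L / \<gamma> L)" "M \<in> B" "\<gamma> M \<noteq> 0" "g' = (- \<beta> M / \<gamma> M, - \<alpha> M / \<gamma> M)"
    using g unfolding graph_set_def by blast
  then have "L \<noteq> M" using g(3) by blast
  then obtain k s where k: "k \<in> B" "\<gamma> k = 0" "\<alpha> L / \<gamma> L - \<alpha> M / \<gamma> M = s * \<alpha> k" "\<beta> L / \<gamma> L - \<beta> M / \<gamma> M = s * \<beta> k"
    using modular[OF LM(1,4) _ LM(2,5)] by blast
  have "s \<noteq> 0" using k(3,4) g(3) LM(3,6) by auto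
  have "s * (\<alpha> k + \<beta> k * t) = (\<alpha> L / \<gamma> L - \<alpha> M / \<gamma> M) + (\<beta> L / \<gamma> L - \<beta> M / \<gamma> M) * t"
    unfolding k(3,4) by (simp only: distrib_left mult.assoc)
  also have "\<dots> = graph_val g' t - graph_val g t"
    unfolding LM(3,6) graph_val_def by (simp add: left_diff_distrib)
  finally have "s * (\<alpha> k + \<beta> k * t) = graph_val g' t - graph_val g t" .
  then have 0: "\<alpha> k + \<beta> k * t = 0" using eq \<open>s \<noteq> 0\<close> by simp
  then have "\<beta> k \<noteq> 0" using nonzero[OF k(1)] k(2) by auto
  moreover have "t = - \<alpha> k / \<beta> k" using 0 linear_root_iff[OF \<open>\<beta> k \<noteq> 0\<close>] by blast
  ultimately show False using t k(1,2) unfolding vertical_set_def by blast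
qed

end

text \<open>A map \<open>f\<close> into a retract factors as
  \<open>\<phi> \<circ> (\<psi> \<circ> f)\<close>, so a contraction in \<open>S\<close> can be
  carried over by \<open>\<phi>\<close>.\<close>

lemma K_pi_1_retract:
  assumes \<phi>: "continuous_map (top_of_set S) X \<phi>" and \<psi>: "continuous_map X (top_of_set S) \<psi>"
    and id: "\<And>x. x \<in> topspace X \<Longrightarrow> \<phi> (\<psi> x) = x"
    and S: "path_connected S"
    and null: "\<And>n f. n \<ge> 2 \<Longrightarrow> continuous_on (Sph n) f \<Longrightarrow> f ` Sph n \<subseteq> S \<Longrightarrow>
      \<exists>c. homotopic_with_canon (\<lambda>_. True) (Sph n) S f (\<lambda>_. c)"
  shows "K_pi_1 X"
  unfolding K_pi_1_def
proof (intro conjI allI impI)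
  have "\<phi> ` S = topspace X"
  proof
    show "\<phi> ` S \<subseteq> topspace X" using \<phi> by (auto simp: continuous_map_def)
    show "topspace X \<subseteq> \<phi> ` S"
    proof
      fix x assume x: "x \<in> topspace X"
      then have "\<psi> x \<in> S" using \<psi> by (auto simp: continuous_map_def)
      then show "x \<in> \<phi> ` S" using id[OF x] by (metis imageI)
    qed
  qed
  moreover have "path_connectedin (top_of_set S) S" using S by (simp add: path_connectedin_subtopology)
  ultimately have "path_connectedin X (topspace X)"
    using path_connectedin_continuous_map_image[OF \<phi>, of S] by simp
  then show "path_connected_space X" by (simp add: path_connectedin_topspace)
  fix n :: nat and f assume n: "2 \<le> n" and f: "continuous_map (nsphere n) X f"
  have "continuous_map (top_of_set (Sph n)) (top_of_set S) (\<psi> \<circ> f)"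
    using continuous_map_compose[OF f \<psi>] by (simp add: nsphere_eq_top_of_set)
  then have "continuous_on (Sph n) (\<psi> \<circ> f)" "(\<psi> \<circ> f) ` Sph n \<subseteq> S"
    by (auto simp: continuous_map_in_subtopology)
  from null[OF n this] obtain c where "homotopic_with_canon (\<lambda>_. True) (Sph n) S (\<psi> \<circ> f) (\<lambda>_. c)" ..
  from homotopic_with_compose_continuous_map_left[OF this \<phi>, of "\<lambda>_. True"]
  have "homotopic_with (\<lambda>_. True) (nsphere n) X (\<phi> \<circ> (\<psi> \<circ> f)) (\<phi> \<circ> (\<lambda>_. c))"
    by (simp add: nsphere_eq_top_of_set)
  moreover have "f x = (\<phi> \<circ> (\<psi> \<circ> f)) x" if "x \<in> topspace (nsphere n)" for x
    using id[of "f x"] f that by (auto simp: continuous_map_def Pi_iff)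
  ultimately have "homotopic_with (\<lambda>_. True) (nsphere n) X f (\<lambda>_. \<phi> c)"
    by (rule homotopic_with_eq) auto
  then show "\<exists>c. homotopic_with (\<lambda>_. True) (nsphere n) X f (\<lambda>_. c)" by blast
qed

text \<open>The form of \<open>L0\<close> is a multiple of \<open>n1\<close>. Off this line the
  first coordinate is therefore nonzero, and the complement is identified with a graph complement in
  the chart where that coordinate is 1.\<close>

lemma K_pi_1_if_modular_point:
  assumes B: "line_arrangement B" "modular_point B (ppt v)" and v: "v \<noteq> 0"
    and dual: "dual_bases e1 e2 v n1 n2 n3" and L0: "L0 \<in> B" "lform (line_form L0) e2 = 0" "lform (line_form L0) v = 0"
  shows "K_pi_1 (arr_complement B)"
proof -
  let ?\<alpha> = "\<lambda>L. lform (line_form L) e1" and ?\<beta> = "\<lambda>L. lform (line_form L) e2" and ?\<gamma> = "\<lambda>L. lform (line_form L) v"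
  interpret modular_forms B ?\<alpha> ?\<beta> ?\<gamma>
    by (rule modular_forms_if_modular_point[OF B v dual])
  define S where "S = graph_complement (vertical_set B ?\<alpha> ?\<beta> ?\<gamma>) (graph_set B ?\<alpha> ?\<beta> ?\<gamma>)"
  have line: "is_line L" if "L \<in> B" for L using B(1) that unfolding line_arrangement_def by blast
  define vec where "vec p = e1 + fst p *s e2 + snd p *s v" for p :: "complex \<times> complex"
  define \<phi> where "\<phi> p = ppt (vec p)" for p
  have vec_nz: "vec p \<noteq> 0" for p unfolding vec_def by (rule affine_chart_nonzero[OF dual])
  have lform_vec: "lform a (vec p) = lform a e1 + lform a e2 * fst p + lform a v * snd p" for a p
    by (simp add: vec_def lform_add lform_scale mult.commute)
  have S_iff: "p \<in> S \<longleftrightarrow> \<phi> p \<in> P2 - \<Union>B" for p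
  proof -
    have "p \<in> S \<longleftrightarrow> (\<forall>L\<in>B. lform (line_form L) (vec p) \<noteq> 0)"
      unfolding S_def lform_vec using mem_graph_complement_iff[of "fst p" "snd p"] by simp
    also have "\<dots> \<longleftrightarrow> \<phi> p \<in> P2 - \<Union>B"
      using ppt_in_P2[OF vec_nz] ppt_in_line[OF line vec_nz] by (auto simp: \<phi>_def)
    finally show ?thesis .
  qed
  have cont_vec: "continuous_on S vec"
    unfolding vec_def vector_scalar_mult_def by (intro continuous_intros)
  have \<phi>: "continuous_map (top_of_set S) (arr_complement B) \<phi>"
    unfolding arr_complement_def continuous_map_in_subtopology \<phi>_def
    using continuous_map_ppt[OF cont_vec vec_nz] S_iff by (auto simp: \<phi>_def)
  define \<rho> where "\<rho> w = (lform n2 w / lform n1 w, lform n3 w / lform n1 w)" for w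
  \<comment> \<open>The affine coordinates \<open>\<rho>\<close> are invariant under scaling, so the
    choice of the representative is immaterial.\<close>
  define \<psi> where "\<psi> P = \<rho> (SOME w. w \<in> P)" for P :: ppoint
  have \<psi>: "\<psi> (ppt w) = \<rho> w" for w
  proof -
    have "(SOME u. u \<in> ppt w) \<in> ppt w" by (rule someI[of "\<lambda>u. u \<in> ppt w", OF self_in_ppt])
    then obtain c where "(SOME u. u \<in> ppt w) = c *s w" "c \<noteq> 0" unfolding ppt_def by blast
    then show ?thesis unfolding \<psi>_def \<rho>_def by (simp add: lform_scale)
  qed
  have n1_nz: "lform n1 w \<noteq> 0" if "w \<noteq> 0" "ppt w \<notin> L0" for w
  proof -
    have "lform (line_form L0) w = ?\<alpha> L0 * lform n1 w"
      by (subst dual_bases_expand(2)[OF dual, of "line_form L0"]) (simp add: L0 lform_add lform_scale)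
    then show ?thesis using that ppt_in_line[OF line[OF L0(1)] that(1)] by auto
  qed
  have id: "\<phi> (\<psi> P) = P" if P: "P \<in> P2" "P \<notin> L0" for P
  proof -
    obtain w where w: "P = ppt w" "w \<noteq> 0" using P unfolding P2_def by blast
    have nz: "lform n1 w \<noteq> 0" using n1_nz w P by blast
    have "vec (\<rho> w) = (1 / lform n1 w) *s (lform n1 w *s e1 + lform n2 w *s e2 + lform n3 w *s v)"
      using nz by (simp add: vec_def \<rho>_def vector_add_ldistrib vector_smult_assoc)
    also have "\<dots> = (1 / lform n1 w) *s w" using dual_bases_expand(1)[OF dual, of w] by simp
    finally show ?thesis unfolding w(1) \<psi> \<phi>_def using nz by (simp add: ppt_scale)
  qed
  have top: "topspace (arr_complement B) = P2 - \<Union>B"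
    unfolding arr_complement_def by (auto simp: topspace_P2top)
  have cont_lform: "continuous_on A (lform a)" for A a
    unfolding lform_def by (intro continuous_intros)
  have \<psi>_cont: "continuous_map (arr_complement B) (top_of_set S) \<psi>"
    unfolding continuous_map_in_subtopology
  proof (intro conjI)
    show "\<psi> \<in> topspace (arr_complement B) \<rightarrow> S"
      unfolding top using S_iff id L0(1) by auto
    show "continuous_map (arr_complement B) euclidean \<psi>"
      unfolding continuous_map_def
    proof (intro conjI allI impI)
      fix V :: "(complex \<times> complex) set" assume "openin euclidean V"
      then have V: "open V" by simp
      \<comment> \<open>The preimage of \<open>V\<close> in the entire chart. Its union in the
        vector space is the preimage of \<open>V\<close> under \<open>\<rho>\<close>, which shows
        that it is open.\<close>
      define U where "U = {P \<in> P2. \<exists>w\<in>P. lform n1 w \<noteq> 0 \<and> \<rho> w \<in> V}"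
      have "\<Union>U = {w. lform n1 w \<noteq> 0} \<inter> \<rho> -` V"
      proof (intro set_eqI iffI)
        fix w assume "w \<in> \<Union>U"
        then obtain P u where P: "P \<in> P2" "w \<in> P" "u \<in> P" "lform n1 u \<noteq> 0" "\<rho> u \<in> V" unfolding U_def by blast
        then have "w \<in> ppt u" using P2_eq_ppt by blast
        then obtain c where "w = c *s u" "c \<noteq> 0" unfolding ppt_def by blast
        then show "w \<in> {w. lform n1 w \<noteq> 0} \<inter> \<rho> -` V" using P by (simp add: \<rho>_def lform_scale)
      next
        fix w assume w: "w \<in> {w. lform n1 w \<noteq> 0} \<inter> \<rho> -` V"
        then have "w \<noteq> 0" by (auto simp: lform_def)
        then show "w \<in> \<Union>U" using w ppt_in_P2 self_in_ppt[of w] unfolding U_def by blast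
      qed
      moreover have "open ({w. lform n1 w \<noteq> 0} \<inter> \<rho> -` V)"
      proof (rule continuous_open_preimage[OF _ _ V])
        show "open {w. lform n1 w \<noteq> 0}" by (intro open_Collect_neq cont_lform continuous_intros)
        show "continuous_on {w. lform n1 w \<noteq> 0} \<rho>" unfolding \<rho>_def by (intro continuous_intros cont_lform) auto
      qed
      ultimately have opU: "openin P2top U" unfolding openin_P2top by (auto simp: U_def)
      have eq: "{P \<in> topspace (arr_complement B). \<psi> P \<in> V} = (P2 - \<Union>B) \<inter> U"
      proof (intro set_eqI iffI)
        fix P assume "P \<in> {P \<in> topspace (arr_complement B). \<psi> P \<in> V}"
        then have P: "P \<in> P2 - \<Union>B" "\<psi> P \<in> V" unfolding top by auto
        then obtain w where w: "P = ppt w" "w \<noteq> 0" unfolding P2_def by blast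
        then have "lform n1 w \<noteq> 0" using n1_nz P L0(1) by blast
        then show "P \<in> (P2 - \<Union>B) \<inter> U" using P w self_in_ppt[of w] \<psi>[of w] unfolding U_def by auto
      next
        fix P assume P: "P \<in> (P2 - \<Union>B) \<inter> U"
        then obtain w where w: "w \<in> P" "\<rho> w \<in> V" unfolding U_def by blast
        then have "P = ppt w" using P2_eq_ppt P by blast
        then show "P \<in> {P \<in> topspace (arr_complement B). \<psi> P \<in> V}" unfolding top using P w \<psi>[of w] by auto
      qed
      show "openin (arr_complement B) {P \<in> topspace (arr_complement B). \<psi> P \<in> V}"
        unfolding eq unfolding arr_complement_def openin_subtopology using opU by blast
    qed auto
  qed
  show ?thesis
  proof (rule K_pi_1_retract[OF \<phi> \<psi>_cont])
    show "\<phi> (\<psi> P) = P" if "P \<in> topspace (arr_complement B)" for P using that id L0(1) unfolding top by blast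
    show "path_connected S" unfolding S_def
      by (intro path_connected_graph_complement finite_vertical_set finite_graph_set)
    fix n :: nat and f assume n: "n \<ge> 2" and f: "continuous_on (Sph n) f" "f ` Sph n \<subseteq> S"
    show "\<exists>c. homotopic_with_canon (\<lambda>_. True) (Sph n) S f (\<lambda>_. c)"
      unfolding S_def
      by (rule nullhomotopic_into_graph_complement[OF has_logs_Sph[OF n] connected_Sph[OF n] Sph_nonempty compact_Sph
            locally_connected_Sph finite_vertical_set finite_graph_set graph_set_separated f[unfolded S_def]])
  qed
qed

lemma free_and_K_pi_1_if_modular_point:
  assumes B: "line_arrangement B" "modular_point B q" and q: "q \<in> P2"
  shows "free_arrangement B \<and> K_pi_1 (arr_complement B)"
proof -
  obtain v where v: "q = ppt v" "v \<noteq> 0" using q unfolding P2_def by blast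
  obtain L0 where L0: "L0 \<in> B" "q \<in> L0" using B(2) unfolding modular_point_def by blast
  have line: "is_line L0" using B(1) L0 unfolding line_arrangement_def by blast
  have L0v: "lform (line_form L0) v = 0" using ppt_in_line[OF line v(2)] L0 v(1) by simp
  obtain e1 e2 n1 n2 n3 where dual: "dual_bases e1 e2 v n1 n2 n3" and e2: "lform (line_form L0) e2 = 0"
    using ex_dual_bases[OF _ v(2) L0v] line_form[OF line] by blast
  have mod: "modular_point B (ppt v)" using B(2) v(1) by simp
  have "K_pi_1 (arr_complement B)"
    by (rule K_pi_1_if_modular_point[OF B(1) mod v(2) dual L0(1) e2 L0v])
  moreover have "free_arrangement B"
    using free_AR_if_modular_forms[OF dual modular_forms_if_modular_point[OF B(1) mod v(2) dual]]
    unfolding free_arrangement_def defpoly_def line_form_def .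
  ultimately show ?thesis by blast
qed

section \<open>Joining a point to the multiple points of an arrangement\<close>

definition meet :: "ppoint set \<Rightarrow> ppoint set \<Rightarrow> complex ^ 3" where
  "meet L M = cross (line_form L) (line_form M)"

lemma meet_nonzero:
  assumes "is_line L" "is_line M" "L \<noteq> M"
  shows "meet L M \<noteq> 0"
  using cross_eq_0_imp[of "line_form L" "line_form M"] lines_eq_if_proportional[OF assms(1,2)] line_form[OF assms(1)] assms(3)
  unfolding meet_def by blast

lemma mem_two_lines_iff:
  assumes "is_line L" "is_line M" "L \<noteq> M"
  shows "q \<in> L \<and> q \<in> M \<longleftrightarrow> q = ppt (meet L M)"
proof
  assume "q = ppt (meet L M)"
  then show "q \<in> L \<and> q \<in> M"
    using meet_nonzero[OF assms] ppt_in_line assms by (simp add: meet_def lform_cross)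
next
  assume q: "q \<in> L \<and> q \<in> M"
  then have "q \<in> P2" using line_form[OF assms(1)] unfolding pline_def by blast
  then obtain w where w: "q = ppt w" "w \<noteq> 0" unfolding P2_def by blast
  then have "lform (line_form L) w = 0" "lform (line_form M) w = 0" using q ppt_in_line assms by auto
  then obtain s where s: "w = s *s meet L M"
    using orthogonal_imp_multiple_of_cross meet_nonzero[OF assms] unfolding meet_def by blast
  then have "s \<noteq> 0" using w(2) by auto
  then show "q = ppt (meet L M)" using s w(1) ppt_scale by simp
qed

lemma pline_through_two_points:
  assumes "is_line L" "v \<noteq> 0" "w \<noteq> 0" "ppt v \<in> L" "ppt w \<in> L" "ppt v \<noteq> ppt w"
  shows "cross v w \<noteq> 0" "L = pline (cross v w)"
proof -
  show nz: "cross v w \<noteq> 0"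
  proof
    assume "cross v w = 0"
    then obtain s where "w = s *s v" using cross_eq_0_imp assms(2) by blast
    moreover then have "s \<noteq> 0" using assms(3) by auto
    ultimately show False using assms(6) ppt_scale by simp
  qed
  have "lform v (line_form L) = 0" "lform w (line_form L) = 0"
    using ppt_in_line[OF assms(1)] assms(2-5) by (simp_all add: lform_commute)
  then obtain s where s: "line_form L = s *s cross v w" using orthogonal_imp_multiple_of_cross[OF nz] by blast
  then have "s \<noteq> 0" using line_form[OF assms(1)] by auto
  then show "L = pline (cross v w)" using line_form[OF assms(1)] s pline_scale by metis
qed

lemma multiple_point_iff:
  assumes "line_arrangement A"
  shows "multiple_point A q \<longleftrightarrow> (\<exists>L\<in>A. \<exists>M\<in>A. L \<noteq> M \<and> q = ppt (meet L M))"
proof -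
  have line: "is_line L" if "L \<in> A" for L using assms that unfolding line_arrangement_def by blast
  define R where "R \<longleftrightarrow> (\<exists>L\<in>A. \<exists>M\<in>A. L \<noteq> M \<and> q = ppt (meet L M))"
  have fin: "finite {L \<in> A. q \<in> L}" using assms unfolding line_arrangement_def by simp
  have "card {L \<in> A. q \<in> L} \<ge> 2 \<longleftrightarrow> (\<exists>L\<in>A. \<exists>M\<in>A. L \<noteq> M \<and> q \<in> L \<and> q \<in> M)"
  proof
    assume "card {L \<in> A. q \<in> L} \<ge> 2"
    then have "\<not> card {L \<in> A. q \<in> L} \<le> Suc 0" by simp
    then show "\<exists>L\<in>A. \<exists>M\<in>A. L \<noteq> M \<and> q \<in> L \<and> q \<in> M" using card_le_Suc0_iff_eq[OF fin] by blast
  next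
    assume "\<exists>L\<in>A. \<exists>M\<in>A. L \<noteq> M \<and> q \<in> L \<and> q \<in> M"
    then have "\<not> card {L \<in> A. q \<in> L} \<le> Suc 0" using card_le_Suc0_iff_eq[OF fin] by blast
    then show "card {L \<in> A. q \<in> L} \<ge> 2" by simp
  qed
  also have "\<dots> \<longleftrightarrow> R"
    unfolding R_def using mem_two_lines_iff line by meson
  finally have "card {L \<in> A. q \<in> L} \<ge> 2 \<longleftrightarrow> R" .
  moreover have "q \<in> P2" if R
  proof -
    from that obtain L M where "L \<in> A" "M \<in> A" "L \<noteq> M" "q = ppt (meet L M)" unfolding R_def by blast
    then show ?thesis using ppt_in_P2 meet_nonzero[OF line line] by simp
  qed
  ultimately show ?thesis unfolding multiple_point_def R_def[symmetric] by blast
qed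

text \<open>Indexing the added lines by pairs of lines of \<open>A\<close> shows that there are
  finitely many and gives each an explicit form.\<close>

lemma Barr_eq:
  assumes A: "line_arrangement A" and v: "v \<noteq> 0" "\<forall>L\<in>A. ppt v \<notin> L"
  shows "Barr A (ppt v) = A \<union> {pline (cross v (meet L M)) | L M. L \<in> A \<and> M \<in> A \<and> L \<noteq> M}"
    and "\<And>L M. L \<in> A \<Longrightarrow> M \<in> A \<Longrightarrow> L \<noteq> M \<Longrightarrow> cross v (meet L M) \<noteq> 0"
proof -
  have line: "is_line L" if "L \<in> A" for L using A that unfolding line_arrangement_def by blast
  have ne: "ppt v \<noteq> ppt (meet L M)" if "L \<in> A" "M \<in> A" "L \<noteq> M" for L M
    using mem_two_lines_iff[OF line[OF that(1)] line[OF that(2)] that(3), of "ppt (meet L M)"] v(2) that by metis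
  show nz: "cross v (meet L M) \<noteq> 0" if LM: "L \<in> A" "M \<in> A" "L \<noteq> M" for L M
  proof
    assume "cross v (meet L M) = 0"
    then obtain s where s: "meet L M = s *s v" using cross_eq_0_imp v(1) by blast
    then have "s \<noteq> 0" using meet_nonzero[OF line[OF LM(1)] line[OF LM(2)] LM(3)] by auto
    then show False using ne[OF LM] s ppt_scale by simp
  qed
  have "{L. is_line L \<and> ppt v \<in> L \<and> (\<exists>q. multiple_point A q \<and> q \<in> L)} =
      {pline (cross v (meet L M)) | L M. L \<in> A \<and> M \<in> A \<and> L \<noteq> M}"
  proof (intro set_eqI iffI)
    fix N assume "N \<in> {L. is_line L \<and> ppt v \<in> L \<and> (\<exists>q. multiple_point A q \<and> q \<in> L)}"
    then obtain L M where N: "is_line N" "ppt v \<in> N" "ppt (meet L M) \<in> N" "L \<in> A" "M \<in> A" "L \<noteq> M"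
      unfolding multiple_point_iff[OF A] by blast
    then have "N = pline (cross v (meet L M))"
      by (intro pline_through_two_points(2)[OF N(1) v(1)] meet_nonzero line ne)
    with N(4-6) show "N \<in> {pline (cross v (meet L M)) | L M. L \<in> A \<and> M \<in> A \<and> L \<noteq> M}"
      by (intro CollectI exI[of _ L] exI[of _ M] conjI)
  next
    fix N assume "N \<in> {pline (cross v (meet L M)) | L M. L \<in> A \<and> M \<in> A \<and> L \<noteq> M}"
    then obtain L M where N: "N = pline (cross v (meet L M))" "L \<in> A" "M \<in> A" "L \<noteq> M" by blast
    have "is_line N" unfolding is_line_def N(1) using nz[OF N(2-4)] by (intro exI[of _ "cross v (meet L M)"]) simp
    moreover have "ppt v \<in> N" unfolding N(1) by (simp add: ppt_in_pline[OF v(1)] lform_cross)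
    moreover have "ppt (meet L M) \<in> N"
      unfolding N(1) using ppt_in_pline[OF meet_nonzero[OF line[OF N(2)] line[OF N(3)] N(4)]] by (simp add: lform_cross)
    moreover have "multiple_point A (ppt (meet L M))"
      unfolding multiple_point_iff[OF A] using N(2-4) by (intro bexI[of _ L] bexI[of _ M] conjI refl)
    ultimately show "N \<in> {L. is_line L \<and> ppt v \<in> L \<and> (\<exists>q. multiple_point A q \<and> q \<in> L)}"
      by (intro CollectI conjI exI[of _ "ppt (meet L M)"])
  qed
  then show "Barr A (ppt v) = A \<union> {pline (cross v (meet L M)) | L M. L \<in> A \<and> M \<in> A \<and> L \<noteq> M}"
    unfolding Barr_def by simp
qed

lemma line_arrangement_Barr:
  assumes A: "line_arrangement A" and v: "v \<noteq> 0" "\<forall>L\<in>A. ppt v \<notin> L"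
  shows "line_arrangement (Barr A (ppt v))"
proof -
  have "{pline (cross v (meet L M)) | L M. L \<in> A \<and> M \<in> A \<and> L \<noteq> M} \<subseteq> (\<lambda>(L, M). pline (cross v (meet L M))) ` (A \<times> A)"
    by auto
  then have "finite {pline (cross v (meet L M)) | L M. L \<in> A \<and> M \<in> A \<and> L \<noteq> M}"
    using A unfolding line_arrangement_def by (meson finite_SigmaI finite_imageI finite_subset)
  moreover have "is_line N" if "N \<in> Barr A (ppt v)" for N
    using that A unfolding Barr_def line_arrangement_def by blast
  ultimately show ?thesis using A unfolding line_arrangement_def Barr_eq(1)[OF A v] by blast
qed

text \<open>Lines of the new arrangement that miss the point already belong to \<open>A\<close>. Two
  of them meet in a single multiple point of \<open>A\<close>, whose join with the given point has
  been added.\<close>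

lemma modular_point_Barr:
  assumes A: "line_arrangement A" and v: "v \<noteq> 0" "\<forall>L\<in>A. ppt v \<notin> L"
    and two: "L1 \<in> A" "L2 \<in> A" "L1 \<noteq> L2"
  shows "modular_point (Barr A (ppt v)) (ppt v)"
  unfolding modular_point_def
proof (intro conjI ballI impI)
  have line: "is_line L" if "L \<in> A" for L using A that unfolding line_arrangement_def by blast
  have join: "pline (cross v (meet L M)) \<in> Barr A (ppt v)" "ppt v \<in> pline (cross v (meet L M))"
      "ppt (meet L M) \<in> pline (cross v (meet L M))" if LM: "L \<in> A" "M \<in> A" "L \<noteq> M" for L M
  proof -
    show "pline (cross v (meet L M)) \<in> Barr A (ppt v)" using Barr_eq(1)[OF A v] LM by blast
    show "ppt v \<in> pline (cross v (meet L M))" by (simp add: ppt_in_pline[OF v(1)] lform_cross)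
    show "ppt (meet L M) \<in> pline (cross v (meet L M))"
      using ppt_in_pline[OF meet_nonzero[OF line[OF LM(1)] line[OF LM(2)] LM(3)]] by (simp add: lform_cross)
  qed
  show "\<exists>L\<in>Barr A (ppt v). ppt v \<in> L" using join[OF two] by blast
  fix L M assume LM: "L \<in> Barr A (ppt v)" "M \<in> Barr A (ppt v)" "L \<noteq> M" "ppt v \<notin> L" "ppt v \<notin> M"
  then have A: "L \<in> A" "M \<in> A" unfolding Barr_def by blast+
  have "L \<inter> M \<subseteq> {ppt (meet L M)}" using mem_two_lines_iff[OF line[OF A(1)] line[OF A(2)] LM(3)] by blast
  then show "\<exists>N\<in>Barr A (ppt v). ppt v \<in> N \<and> L \<inter> M \<subseteq> N" using join[OF A LM(3)] by blast
qed

text \<open>For empty \<open>A\<close> nothing is added and the complement is the whole projective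
  plane, whose second homotopy group is infinite cyclic; hence the hypothesis that \<open>A\<close>
  is nonempty.\<close>

theorem theorem1p13:
  assumes "line_arrangement A" and "A \<noteq> {}"
    and "p \<in> P2" and "\<forall>L\<in>A. p \<notin> L"
  shows "free_arrangement (Barr A p) \<and> K_pi_1 (arr_complement (Barr A p))"
proof -
  obtain v where v: "p = ppt v" "v \<noteq> 0" using assms(3) unfolding P2_def by blast
  have off: "\<forall>L\<in>A. ppt v \<notin> L" using assms(4) v(1) by simp
  have arr: "line_arrangement (Barr A p)" unfolding v(1) by (rule line_arrangement_Barr[OF assms(1) v(2) off])
  show ?thesis
  proof (cases "\<exists>L1\<in>A. \<exists>L2\<in>A. L1 \<noteq> L2")
    case True
    then have "modular_point (Barr A p) p" unfolding v(1) using modular_point_Barr[OF assms(1) v(2) off] by blast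
    then show ?thesis by (rule free_and_K_pi_1_if_modular_point[OF arr _ assms(3)])
  next
    case False
    then obtain L where L: "A = {L}" using assms(2) by blast
    \<comment> \<open>A single line has no multiple points, so no line through \<open>p\<close> is
      added, and a point of \<open>L\<close> has to take over the role of \<open>p\<close>.\<close>
    then have Barr: "Barr A p = {L}" using Barr_eq(1)[OF assms(1) v(2) off] unfolding v(1) by auto
    have line: "is_line L" using assms(1) L unfolding line_arrangement_def by blast
    \<comment> \<open>The cross product of the form with any vector not parallel to it represents a
      point of the line.\<close>
    have "\<exists>w. w \<noteq> 0 \<and> lform (line_form L) w = 0"
    proof (cases "cross (line_form L) v = 0")
      case False
      then show ?thesis using lform_cross(1) by blast
    next
      case True
      obtain u where "cross (line_form L) u \<noteq> 0"
      proof -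
        have "cross (line_form L) (axis 1 1) \<noteq> 0 \<or> cross (line_form L) (axis 2 1) \<noteq> 0"
          using line_form[OF line] by (auto simp: vec3_eq_0_iff axis_def)
        then show ?thesis using that by blast
      qed
      then show ?thesis using lform_cross(1) by blast
    qed
    then obtain w where w: "w \<noteq> 0" "lform (line_form L) w = 0" by blast
    then have "modular_point {L} (ppt w)" using ppt_in_line[OF line w(1)] unfolding modular_point_def by simp
    then show ?thesis using free_and_K_pi_1_if_modular_point[OF arr] ppt_in_P2[OF w(1)] unfolding Barr by blast
  qed
qed

end
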